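(* Let $d\ge1$ be an integer, $T>0$, let $b\in L^2([0,T];L^2(\mathbb{T}^d))$ be a divergence-free vector field, and let $u_0\in L^2(\mathbb{T}^d)$. Then there exists at most one parabolic solution to the Cauchy problem $\partial_t u+\operatorname{div}(bu)=\Delta u$ in $(0,T)\times\mathbb{T}^d$, $u|_{t=0}=u_0$.
   Context: $\mathbb{T}^d=\mathbb{R}^d/\mathbb{Z}^d$ is the flat torus. A vector field $b:[0,T]\times\mathbb{T}^d\to\mathbb{R}^d$ is divergence-free if $\operatorname{div}_x b=0$ in the sense of distributions. Parabolic solution: for $b\in L^1([0,T];L^2(\mathbb{T}^d))$ divergence-free and $u_0\in L^2(\mathbb{T}^d)$, a function $u\in L^\infty([0,T];L^2(\mathbb{T}^d))$ is a parabolic solution if $u\in L^2([0,T];H^1(\mathbb{T}^d))$ and $u$ is a distributional solution, i.e. for every $\varphi\in C_c^\infty([0,T)\times\mathbb{T}^d)$ $$\int_0^T\int_{\mathbb{T}^d}u(\partial_t\varphi+b\cdot\nabla\varphi+\Delta\varphi)\,dx\,dt+\int_{\mathbb{T}^d}u_0\,\varphi(0,\cdot)\,dx=0.$$ Functions are identified when equal almost everywhere. *)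

theory Defs
  imports "HOL-Analysis.Analysis"
begin

text \<open>
  Functions on the flat torus of dimension \<open>d = CARD('n)\<close> are functions on \<open>real ^ 'n\<close> that are
  1-periodic in every coordinate; integrals over the torus are Lebesgue integrals over the unit cube.
  Functions of time and space are curried, \<open>u t x\<close>, with time ranging over \<open>{0..T}\<close>; their values at
  other times are irrelevant. Elements of the \<open>L\<^sup>p\<close> spaces are represented by functions, and equality
  in these spaces is equality almost everywhere.
\<close>

definition torus_periodic :: "(real ^ 'n \<Rightarrow> 'b) \<Rightarrow> bool" where
  "torus_periodic f \<longleftrightarrow> (\<forall>x i. f (x + axis i 1) = f x)"

definition torus_measure :: "(real ^ 'n) measure" where
  "torus_measure = lebesgue_on (cbox 0 1)"

definition spacetime_measure :: "real \<Rightarrow> (real \<times> (real ^ 'n)) measure" where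
  "spacetime_measure T = lebesgue_on ({0..T} \<times> cbox 0 1)"


subsection \<open>Smooth functions and differential operators\<close>

primrec Ck :: "nat \<Rightarrow> ('a::euclidean_space \<Rightarrow> real) \<Rightarrow> bool" where
  "Ck 0 f \<longleftrightarrow> continuous_on UNIV f"
| "Ck (Suc k) f \<longleftrightarrow> (\<forall>x. f differentiable (at x)) \<and>
     (\<forall>e\<in>Basis. Ck k (\<lambda>x. frechet_derivative f (at x) e))"

definition smooth :: "('a::euclidean_space \<Rightarrow> real) \<Rightarrow> bool" where
  "smooth f \<longleftrightarrow> (\<forall>k. Ck k f)"

definition partial_deriv :: "'n \<Rightarrow> (real ^ 'n \<Rightarrow> real) \<Rightarrow> real ^ 'n \<Rightarrow> real" where
  "partial_deriv i f x = frechet_derivative f (at x) (axis i 1)"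

definition grad :: "(real ^ 'n \<Rightarrow> real) \<Rightarrow> real ^ 'n \<Rightarrow> real ^ 'n" where
  "grad f x = (\<chi> i. partial_deriv i f x)"

definition laplacian :: "(real ^ 'n \<Rightarrow> real) \<Rightarrow> real ^ 'n \<Rightarrow> real" where
  "laplacian f x = (\<Sum>i\<in>UNIV. partial_deriv i (partial_deriv i f) x)"

text \<open>
  Smooth functions on \<open>I\<close> times the torus with compact support, for \<open>I = {0<..<T}\<close> or \<open>I = {0..<T}\<close>.
  They are represented by smooth functions on all of space-time, of which only the restriction to
  times in \<open>I\<close> matters; for \<open>I = {0..<T}\<close> this means smoothness up to the boundary \<open>t = 0\<close>.
  As the torus is compact, the support is compact iff it lies over a compact set of times.
\<close>

definition test_function :: "real set \<Rightarrow> (real \<Rightarrow> real ^ 'n \<Rightarrow> real) \<Rightarrow> bool" where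
  "test_function I \<phi> \<longleftrightarrow>
     smooth (\<lambda>(t, x). \<phi> t x) \<and> (\<forall>t. torus_periodic (\<phi> t)) \<and>
     (\<exists>K. compact K \<and> K \<subseteq> I \<and> (\<forall>t\<in>I - K. \<forall>x. \<phi> t x = 0))"


subsection \<open>Function spaces\<close>

definition L2_norm_sq :: "(real ^ 'n \<Rightarrow> 'b::euclidean_space) \<Rightarrow> ennreal" where
  "L2_norm_sq f = (\<integral>\<^sup>+ x. ennreal ((norm (f x))\<^sup>2) \<partial>torus_measure)"

definition in_L2 :: "(real ^ 'n \<Rightarrow> 'b::euclidean_space) \<Rightarrow> bool" where
  "in_L2 f \<longleftrightarrow> torus_periodic f \<and> f \<in> borel_measurable torus_measure \<and> L2_norm_sq f < \<infinity>"

text \<open>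
  Strongly measurable maps from \<open>[0,T]\<close> to \<open>L\<^sup>2\<close> of the torus are represented by jointly measurable
  functions of time and space.
\<close>

definition spacetime_measurable ::
    "real \<Rightarrow> (real \<Rightarrow> real ^ 'n \<Rightarrow> 'b::euclidean_space) \<Rightarrow> bool" where
  "spacetime_measurable T u \<longleftrightarrow>
     (\<forall>t\<in>{0..T}. torus_periodic (u t)) \<and> (\<lambda>(t, x). u t x) \<in> borel_measurable (spacetime_measure T)"

definition in_L2_L2 :: "real \<Rightarrow> (real \<Rightarrow> real ^ 'n \<Rightarrow> 'b::euclidean_space) \<Rightarrow> bool" where
  "in_L2_L2 T u \<longleftrightarrow> spacetime_measurable T u \<and>
     (\<integral>\<^sup>+ t. L2_norm_sq (u t) \<partial>lebesgue_on {0..T}) < \<infinity>"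

definition in_Linf_L2 :: "real \<Rightarrow> (real \<Rightarrow> real ^ 'n \<Rightarrow> 'b::euclidean_space) \<Rightarrow> bool" where
  "in_Linf_L2 T u \<longleftrightarrow> spacetime_measurable T u \<and>
     (\<exists>C::real. AE t in lebesgue_on {0..T}. L2_norm_sq (u t) \<le> ennreal C)"

definition weak_gradient :: "(real ^ 'n \<Rightarrow> real) \<Rightarrow> (real ^ 'n \<Rightarrow> real ^ 'n) \<Rightarrow> bool" where
  "weak_gradient f G \<longleftrightarrow> (\<forall>\<psi> i. smooth \<psi> \<and> torus_periodic \<psi> \<longrightarrow>
     (LINT x|torus_measure. f x * partial_deriv i \<psi> x) = - (LINT x|torus_measure. (G x $ i) * \<psi> x))"

definition in_L2_H1 :: "real \<Rightarrow> (real \<Rightarrow> real ^ 'n \<Rightarrow> real) \<Rightarrow> bool" where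
  "in_L2_H1 T u \<longleftrightarrow> in_L2_L2 T u \<and>
     (\<exists>G. in_L2_L2 T G \<and> (AE t in lebesgue_on {0..T}. weak_gradient (u t) (G t)))"


subsection \<open>The Cauchy problem\<close>

definition divergence_free :: "real \<Rightarrow> (real \<Rightarrow> real ^ 'n \<Rightarrow> real ^ 'n) \<Rightarrow> bool" where
  "divergence_free T b \<longleftrightarrow> (\<forall>\<phi>. test_function {0<..<T} \<phi> \<longrightarrow>
     (LINT t|lebesgue_on {0..T}. LINT x|torus_measure. b t x \<bullet> grad (\<phi> t) x) = 0)"

definition distributional_solution ::
    "real \<Rightarrow> (real \<Rightarrow> real ^ 'n \<Rightarrow> real ^ 'n) \<Rightarrow> (real ^ 'n \<Rightarrow> real) \<Rightarrow>
     (real \<Rightarrow> real ^ 'n \<Rightarrow> real) \<Rightarrow> bool" where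
  "distributional_solution T b u0 u \<longleftrightarrow> (\<forall>\<phi>. test_function {0..<T} \<phi> \<longrightarrow>
     (LINT t|lebesgue_on {0..T}. LINT x|torus_measure.
        u t x * (deriv (\<lambda>s. \<phi> s x) t + b t x \<bullet> grad (\<phi> t) x + laplacian (\<phi> t) x))
     + (LINT x|torus_measure. u0 x * \<phi> 0 x) = 0)"

definition parabolic_solution ::
    "real \<Rightarrow> (real \<Rightarrow> real ^ 'n \<Rightarrow> real ^ 'n) \<Rightarrow> (real ^ 'n \<Rightarrow> real) \<Rightarrow>
     (real \<Rightarrow> real ^ 'n \<Rightarrow> real) \<Rightarrow> bool" where
  "parabolic_solution T b u0 u \<longleftrightarrow>
     in_Linf_L2 T u \<and> in_L2_H1 T u \<and> distributional_solution T b u0 u"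

end

theory Submission
  imports Defs "HOL-Computational_Algebra.Polynomial"
begin

text \<open>
  Let \<open>w\<close> be the difference of two solutions and \<open>G\<close> its weak gradient. Then \<open>w\<close> solves the same
  equation with initial datum zero, and one would like to multiply the equation by \<open>w\<close> and to use that
  \<open>b \<bullet> G w\<close> is half of \<open>b \<bullet> \<nabla>(w\<^sup>2)\<close>, whose integral vanishes because \<open>b\<close> is divergence-free. This is not
  possible directly: \<open>b\<close> and \<open>G\<close> are square-integrable, so that \<open>b \<bullet> G\<close> is merely integrable, while \<open>w\<close>
  need not be bounded. Therefore \<open>w\<^sup>2\<close> is replaced by \<open>\<beta>(w) = sqrt (1 + w\<^sup>2) - 1\<close> (\<open>soft_abs\<close>), which is
  convex, vanishes only at zero and has a derivative bounded by one (\<open>soft_sgn\<close>).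

  To make the computation legitimate, \<open>w\<close> is convolved in space with smooth periodic kernels \<open>K n\<close>.
  The mollification \<open>W\<close> solves, at each point, an ordinary differential equation in time, with right-hand
  side \<open>F = \<Delta>W - (b \<bullet> G) * K n\<close> (\<open>AE_eq_primitive\<close>, \<open>mollified_flux_eq\<close>). Convexity gives the chain rule
  for \<open>\<beta>(W)\<close> as an inequality (\<open>soft_abs_primitive_le\<close>), and integration over the torus bounds
  \<open>\<integral> \<beta>(W t)\<close> by the time integral of the positive part of \<open>\<integral> \<beta>'(W) F\<close> (\<open>energy_inequality\<close>). In the
  latter integral the diffusion contributes
  \<open>- \<integral> \<beta>''(W) \<bar>\<nabla>W\<bar>\<^sup>2 \<le> 0\<close>, and the transport contributes \<open>- \<integral> (b \<bullet> G) (\<beta>'(W) * K n)\<close>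
  (\<open>soft_sgn_flux_le\<close>).

  As \<open>n\<close> grows, the transport term converges to \<open>- \<integral> b \<bullet> G \<beta>'(w)\<close>. This is also the limit of the
  integrals of \<open>- b \<bullet> \<nabla>(\<beta>(W))\<close>, which vanish because \<open>b\<close> is divergence-free (\<open>commutator_vanishes\<close>).
  The transport term is dominated by \<open>\<integral> \<bar>b\<bar>\<^sup>2 + \<bar>G\<bar>\<^sup>2\<close>, an integrable function of time. Hence
  \<open>\<integral> \<beta>(w t) \<le> 0\<close> for almost every \<open>t\<close>, and \<open>w\<close> vanishes almost everywhere.

  All of this takes place at almost every fixed time. Fubini's theorem is made available by passing to
  Borel representatives of \<open>u\<close>, \<open>v\<close>, \<open>b\<close> and the gradients; and since the kernels form a sequence
  and the mollified quantities are continuous in space, countably many exceptional null sets of times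
  have to be discarded.
\<close>

section \<open>Smooth functions\<close>

lemma Ck_SucI:
  assumes "\<And>x. (f has_derivative D x) (at x)" and "\<And>e. e \<in> Basis \<Longrightarrow> Ck k (\<lambda>x. D x e)"
  shows "Ck (Suc k) f"
proof -
  have "frechet_derivative f (at x) = D x" for x
    using frechet_derivative_at[OF assms(1)] by simp
  then show ?thesis
    using assms by (auto simp: differentiable_def)
qed

lemma Ck_SucD:
  assumes "Ck (Suc k) f"
  shows "(f has_derivative frechet_derivative f (at x)) (at x)"
    and "e \<in> Basis \<Longrightarrow> Ck k (\<lambda>x. frechet_derivative f (at x) e)"
  using assms by (auto simp: frechet_derivative_works)

lemma Ck_lower: "Ck (Suc k) f \<Longrightarrow> Ck k f"
proof (induction k arbitrary: f)
  case 0
  then show ?case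
    by (auto simp: continuous_on_eq_continuous_at intro: differentiable_imp_continuous_within)
next
  case (Suc k)
  then show ?case by (auto simp del: Ck.simps(1))
qed

lemma Ck_const: "Ck k (\<lambda>x. c)"
proof (induction k arbitrary: c)
  case (Suc k)
  show ?case
    by (rule Ck_SucI[where D = "\<lambda>x h. 0"]) (use Suc in \<open>auto intro!: derivative_eq_intros\<close>)
qed auto

lemma Ck_add: "Ck k f \<Longrightarrow> Ck k g \<Longrightarrow> Ck k (\<lambda>x. f x + g x)"
proof (induction k arbitrary: f g)
  case 0
  then show ?case by (auto intro: continuous_intros)
next
  case (Suc k)
  show ?case
    by (rule Ck_SucI, rule has_derivative_add[OF Ck_SucD(1)[OF Suc.prems(1)] Ck_SucD(1)[OF Suc.prems(2)]])
      (intro Suc.IH Ck_SucD(2)[OF Suc.prems(1)] Ck_SucD(2)[OF Suc.prems(2)])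
qed

lemma Ck_mult: "Ck k f \<Longrightarrow> Ck k g \<Longrightarrow> Ck k (\<lambda>x. f x * g x)"
proof (induction k arbitrary: f g)
  case 0
  then show ?case by (auto intro: continuous_intros)
next
  case (Suc k)
  show ?case
    by (rule Ck_SucI, rule has_derivative_mult[OF Ck_SucD(1)[OF Suc.prems(1)] Ck_SucD(1)[OF Suc.prems(2)]])
      (intro Ck_add Suc.IH Ck_SucD(2)[OF Suc.prems(1)] Ck_SucD(2)[OF Suc.prems(2)]
         Ck_lower[OF Suc.prems(1)] Ck_lower[OF Suc.prems(2)])
qed

lemma Ck_sum: "(\<And>i. i \<in> I \<Longrightarrow> Ck k (f i)) \<Longrightarrow> Ck k (\<lambda>x. \<Sum>i\<in>I. f i x)"
  by (induction I rule: infinite_finite_induct) (auto intro: Ck_const Ck_add)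

lemma Ck_prod: "(\<And>i. i \<in> I \<Longrightarrow> Ck k (f i)) \<Longrightarrow> Ck k (\<lambda>x. \<Prod>i\<in>I. f i x)"
  by (induction I rule: infinite_finite_induct) (auto intro: Ck_const Ck_mult)

text \<open>
  The derivative of the composition along a basis vector is a linear combination, with constant
  coefficients, of derivatives of \<open>f\<close> along basis vectors, again composed with the affine map.
\<close>

lemma Ck_affine:
  fixes L :: "'a::euclidean_space \<Rightarrow> 'b::euclidean_space"
  assumes L: "bounded_linear L"
  shows "Ck k f \<Longrightarrow> Ck k (\<lambda>x. f (L x + c))"
proof (induction k arbitrary: f)
  case 0
  then show ?case
    by (auto intro!: continuous_on_compose2[of UNIV f "UNIV" "\<lambda>x. L x + c"]
        continuous_on_add linear_continuous_on[OF L] continuous_on_const)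
next
  case (Suc k)
  let ?D = "\<lambda>x. frechet_derivative f (at x)"
  note D = Ck_SucD(1)[OF Suc.prems]
  have 1: "((\<lambda>x. f (L x + c)) has_derivative (\<lambda>h. ?D (L x + c) (L h))) (at x)" for x
    by (rule has_derivative_compose[OF _ D, of "\<lambda>x. L x + c"])
      (auto intro!: derivative_eq_intros bounded_linear.has_derivative[OF L])
  have 2: "?D y (L e) = (\<Sum>i\<in>Basis. (L e \<bullet> i) * ?D y i)" for y e
  proof -
    have lin: "linear (?D y)" using D has_derivative_linear by blast
    have "?D y (L e) = ?D y (\<Sum>i\<in>Basis. (L e \<bullet> i) *\<^sub>R i)"
      by (simp add: euclidean_representation)
    also have "\<dots> = (\<Sum>i\<in>Basis. (L e \<bullet> i) * ?D y i)"
      by (simp add: linear_sum[OF lin] linear_scale[OF lin])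
    finally show ?thesis .
  qed
  show ?case
    by (rule Ck_SucI[OF 1], unfold 2)
      (intro Ck_sum Ck_mult Ck_const Suc.IH Ck_SucD(2)[OF Suc.prems])
qed

text \<open>
  The outer function is given together with the sequence \<open>h\<close> of its iterated derivatives. The chain
  rule then leads from \<open>h j\<close> to \<open>h (Suc j)\<close>, and the induction closes for all \<open>j\<close> at once.
\<close>

lemma Ck_chain:
  assumes h: "\<And>j s. (h j has_real_derivative h (Suc j) s) (at s)"
  shows "Ck k f \<Longrightarrow> Ck k (\<lambda>x. h j (f x))"
proof (induction k arbitrary: f j)
  case 0
  have "continuous_on UNIV (h j)"
    by (rule DERIV_continuous_on[where D = "h (Suc j)"]) (rule h)
  with 0 show ?case
    using continuous_on_compose2[of UNIV "h j" UNIV f] by simp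
next
  case (Suc k)
  have "((\<lambda>x. h j (f x)) has_derivative (\<lambda>e. h (Suc j) (f x) * frechet_derivative f (at x) e)) (at x)" for x
    by (rule has_derivative_compose[OF Ck_SucD(1)[OF Suc.prems]])
      (use h in \<open>simp add: has_field_derivative_def\<close>)
  then show ?case
    by (rule Ck_SucI) (intro Ck_mult Suc.IH Ck_lower[OF Suc.prems] Ck_SucD(2)[OF Suc.prems])
qed

lemma Ck_linear: "bounded_linear (f :: 'a::euclidean_space \<Rightarrow> real) \<Longrightarrow> Ck k f"
proof (induction k)
  case 0
  then show ?case by (auto intro: linear_continuous_on)
next
  case (Suc k)
  show ?case
    by (rule Ck_SucI[OF bounded_linear.has_derivative[OF Suc.prems has_derivative_ident]])
      (rule Ck_const)
qed

lemma smooth_mult: "smooth f \<Longrightarrow> smooth g \<Longrightarrow> smooth (\<lambda>x. f x * g x)"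
  by (simp add: smooth_def Ck_mult)

lemma smooth_affine:
  "bounded_linear L \<Longrightarrow> smooth f \<Longrightarrow> smooth (\<lambda>x. f (L x + c))"
  by (simp add: smooth_def Ck_affine)

lemma smooth_has_derivative:
  "smooth f \<Longrightarrow> (f has_derivative frechet_derivative f (at x)) (at x)"
  unfolding smooth_def using Ck_SucD(1)[of 0] by blast

lemma smooth_continuous: "smooth f \<Longrightarrow> continuous_on UNIV f"
  unfolding smooth_def using Ck.simps(1) by blast

lemma smooth_partial_deriv:
  assumes "smooth f"
  shows "smooth (partial_deriv i f)"
proof -
  have "Ck k (\<lambda>x. frechet_derivative f (at x) (axis i 1))" for k
    using assms by (intro Ck_SucD(2)) (auto simp: smooth_def simp del: Ck.simps)
  then show ?thesis
    by (simp add: smooth_def partial_deriv_def[abs_def])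
qed

section \<open>A family of smooth functions vanishing on a half-line\<close>

text \<open>
  For \<open>p = 1\<close> this is the classical smooth function with all derivatives zero at the origin. Admitting a
  polynomial factor in \<open>1 / s\<close> makes the family closed under differentiation.
\<close>

definition flat :: "real poly \<Rightarrow> real \<Rightarrow> real" where
  "flat p s = (if s > 0 then poly p (1 / s) * exp (- (1 / s)) else 0)"

lemma poly_exp_decay: "((\<lambda>x. poly p x * exp (- x)) \<longlongrightarrow> (0::real)) at_top"
proof -
  have "((\<lambda>x. \<Sum>i\<le>degree p. coeff p i * (x ^ i / exp x)) \<longlongrightarrow> (\<Sum>i\<le>degree p. coeff p i * 0)) at_top"
    by (intro tendsto_sum tendsto_mult tendsto_const tendsto_power_div_exp_0)
  then show ?thesis
    by (simp add: poly_altdef sum_divide_distrib exp_minus divide_inverse sum_distrib_right mult.assoc)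
qed

lemma flat_DERIV:
  "(flat p has_real_derivative flat ([:0, 0, 1:] * (p - pderiv p)) s) (at s)"
proof -
  consider "s > 0" | "s < 0" | "s = 0" by linarith
  then show ?thesis
  proof cases
    case 1
    have "((\<lambda>s. poly p (1 / s) * exp (- (1 / s))) has_real_derivative
        flat ([:0, 0, 1:] * (p - pderiv p)) s) (at s)"
    proof -
      have "((\<lambda>s. poly p (1 / s)) has_real_derivative poly (pderiv p) (1 / s) * (- (1 / s\<^sup>2))) (at s)"
        by (rule DERIV_chain2[OF poly_DERIV])
          (use 1 in \<open>auto intro!: derivative_eq_intros simp: power2_eq_square\<close>)
      moreover have "((\<lambda>s. exp (- (1 / s))) has_real_derivative exp (- (1 / s)) * (1 / s\<^sup>2)) (at s)"
        using 1 by (auto intro!: derivative_eq_intros simp: power2_eq_square)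
      ultimately have "((\<lambda>s. poly p (1 / s) * exp (- (1 / s))) has_real_derivative
        poly (pderiv p) (1 / s) * (- (1 / s\<^sup>2)) * exp (- (1 / s)) +
        exp (- (1 / s)) * (1 / s\<^sup>2) * poly p (1 / s)) (at s)"
        by (rule DERIV_mult)
      also have "poly (pderiv p) (1 / s) * (- (1 / s\<^sup>2)) * exp (- (1 / s)) +
        exp (- (1 / s)) * (1 / s\<^sup>2) * poly p (1 / s) = flat ([:0, 0, 1:] * (p - pderiv p)) s"
        using 1 by (simp add: flat_def power2_eq_square algebra_simps)
      finally show ?thesis .
    qed
    then show ?thesis
      by (rule has_field_derivative_transform_within_open[where S = "{0<..}"])
        (use 1 in \<open>auto simp: flat_def\<close>)
  next
    case 2
    have "((\<lambda>s. 0) has_real_derivative 0) (at s)" by simp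
    then have "(flat p has_real_derivative 0) (at s)"
      by (rule has_field_derivative_transform_within_open[where S = "{..<0}"])
        (use 2 in \<open>auto simp: flat_def\<close>)
    then show ?thesis using 2 by (simp add: flat_def)
  next
    case 3
    \<comment> \<open>The quotient by \<open>h\<close> is absorbed by one more power of \<open>1 / h\<close> in the polynomial.\<close>
    have "((\<lambda>h. flat p h / h) \<longlongrightarrow> 0) (at_right 0)"
    proof -
      have "((\<lambda>h::real. poly (pCons 0 p) (inverse h) * exp (- inverse h)) \<longlongrightarrow> 0) (at_right 0)"
        by (rule filterlim_compose[OF poly_exp_decay filterlim_inverse_at_top_right])
      then show ?thesis
        by (rule Lim_transform_eventually)
          (auto simp: eventually_at_right_field flat_def divide_inverse mult_ac intro!: exI[of _ 1])
    qed
    moreover have "((\<lambda>h. flat p h / h) \<longlongrightarrow> 0) (at_left 0)"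
      by (rule Lim_transform_eventually[OF tendsto_const])
        (auto simp: eventually_at_left_field flat_def intro!: exI[of _ "-1"])
    ultimately have "((\<lambda>h. flat p h / h) \<longlongrightarrow> 0) (at 0)"
      by (simp add: filterlim_split_at)
    then show ?thesis using 3 by (simp add: DERIV_def flat_def)
  qed
qed

lemma smooth_flat: "smooth (flat p)"
proof -
  define q where "q j = ((\<lambda>p. [:0, 0, 1:] * (p - pderiv p)) ^^ j) p" for j
  have "Ck k (\<lambda>s. flat (q 0) s)" for k
  proof (rule Ck_chain[where h = "\<lambda>j. flat (q j)"])
    show "(flat (q j) has_real_derivative flat (q (Suc j)) s) (at s)" for j s
      using flat_DERIV[of "q j" s] by (simp only: q_def funpow.simps o_apply)
    show "Ck k (\<lambda>s. s)"
      by (rule Ck_linear) (rule bounded_linear_ident)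
  qed
  then show ?thesis unfolding smooth_def q_def by (simp only: funpow.simps id_apply) simp
qed

section \<open>Periodic functions and integration on the torus\<close>

lemma torus_periodic_add_int:
  assumes "torus_periodic f"
  shows "f (x + of_int m *\<^sub>R axis i 1) = f x"
proof (induction m arbitrary: x rule: int_induct[where k = 0])
  case (step1 m)
  have "f (x + of_int (m + 1) *\<^sub>R axis i 1) = f ((x + of_int m *\<^sub>R axis i 1) + axis i 1)"
    by (simp add: algebra_simps)
  with assms step1 show ?case by (simp add: torus_periodic_def)
next
  case (step2 m)
  have "f (x + of_int (m - 1) *\<^sub>R axis i 1) = f ((x + of_int (m - 1) *\<^sub>R axis i 1) + axis i 1)"
    using assms by (simp add: torus_periodic_def)
  also have "\<dots> = f (x + of_int m *\<^sub>R axis i 1)"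
    by (simp add: algebra_simps)
  finally show ?case using step2 by simp
qed auto

lemma torus_periodic_add_lattice:
  assumes "torus_periodic f" "finite A"
  shows "f (x + (\<Sum>i\<in>A. of_int (m i) *\<^sub>R axis i 1)) = f x"
  using assms(2)
proof (induction A arbitrary: x)
  case (insert i A)
  then have "f (x + (\<Sum>i\<in>insert i A. of_int (m i) *\<^sub>R axis i 1))
      = f ((x + (\<Sum>i\<in>A. of_int (m i) *\<^sub>R axis i 1)) + of_int (m i) *\<^sub>R axis i 1)"
    by (simp add: algebra_simps)
  with insert show ?case by (simp add: torus_periodic_add_int[OF assms(1)])
qed auto

lemma vec_sum_axis: "(\<Sum>i\<in>UNIV. c i *\<^sub>R axis i (1::real)) = (\<chi> i. c i)"
  by (simp add: vec_eq_iff axis_def if_distrib cong: if_cong)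

text \<open>
  Moves a point into the unit cube, where compactness provides bounds.
\<close>

lemma torus_periodic_frac:
  fixes f :: "real ^ 'n \<Rightarrow> 'b"
  assumes "torus_periodic f"
  shows "f (\<chi> i. frac (x $ i)) = f x"
proof -
  have eq: "(\<chi> i. frac (x $ i)) = x + (\<Sum>i\<in>UNIV. of_int (- \<lfloor>x $ i\<rfloor>) *\<^sub>R axis i 1)"
    unfolding vec_sum_axis by (simp add: vec_eq_iff frac_def)
  show ?thesis
    unfolding eq by (rule torus_periodic_add_lattice[OF assms]) simp
qed

lemma frac_in_cube: "(\<chi> i. frac (x $ i)) \<in> cbox 0 (1 :: real ^ 'n)"
  by (simp add: mem_box_cart less_imp_le[OF frac_lt_1])

lemma torus_periodic_bounded:
  fixes f :: "real ^ 'n \<Rightarrow> real"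
  assumes "torus_periodic f" "continuous_on UNIV f"
  obtains B where "B \<ge> 0" "\<And>x. \<bar>f x\<bar> \<le> B"
proof -
  have "bounded (f ` cbox 0 1)"
    by (intro compact_imp_bounded compact_continuous_image continuous_on_subset[OF assms(2)]) auto
  then obtain B where B: "\<And>x. x \<in> cbox 0 1 \<Longrightarrow> \<bar>f x\<bar> \<le> B"
    by (auto simp: bounded_iff)
  have "\<bar>f x\<bar> \<le> max B 0" for x
    using B[OF frac_in_cube[of x]] torus_periodic_frac[OF assms(1), of x] by simp
  then show ?thesis by (intro that[of "max B 0"]) auto
qed

abbreviation \<T> :: "(real ^ 'n) measure" where
  "\<T> \<equiv> torus_measure"

lemma space_torus [simp]: "space \<T> = cbox 0 1"
  by (simp add: torus_measure_def)

lemma emeasure_torus: "emeasure \<T> (cbox 0 (1 :: real ^ 'n)) = 1"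
proof -
  have "emeasure lborel (cbox 0 (1 :: real ^ 'n)) = 1"
    by (subst emeasure_lborel_cbox) (auto simp: Basis_vec_def inner_axis intro!: prod.neutral)
  then show ?thesis
    by (simp add: torus_measure_def emeasure_restrict_space)
qed

interpretation torus: finite_measure "\<T> :: (real ^ 'n) measure"
  by standard (simp add: emeasure_torus)

lemma measure_torus [simp]: "measure \<T> (cbox 0 (1 :: real ^ 'n)) = 1"
  by (simp add: measure_def emeasure_torus)

lemma torus_borel_measurable:
  "f \<in> borel_measurable borel \<Longrightarrow> f \<in> borel_measurable \<T>"
  unfolding torus_measure_def
  by (intro measurable_restrict_space1) (simp add: measurable_completion)

lemma torus_continuous_integrable:
  fixes f :: "real ^ 'n \<Rightarrow> real"
  assumes "continuous_on UNIV f"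
  shows "integrable \<T> f"
  unfolding torus_measure_def
  by (rule continuous_imp_integrable) (rule continuous_on_subset[OF assms], simp)

lemma torus_integral_HK:
  fixes f :: "real ^ 'n \<Rightarrow> real"
  assumes "continuous_on UNIV f"
  shows "(LINT x|\<T>. f x) = integral (cbox 0 1) f"
  using torus_continuous_integrable[OF assms] unfolding torus_measure_def
  by (intro lebesgue_integral_eq_integral) auto

text \<open>
  The shifted cube is cut along the hyperplane on which the shifted coordinate equals one. Moving the part
  beyond it back by one period reassembles the unit cube.
\<close>

lemma torus_integral_shift_small:
  fixes f :: "real ^ 'n \<Rightarrow> real"
  assumes per: "torus_periodic f" and cont: "continuous_on UNIV f" and s: "0 \<le> s" "s \<le> 1"
  shows "(LINT x|\<T>. f (x + s *\<^sub>R axis i 1)) = (LINT x|\<T>. f x)"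
proof -
  let ?e = "axis i 1 :: real ^ 'n"
  define c where "c = s *\<^sub>R ?e"
  have c: "c $ j = (if j = i then s else 0)" for j
    by (simp add: c_def axis_def)
  have e: "?e $ j = (if j = i then 1 else 0)" for j
    by (simp add: axis_def)
  have all_split: "(\<forall>j. P j) \<longleftrightarrow> P i \<and> (\<forall>j. j \<noteq> i \<longrightarrow> P j)" for P
    by auto
  let ?R = "\<lambda>x. \<forall>j. j \<noteq> i \<longrightarrow> 0 \<le> x $ j \<and> x $ j \<le> 1"
  have box: "x \<in> cbox c (1 + c) \<longleftrightarrow> (s \<le> x $ i \<and> x $ i \<le> 1 + s) \<and> ?R x"
      "x \<in> cbox 0 1 \<longleftrightarrow> (0 \<le> x $ i \<and> x $ i \<le> 1) \<and> ?R x"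
      "x \<in> cbox ?e (1 + c) \<longleftrightarrow> (1 \<le> x $ i \<and> x $ i \<le> 1 + s) \<and> ?R x"
      "x \<in> cbox 0 (1 + c - ?e) \<longleftrightarrow> (0 \<le> x $ i \<and> x $ i \<le> s) \<and> ?R x" for x
    unfolding mem_box_cart by (subst all_split; simp add: c e)+
  have int: "f integrable_on cbox a b" for a b
    by (intro integrable_continuous continuous_on_subset[OF cont]) simp
  have "(LINT x|\<T>. f (x + c)) = integral (cbox 0 1) (\<lambda>x. f (x + c))"
    by (intro torus_integral_HK continuous_on_compose2[OF cont] continuous_intros) auto
  also have "\<dots> = integral (cbox c (1 + c)) f"
    using integral_shift_cbox[of c c "1 + c" f] by simp
  also have "\<dots> = integral (cbox c (1 + c) \<inter> {x. x \<bullet> ?e \<le> 1}) f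
      + integral (cbox c (1 + c) \<inter> {x. x \<bullet> ?e \<ge> 1}) f"
    by (intro integral_split int) auto
  also have "cbox c (1 + c) \<inter> {x. x \<bullet> ?e \<le> 1} = cbox 0 1 \<inter> {x. x \<bullet> ?e \<ge> s}"
    using s by (auto simp: box inner_axis)
  also have "cbox c (1 + c) \<inter> {x. x \<bullet> ?e \<ge> 1} = cbox ?e (1 + c)"
    using s by (auto simp: box inner_axis)
  also have "integral (cbox ?e (1 + c)) f = integral (cbox 0 (1 + c - ?e)) (\<lambda>x. f (x + ?e))"
    using integral_shift_cbox[of ?e ?e "1 + c" f] by simp
  also have "\<dots> = integral (cbox 0 (1 + c - ?e)) f"
    using per by (simp add: torus_periodic_def)
  also have "cbox 0 (1 + c - ?e) = cbox 0 1 \<inter> {x. x \<bullet> ?e \<le> s}"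
    using s by (auto simp: box inner_axis)
  also have "integral (cbox 0 1 \<inter> {x. x \<bullet> ?e \<ge> s}) f + integral (cbox 0 1 \<inter> {x. x \<bullet> ?e \<le> s}) f
      = integral (cbox 0 1) f"
    by (subst integral_split[OF int, of ?e 0 1 s]) auto
  also have "\<dots> = (LINT x|\<T>. f x)"
    by (rule torus_integral_HK[OF cont, symmetric])
  finally show ?thesis by (simp add: c_def)
qed

lemma torus_periodic_shift: "torus_periodic f \<Longrightarrow> torus_periodic (\<lambda>x. f (x + c))"
  unfolding torus_periodic_def by (metis add.commute add.assoc)

lemma torus_integral_shift_axis:
  fixes f :: "real ^ 'n \<Rightarrow> real"
  assumes per: "torus_periodic f" and cont: "continuous_on UNIV f"
  shows "(LINT x|\<T>. f (x + s *\<^sub>R axis i 1)) = (LINT x|\<T>. f x)"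
proof -
  have "f (x + s *\<^sub>R axis i 1) = f (x + frac s *\<^sub>R axis i 1)" for x
    using torus_periodic_add_int[OF per, of "x + frac s *\<^sub>R axis i 1" "\<lfloor>s\<rfloor>" i]
    by (simp add: frac_def algebra_simps)
  then show ?thesis
    using torus_integral_shift_small[OF per cont, of "frac s" i] frac_lt_1[of s] by simp
qed

lemma torus_integral_shift:
  fixes f :: "real ^ 'n \<Rightarrow> real"
  assumes per: "torus_periodic f" and cont: "continuous_on UNIV f"
  shows "(LINT x|\<T>. f (x + y)) = (LINT x|\<T>. f x)"
proof -
  have "(LINT x|\<T>. f (x + (\<Sum>i\<in>A. y $ i *\<^sub>R axis i 1))) = (LINT x|\<T>. f x)"
    if "finite A" for A
    using that
  proof (induction A)
    case (insert j A)
    let ?g = "\<lambda>x. f (x + (\<Sum>i\<in>A. y $ i *\<^sub>R axis i 1))"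
    have "(LINT x|\<T>. f (x + (\<Sum>i\<in>insert j A. y $ i *\<^sub>R axis i 1)))
        = (LINT x|\<T>. ?g (x + y $ j *\<^sub>R axis j 1))"
      using insert by (simp add: add.assoc)
    also have "\<dots> = (LINT x|\<T>. ?g x)"
      by (intro torus_integral_shift_axis torus_periodic_shift per continuous_on_compose2[OF cont])
        (auto intro: continuous_intros)
    finally show ?case using insert by simp
  qed simp
  from this[of UNIV] show ?thesis
    by (simp add: vec_sum_axis)
qed

section \<open>Periodic functions with continuous partial derivatives\<close>

text \<open>
  Only derivatives along the coordinate axes are recorded. Integration by parts uses no others, and
  they pass to convolutions one direction at a time.
\<close>

definition C1_periodic :: "(real ^ 'n \<Rightarrow> real) \<Rightarrow> ('n \<Rightarrow> real ^ 'n \<Rightarrow> real) \<Rightarrow> bool" where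
  "C1_periodic f D \<longleftrightarrow> torus_periodic f \<and> continuous_on UNIV f \<and>
     (\<forall>i. torus_periodic (D i) \<and> continuous_on UNIV (D i) \<and>
       (\<forall>x. ((\<lambda>s. f (x + s *\<^sub>R axis i 1)) has_real_derivative D i x) (at 0)))"

lemma C1_periodic_along:
  assumes "C1_periodic f D"
  shows "((\<lambda>s. f (x + s *\<^sub>R axis i 1)) has_real_derivative D i (x + s *\<^sub>R axis i 1)) (at s)"
proof -
  have "((\<lambda>r. f ((x + s *\<^sub>R axis i 1) + r *\<^sub>R axis i 1)) has_real_derivative D i (x + s *\<^sub>R axis i 1)) (at 0)"
    using assms by (simp add: C1_periodic_def)
  then have "((\<lambda>r. f (x + (r + s) *\<^sub>R axis i 1)) has_real_derivative D i (x + s *\<^sub>R axis i 1)) (at 0)"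
    by (simp add: algebra_simps)
  then show ?thesis
    using DERIV_shift[of "\<lambda>s. f (x + s *\<^sub>R axis i 1)" "D i (x + s *\<^sub>R axis i 1)" 0 s]
    by simp
qed

lemma C1_periodic_lipschitz:
  assumes "C1_periodic f D" "\<And>x. \<bar>D i x\<bar> \<le> B"
  shows "\<bar>f (x + s *\<^sub>R axis i 1) - f x\<bar> \<le> B * \<bar>s\<bar>"
proof -
  have "norm (f (x + s *\<^sub>R axis i 1) - f (x + 0 *\<^sub>R axis i 1)) \<le> B * norm (s - 0)"
    by (rule field_differentiable_bound[where S = UNIV and f = "\<lambda>s. f (x + s *\<^sub>R axis i 1)"])
      (use C1_periodic_along[OF assms(1)] assms(2) in auto)
  then show ?thesis by simp
qed

lemma C1_periodic_mult:
  assumes "C1_periodic f D" "C1_periodic g E"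
  shows "C1_periodic (\<lambda>x. f x * g x) (\<lambda>i x. D i x * g x + f x * E i x)"
  using assms unfolding C1_periodic_def
  by (auto intro!: continuous_intros derivative_eq_intros simp: torus_periodic_def)

lemma C1_periodic_compose:
  assumes "C1_periodic f D" "\<And>s. (\<beta> has_real_derivative \<beta>' s) (at s)" "continuous_on UNIV \<beta>'"
  shows "C1_periodic (\<lambda>x. \<beta> (f x)) (\<lambda>i x. \<beta>' (f x) * D i x)"
proof -
  have "continuous_on UNIV \<beta>"
    by (rule DERIV_continuous_on[where D = \<beta>']) (rule assms)
  then have 1: "continuous_on UNIV (\<lambda>x. \<beta> (f x))" "continuous_on UNIV (\<lambda>x. \<beta>' (f x))"
    using assms(1,3) continuous_on_compose2[of UNIV _ UNIV f] by (auto simp: C1_periodic_def)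
  have "((\<lambda>s. \<beta> (f (x + s *\<^sub>R axis i 1))) has_real_derivative \<beta>' (f (x + 0 *\<^sub>R axis i 1)) * D i x) (at 0)" for x i
    by (rule DERIV_chain2[OF assms(2)]) (use assms(1) in \<open>auto simp: C1_periodic_def\<close>)
  with assms(1) 1 show ?thesis
    by (auto simp: C1_periodic_def torus_periodic_def intro!: continuous_intros)
qed

lemma C1_periodic_smooth:
  assumes "smooth f" "torus_periodic f"
  shows "C1_periodic f (\<lambda>i. partial_deriv i f)"
proof -
  have der: "((\<lambda>s. f (x + s *\<^sub>R axis i 1)) has_real_derivative partial_deriv i f x) (at 0)" for x i
  proof -
    have "((\<lambda>s. f (x + s *\<^sub>R axis i 1)) has_derivative
        (\<lambda>h. frechet_derivative f (at (x + 0 *\<^sub>R axis i 1)) (h *\<^sub>R axis i 1))) (at 0)"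
      by (rule has_derivative_compose[OF _ smooth_has_derivative[OF assms(1)], where f = "\<lambda>s. x + s *\<^sub>R axis i 1"])
        (auto intro!: derivative_eq_intros)
    moreover have "frechet_derivative f (at x) (h *\<^sub>R axis i 1) = partial_deriv i f x * h" for h
      using linear_scale[OF has_derivative_linear[OF smooth_has_derivative[OF assms(1)]]]
      by (simp add: partial_deriv_def)
    ultimately show ?thesis
      by (simp add: has_field_derivative_def)
  qed
  moreover have "torus_periodic (partial_deriv i f)" for i
    unfolding torus_periodic_def
  proof (intro allI)
    fix x j
    have "f (x + axis j 1 + s *\<^sub>R axis i 1) = f (x + s *\<^sub>R axis i 1)" for s
      using assms(2) by (metis torus_periodic_def add.commute add.assoc)
    then show "partial_deriv i f (x + axis j 1) = partial_deriv i f x"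
      using der[of "x + axis j 1" i] der[of x i] DERIV_unique by simp
  qed
  ultimately show ?thesis
    using assms smooth_continuous smooth_partial_deriv unfolding C1_periodic_def by blast
qed

text \<open>
  By translation invariance the difference quotients of \<open>f\<close> have integral zero, and they converge
  boundedly to the derivative.
\<close>

lemma integral_deriv_periodic:
  assumes f: "C1_periodic f D"
  shows "(LINT x|\<T>. D i x) = 0"
proof -
  have cf: "continuous_on UNIV f" "torus_periodic f" and cD: "continuous_on UNIV (D i)" "torus_periodic (D i)"
    using f by (auto simp: C1_periodic_def)
  obtain B where B: "\<And>x. \<bar>D i x\<bar> \<le> B"
    using torus_periodic_bounded[OF cD(2,1)] by blast
  define h :: "nat \<Rightarrow> real" where "h n = inverse (real (Suc n))" for n
  have h: "h n > 0" for n by (simp add: h_def)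
  have h0: "h \<longlonglongrightarrow> 0"
    unfolding h_def by (rule LIMSEQ_inverse_real_of_nat)
  have fs: "continuous_on UNIV (\<lambda>x. f (x + c))" for c
    by (intro continuous_on_compose2[OF cf(1)] continuous_intros) auto
  let ?q = "\<lambda>n x. (f (x + h n *\<^sub>R axis i 1) - f x) / h n"
  have "(\<lambda>n. LINT x|\<T>. ?q n x) \<longlonglongrightarrow> (LINT x|\<T>. D i x)"
  proof (rule integral_dominated_convergence[where w = "\<lambda>x. B"])
    show "D i \<in> borel_measurable \<T>" "?q n \<in> borel_measurable \<T>" for n
      by (intro torus_borel_measurable borel_measurable_divide borel_measurable_diff
          borel_measurable_const borel_measurable_continuous_onI cD fs cf)+
    show "AE x in \<T>. (\<lambda>n. ?q n x) \<longlonglongrightarrow> D i x"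
    proof (rule AE_I2)
      fix x
      have "((\<lambda>s. f (x + s *\<^sub>R axis i 1)) has_real_derivative D i x) (at 0)"
        using f by (auto simp: C1_periodic_def)
      then have "((\<lambda>s. (f (x + s *\<^sub>R axis i 1) - f x) / s) \<longlongrightarrow> D i x) (at 0)"
        by (simp add: DERIV_def)
      then show "(\<lambda>n. ?q n x) \<longlonglongrightarrow> D i x"
        by (rule filterlim_compose) (use h h0 in \<open>auto simp: filterlim_at order.strict_implies_not_eq[symmetric] less_imp_neq\<close>)
    qed
    show "AE x in \<T>. norm (?q n x) \<le> B" for n
      using C1_periodic_lipschitz[OF f B, of _ "h n"] h[of n]
      by (auto simp: divide_le_eq)
  qed simp
  moreover have "(LINT x|\<T>. ?q n x) = 0" for n
    using torus_integral_shift_axis[OF cf(2,1), of "h n" i]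
      Bochner_Integration.integral_diff[OF torus_continuous_integrable[OF fs] torus_continuous_integrable[OF cf(1)], of "h n *\<^sub>R axis i 1"]
    by simp
  ultimately have "(\<lambda>n::nat. 0) \<longlonglongrightarrow> (LINT x|\<T>. D i x)"
    by (simp only:)
  then show ?thesis
    by (simp add: LIMSEQ_const_iff)
qed

lemma integral_by_parts_periodic:
  assumes f: "C1_periodic f D" and g: "C1_periodic g E"
  shows "(LINT x|\<T>. D i x * g x) = - (LINT x|\<T>. f x * E i x)"
proof -
  have "integrable \<T> (\<lambda>x. D i x * g x)" "integrable \<T> (\<lambda>x. f x * E i x)"
    using f g by (auto intro!: torus_continuous_integrable continuous_intros simp: C1_periodic_def)
  then show ?thesis
    using integral_deriv_periodic[OF C1_periodic_mult[OF f g], of i] by simp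
qed

section \<open>Square-integrable functions\<close>

definition sq_integrable :: "'a measure \<Rightarrow> ('a \<Rightarrow> real) \<Rightarrow> bool" where
  "sq_integrable M f \<longleftrightarrow> f \<in> borel_measurable M \<and> integrable M (\<lambda>x. (f x)\<^sup>2)"

lemma sq_integrable_measurable: "sq_integrable M f \<Longrightarrow> f \<in> borel_measurable M"
  by (simp add: sq_integrable_def)

lemma abs_mult_le_squares: "\<bar>a * b\<bar> \<le> a\<^sup>2 + (b :: real)\<^sup>2"
proof -
  have "2 * (\<bar>a\<bar> * \<bar>b\<bar>) \<le> \<bar>a\<bar>\<^sup>2 + \<bar>b\<bar>\<^sup>2"
    using sum_squares_bound[of "\<bar>a\<bar>" "\<bar>b\<bar>"] by simp
  moreover have "0 \<le> \<bar>a\<bar> * \<bar>b\<bar>" by simp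
  ultimately show ?thesis unfolding abs_mult power2_abs by linarith
qed

lemma sq_integrable_mult:
  assumes "sq_integrable M f" "sq_integrable M g"
  shows "integrable M (\<lambda>x. f x * g x)"
proof (rule Bochner_Integration.integrable_bound)
  show "integrable M (\<lambda>x. (f x)\<^sup>2 + (g x)\<^sup>2)"
    using assms by (simp add: sq_integrable_def)
  show "(\<lambda>x. f x * g x) \<in> borel_measurable M"
    using assms by (auto simp: sq_integrable_def)
  show "AE x in M. norm (f x * g x) \<le> norm ((f x)\<^sup>2 + (g x)\<^sup>2)"
    using abs_mult_le_squares by auto
qed

lemma sq_integrable_add:
  assumes "sq_integrable M f" "sq_integrable M g"
  shows "sq_integrable M (\<lambda>x. f x + g x)"
  using assms sq_integrable_mult[OF assms]
  by (auto simp: sq_integrable_def power2_sum mult.assoc)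

lemma sq_integrable_cmult:
  assumes "sq_integrable M f"
  shows "sq_integrable M (\<lambda>x. c * f x)"
  unfolding sq_integrable_def power_mult_distrib
  using assms by (intro conjI borel_measurable_times borel_measurable_const
      Bochner_Integration.integrable_mult_right) (simp_all add: sq_integrable_def)

lemma sq_integrable_diff:
  assumes "sq_integrable M f" "sq_integrable M g"
  shows "sq_integrable M (\<lambda>x. f x - g x)"
  using sq_integrable_add[OF assms(1) sq_integrable_cmult[OF assms(2), of "-1"]] by simp

lemma integrable_mult_bounded:
  fixes f g :: "'a \<Rightarrow> real"
  assumes "integrable M f" "g \<in> borel_measurable M" "\<And>x. x \<in> space M \<Longrightarrow> \<bar>g x\<bar> \<le> B"
  shows "integrable M (\<lambda>x. f x * g x)"
proof (rule Bochner_Integration.integrable_bound)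
  show "integrable M (\<lambda>x. B * f x)" using assms by simp
  show "(\<lambda>x. f x * g x) \<in> borel_measurable M" using assms by auto
  show "AE x in M. norm (f x * g x) \<le> norm (B * f x)"
  proof (rule AE_I2)
    fix x assume "x \<in> space M"
    then have "\<bar>g x\<bar> \<le> \<bar>B\<bar>" using assms(3) by fastforce
    then have "\<bar>g x\<bar> * \<bar>f x\<bar> \<le> \<bar>B\<bar> * \<bar>f x\<bar>"
      by (rule mult_right_mono) simp
    then show "norm (f x * g x) \<le> norm (B * f x)"
      by (simp add: abs_mult mult.commute)
  qed
qed

lemma sq_integrable_mult_bounded:
  assumes "sq_integrable M f" "g \<in> borel_measurable M" "\<And>x. x \<in> space M \<Longrightarrow> \<bar>g x\<bar> \<le> B"
  shows "sq_integrable M (\<lambda>x. f x * g x)"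
proof -
  have "integrable M (\<lambda>x. (f x)\<^sup>2 * (g x)\<^sup>2)"
  proof (rule integrable_mult_bounded[where B = "B\<^sup>2"])
    show "\<bar>(g x)\<^sup>2\<bar> \<le> B\<^sup>2" if "x \<in> space M" for x
      using assms(3)[OF that] by (simp add: abs_le_square_iff[symmetric])
  qed (use assms in \<open>auto simp: sq_integrable_def\<close>)
  then show ?thesis
    using assms by (auto simp: sq_integrable_def power_mult_distrib)
qed

lemma (in finite_measure) sq_integrable_bounded:
  assumes "f \<in> borel_measurable M" "\<And>x. x \<in> space M \<Longrightarrow> \<bar>f x\<bar> \<le> B"
  shows "sq_integrable M f"
proof -
  have "sq_integrable M (\<lambda>x. 1 * f x)"
    by (rule sq_integrable_mult_bounded) (use assms in \<open>auto simp: sq_integrable_def\<close>)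
  then show ?thesis by simp
qed

lemma (in finite_measure) sq_integrable_imp_integrable:
  assumes "sq_integrable M f"
  shows "integrable M f"
proof -
  have "sq_integrable M (\<lambda>x. 1)"
    by (simp add: sq_integrable_def)
  from sq_integrable_mult[OF assms this] show ?thesis by simp
qed

lemma three_squares: "(a + b + c)\<^sup>2 \<le> 3 * (a\<^sup>2 + b\<^sup>2 + (c :: real)\<^sup>2)"
proof -
  have "0 \<le> (a - b)\<^sup>2 + (b - c)\<^sup>2 + (a - c)\<^sup>2" by simp
  then show ?thesis by (simp add: power2_eq_square algebra_simps)
qed

lemma clip_tendsto:
  "(\<lambda>n. max (- real n) (min (real n) a)) \<longlonglongrightarrow> a"
proof -
  obtain N where N: "\<bar>a\<bar> \<le> real N" using real_arch_simple by blast
  have "\<forall>\<^sub>F n in sequentially. max (- real n) (min (real n) a) = a"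
    using eventually_ge_at_top[of N] by eventually_elim (use N in linarith)
  then show ?thesis by (rule tendsto_eventually)
qed

text \<open>
  Young's inequality \<open>\<bar>f g\<bar> \<le> f\<^sup>2 / d + d g\<^sup>2\<close>, where \<open>d\<close> is chosen small depending on the bound on \<open>g\<close> only.
\<close>

lemma integral_mult_tendsto_L2:
  assumes f: "\<And>n. sq_integrable M (f n)" and lim: "(\<lambda>n. LINT x|M. (f n x)\<^sup>2) \<longlonglongrightarrow> 0"
    and g: "\<And>n. sq_integrable M (g n)" "\<And>n. (LINT x|M. (g n x)\<^sup>2) \<le> B"
  shows "(\<lambda>n. LINT x|M. f n x * g n x) \<longlonglongrightarrow> 0"
proof (rule LIMSEQ_I)
  fix e :: real assume e: "e > 0"
  define C where "C = max B 0 + 1"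
  define d where "d = e / (2 * C)"
  have "C > 0" by (simp add: C_def add_nonneg_pos)
  then have d: "d > 0" "d * C = e / 2" using e by (auto simp: d_def)
  have "\<forall>\<^sub>F n in sequentially. (LINT x|M. (f n x)\<^sup>2) < d * (e / 2)"
    using lim e d by (intro order_tendstoD(2)) auto
  then obtain N where N: "\<And>n. n \<ge> N \<Longrightarrow> (LINT x|M. (f n x)\<^sup>2) < d * (e / 2)"
    by (auto simp: eventually_sequentially)
  have "norm ((LINT x|M. f n x * g n x) - 0) < e" if n: "n \<ge> N" for n
  proof -
    have f2: "integrable M (\<lambda>x. (f n x)\<^sup>2)" and g2: "integrable M (\<lambda>x. (g n x)\<^sup>2)"
      using f g by (auto simp: sq_integrable_def)
    have pw: "\<bar>f n x * g n x\<bar> \<le> 1 / d * (f n x)\<^sup>2 + d * (g n x)\<^sup>2" for x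
      using d(1) abs_mult_le_squares[of "f n x / sqrt d" "sqrt d * g n x"]
      by (simp add: power_divide power_mult_distrib)
    have "\<bar>LINT x|M. f n x * g n x\<bar> \<le> (LINT x|M. \<bar>f n x * g n x\<bar>)"
      by (rule integral_abs_bound)
    also have "\<dots> \<le> (LINT x|M. 1 / d * (f n x)\<^sup>2 + d * (g n x)\<^sup>2)"
      by (intro integral_mono pw integrable_abs sq_integrable_mult f g
          Bochner_Integration.integrable_add integrable_mult_right f2 g2)
    also have "\<dots> = 1 / d * (LINT x|M. (f n x)\<^sup>2) + d * (LINT x|M. (g n x)\<^sup>2)"
      using f2 g2 by simp
    also have "1 / d * (LINT x|M. (f n x)\<^sup>2) < e / 2"
      using N[OF n] d(1) by (simp add: field_simps)
    also have "d * (LINT x|M. (g n x)\<^sup>2) \<le> d * C"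
      using g(2)[of n] d(1) by (intro mult_left_mono) (auto simp: C_def)
    finally show ?thesis using d(2) by simp
  qed
  then show "\<exists>N. \<forall>n\<ge>N. norm ((LINT x|M. f n x * g n x) - 0) < e" by blast
qed

text \<open>
  As \<open>g\<close> is merely integrable, it is split into a truncation, to which the preceding lemma applies, and
  a remainder that is small in mean and is multiplied by a bounded function.
\<close>

lemma (in finite_measure) integral_tendsto_L2_bounded:
  fixes P :: "nat \<Rightarrow> 'a \<Rightarrow> real"
  assumes P: "\<And>n. P n \<in> borel_measurable M" "\<And>n x. x \<in> space M \<Longrightarrow> \<bar>P n x\<bar> \<le> B"
    and lim: "(\<lambda>n. LINT x|M. (P n x)\<^sup>2) \<longlonglongrightarrow> 0" and g: "integrable M g"
  shows "(\<lambda>n. LINT x|M. P n x * g x) \<longlonglongrightarrow> 0"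
proof (rule LIMSEQ_I)
  fix e :: real assume e: "e > 0"
  let ?c = "\<lambda>R x. max (- real R) (min (real R) (g x))"
  define C where "C = max B 0 + 1"
  have C: "C > 0" by (simp add: C_def add_nonneg_pos)
  have gm [measurable]: "g \<in> borel_measurable M" using g by auto
  have "(\<lambda>R. LINT x|M. \<bar>g x - ?c R x\<bar>) \<longlonglongrightarrow> (LINT x|M. \<bar>g x - g x\<bar>)"
  proof (rule integral_dominated_convergence[where w = "\<lambda>x. \<bar>g x\<bar>"])
    show "AE x in M. (\<lambda>R. \<bar>g x - ?c R x\<bar>) \<longlonglongrightarrow> \<bar>g x - g x\<bar>"
      by (intro AE_I2 tendsto_rabs tendsto_diff tendsto_const clip_tendsto)
  qed (use g in \<open>auto intro!: AE_I2\<close>)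
  then have "\<forall>\<^sub>F R in sequentially. (LINT x|M. \<bar>g x - ?c R x\<bar>) < e / (2 * C)"
    using e C by (intro order_tendstoD(2)) auto
  then obtain R where R: "(LINT x|M. \<bar>g x - ?c R x\<bar>) < e / (2 * C)"
    by (meson eventually_happens sequentially_bot)
  have sP: "sq_integrable M (P n)" for n by (rule sq_integrable_bounded[OF P])
  have sc: "sq_integrable M (?c R)" by (rule sq_integrable_bounded[where B = "real R"]) auto
  have "(\<lambda>n. LINT x|M. P n x * ?c R x) \<longlonglongrightarrow> 0"
    by (rule integral_mult_tendsto_L2[OF sP lim sc order_refl])
  from LIMSEQ_D[OF this, of "e / 2"] e
  obtain N where N: "\<And>n. n \<ge> N \<Longrightarrow> \<bar>LINT x|M. P n x * ?c R x\<bar> < e / 2" by auto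
  have "norm ((LINT x|M. P n x * g x) - 0) < e" if n: "n \<ge> N" for n
  proof -
    have ic: "integrable M (\<lambda>x. P n x * ?c R x)" by (rule sq_integrable_mult[OF sP sc])
    have id: "integrable M (\<lambda>x. P n x * (g x - ?c R x))"
      using integrable_mult_bounded[OF _ P, of "\<lambda>x. g x - ?c R x"] g sq_integrable_imp_integrable[OF sc]
      by (simp add: mult.commute)
    have "\<bar>LINT x|M. P n x * (g x - ?c R x)\<bar> \<le> (LINT x|M. \<bar>P n x * (g x - ?c R x)\<bar>)"
      by (rule integral_abs_bound)
    also have "\<dots> \<le> (LINT x|M. C * \<bar>g x - ?c R x\<bar>)"
    proof (rule integral_mono)
      fix x assume "x \<in> space M"
      then have "\<bar>P n x\<bar> \<le> C" using P(2)[of x n] by (simp add: C_def)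
      then show "\<bar>P n x * (g x - ?c R x)\<bar> \<le> C * \<bar>g x - ?c R x\<bar>"
        unfolding abs_mult by (rule mult_right_mono) simp
    qed (use id g sq_integrable_imp_integrable[OF sc] in auto)
    also have "\<dots> < e / 2" using R C by (simp add: field_simps)
    finally have "\<bar>LINT x|M. P n x * (g x - ?c R x)\<bar> < e / 2" .
    moreover have "(LINT x|M. P n x * g x) = (LINT x|M. P n x * (g x - ?c R x)) + (LINT x|M. P n x * ?c R x)"
      unfolding Bochner_Integration.integral_add[OF id ic, symmetric] by (simp add: algebra_simps)
    ultimately show ?thesis using N[OF n] by simp
  qed
  then show "\<exists>N. \<forall>n\<ge>N. norm ((LINT x|M. P n x * g x) - 0) < e" by blast
qed

section \<open>A trigonometric approximate identity\<close>

text \<open>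
  Evenness is what makes convolution with a kernel a symmetric operation (\<open>conv_Fubini_kernel\<close>).
\<close>

definition kernel :: "(real ^ 'n \<Rightarrow> real) \<Rightarrow> bool" where
  "kernel K \<longleftrightarrow> smooth K \<and> torus_periodic K \<and> (\<forall>z. 0 \<le> K z) \<and> (\<forall>z. K (- z) = K z)
     \<and> (LINT z|\<T>. K z) = 1"

text \<open>
  Periodic kernels concentrate at all integer vectors. For \<open>y\<close> in the open cube and \<open>x\<close> in the closed
  cube, \<open>y - x\<close> stays away from all of them except the origin, so that it is enough to keep \<open>x\<close> away
  from \<open>y\<close>.
\<close>

definition approx_identity :: "(nat \<Rightarrow> real ^ 'n \<Rightarrow> real) \<Rightarrow> bool" where
  "approx_identity K \<longleftrightarrow> (\<forall>n. kernel (K n)) \<and>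
     (\<forall>y\<in>box 0 1. \<forall>d>0. \<forall>e>0. \<forall>\<^sub>F n in sequentially. \<forall>x\<in>cbox 0 1. d \<le> dist x y \<longrightarrow> K n (y - x) \<le> e)"

text \<open>
  The kernels are the normalised powers of this function, which equals one at the integer vectors
  and is smaller elsewhere. It is smooth and periodic by itself, so that no periodisation is needed.
\<close>

definition cos_prod :: "real ^ 'n \<Rightarrow> real" where
  "cos_prod z = (\<Prod>i\<in>UNIV. (cos (pi * z $ i))\<^sup>2)"

lemma smooth_cos_coord: "smooth (\<lambda>z :: real ^ 'n. cos (pi * z $ i))"
proof -
  define h where "h j s = pi ^ j * cos (pi * s + real j * (pi / 2))" for j s
  have "Ck k (\<lambda>z :: real ^ 'n. h 0 (z $ i))" for k
  proof (rule Ck_chain[where h = h and j = 0 and f = "\<lambda>z. z $ i"])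
    fix j s
    have "cos (pi * s + (real j + 1) * (pi / 2)) = - sin (pi * s + real j * (pi / 2))"
      using minus_sin_cos_eq[of "pi * s + real j * (pi / 2)"] by (simp add: distrib_right add_divide_distrib add.assoc)
    then show "(h j has_real_derivative h (Suc j) s) (at s)"
      unfolding h_def by (auto intro!: derivative_eq_intros simp: algebra_simps)
    show "Ck k (\<lambda>z :: real ^ 'n. z $ i)"
      by (intro Ck_linear bounded_linear_vec_nth)
  qed
  then show ?thesis by (simp add: smooth_def h_def)
qed

lemma cos_prod_bounds: "0 \<le> cos_prod z" "cos_prod z \<le> 1"
  unfolding cos_prod_def
  by (auto intro!: prod_nonneg prod_le_1 simp: abs_square_le_1)

lemma cos_prod_le_factor: "cos_prod z \<le> (cos (pi * z $ i))\<^sup>2"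
proof -
  have "cos_prod z = (cos (pi * z $ i))\<^sup>2 * (\<Prod>j\<in>UNIV - {i}. (cos (pi * z $ j))\<^sup>2)"
    unfolding cos_prod_def by (subst prod.remove[of _ i]) auto
  also have "\<dots> \<le> (cos (pi * z $ i))\<^sup>2 * 1"
    by (intro mult_left_mono prod_le_1) (auto simp: abs_square_le_1)
  finally show ?thesis by simp
qed

lemma smooth_cos_prod: "smooth (cos_prod :: real ^ 'n \<Rightarrow> real)"
proof -
  have "Ck k (\<lambda>z :: real ^ 'n. \<Prod>i\<in>UNIV. (cos (pi * z $ i)) * (cos (pi * z $ i)))" for k
    using smooth_cos_coord by (intro Ck_prod Ck_mult) (auto simp: smooth_def)
  then show ?thesis
    by (simp add: smooth_def cos_prod_def[abs_def] power2_eq_square)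
qed

lemma smooth_power: "smooth f \<Longrightarrow> smooth (\<lambda>x. f x ^ n)"
  by (induction n) (simp_all add: smooth_mult, simp add: smooth_def Ck_const)

lemma cos_sq_le:
  assumes "0 \<le> m" "m \<le> \<bar>t\<bar>" "\<bar>t\<bar> \<le> 1 - m"
  shows "(cos (pi * t))\<^sup>2 \<le> (cos (pi * m))\<^sup>2"
proof -
  have *: "(cos (pi * s))\<^sup>2 \<le> (cos (pi * m))\<^sup>2" if "m \<le> s" "s \<le> 1 / 2" for s
  proof (rule power_mono)
    show "cos (pi * s) \<le> cos (pi * m)"
      using that assms(1) by (intro cos_monotone_0_pi_le) auto
    have "- (pi / 2) \<le> 0" "0 \<le> pi * s" using that assms(1) by auto
    then show "0 \<le> cos (pi * s)"
      using that by (intro cos_ge_zero) (linarith, auto)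
  qed
  have abs: "cos (pi * t) = cos (pi * \<bar>t\<bar>)"
    by (metis abs_mult abs_of_pos cos_abs_real pi_gt_zero)
  show ?thesis
  proof (cases "\<bar>t\<bar> \<le> 1 / 2")
    case True
    then show ?thesis using * assms abs by simp
  next
    case False
    have "cos (pi * (1 - \<bar>t\<bar>)) = - cos (pi * \<bar>t\<bar>)"
      by (simp add: right_diff_distrib cos_diff)
    then have "(cos (pi * t))\<^sup>2 = (cos (pi * (1 - \<bar>t\<bar>)))\<^sup>2"
      by (simp add: abs)
    also have "\<dots> \<le> (cos (pi * m))\<^sup>2"
      using False assms by (intro *) auto
    finally show ?thesis .
  qed
qed

text \<open>
  Some coordinate of \<open>y - x\<close> has absolute value at least \<open>d / CARD('n)\<close>, and none exceeds \<open>1 - r\<close>,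
  where \<open>r\<close> is the distance of \<open>y\<close> to the faces of the cube. Hence one factor of the product is bounded
  away from one.
\<close>

lemma cos_prod_concentrated:
  fixes y :: "real ^ 'n"
  assumes y: "y \<in> box 0 1" and d: "d > 0"
  obtains q where "0 \<le> q" "q < 1" "\<And>x. x \<in> cbox 0 1 \<Longrightarrow> d \<le> dist x y \<Longrightarrow> cos_prod (y - x) \<le> q"
proof -
  define r where "r = Min (range (\<lambda>i. min (y $ i) (1 - y $ i)))"
  have r_le: "r \<le> y $ i" "r \<le> 1 - y $ i" for i
    unfolding r_def by (meson Min_le finite_imageI finite rangeI min.boundedE order_trans)+
  have r_pos: "r > 0"
    using y by (simp add: r_def mem_box_cart)
  define m where "m = min (d / real CARD('n)) r"
  have m: "0 < m" "m \<le> 1 / 2"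
    using r_le[of undefined] r_pos d unfolding m_def by (simp, linarith)
  have "cos (pi * m) < cos 0"
    using m by (intro cos_monotone_0_pi) auto
  moreover have "0 \<le> cos (pi * m)"
  proof (rule cos_ge_zero)
    have "- (pi / 2) \<le> 0" "0 \<le> pi * m" using m by auto
    then show "- (pi / 2) \<le> pi * m" by linarith
  qed (use m in auto)
  ultimately have "(cos (pi * m))\<^sup>2 < 1"
    by (simp add: power_less_one_iff abs_square_less_1)
  moreover have "cos_prod (y - x) \<le> (cos (pi * m))\<^sup>2" if x: "x \<in> cbox 0 1" "d \<le> dist x y" for x
  proof -
    have "\<exists>i. d / real CARD('n) \<le> \<bar>(y - x) $ i\<bar>"
    proof (rule ccontr)
      assume *: "\<not> ?thesis"
      have "dist x y = norm (y - x)" by (simp add: dist_norm norm_minus_commute)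
      also have "\<dots> \<le> (\<Sum>i\<in>UNIV. \<bar>(y - x) $ i\<bar>)" by (rule norm_le_l1_cart)
      also have "\<dots> < (\<Sum>i\<in>(UNIV :: 'n set). d / real CARD('n))"
        using * by (intro sum_strict_mono) (auto simp: not_le)
      also have "\<dots> = d" by simp
      finally show False using x by simp
    qed
    then obtain i where i: "d / real CARD('n) \<le> \<bar>(y - x) $ i\<bar>" by blast
    have "0 \<le> x $ i" "x $ i \<le> 1" using x by (auto simp: mem_box_cart)
    then have "\<bar>(y - x) $ i\<bar> \<le> 1 - m"
      using r_le[of i] by (auto simp: m_def)
    then have "(cos (pi * (y - x) $ i))\<^sup>2 \<le> (cos (pi * m))\<^sup>2"
      using m i by (intro cos_sq_le) (auto simp: m_def)
    then show ?thesis using cos_prod_le_factor order_trans by blast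
  qed
  ultimately show ?thesis by (intro that[of "(cos (pi * m))\<^sup>2"]) auto
qed

lemma torus_borel_cont: "continuous_on UNIV f \<Longrightarrow> f \<in> borel_measurable (\<T> :: (real ^ 'n) measure)"
  for f :: "real ^ 'n \<Rightarrow> real"
  by (intro torus_borel_measurable borel_measurable_continuous_onI)

text \<open>
  By continuity the function exceeds \<open>p\<close> on a small cube with a corner at the origin; \<open>c\<close> is its volume.
\<close>

lemma cos_prod_integral_lower:
  assumes "p < 1" "0 \<le> p"
  obtains c where "c > 0" "\<And>N. c * p ^ N \<le> (LINT z|\<T>. cos_prod (z :: real ^ 'n) ^ N)"
proof -
  let ?f = "cos_prod :: real ^ 'n \<Rightarrow> real"
  have cont: "continuous_on UNIV ?f" by (rule smooth_continuous[OF smooth_cos_prod])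
  have "?f 0 = 1" by (simp add: cos_prod_def)
  moreover have "isCont ?f 0" using cont by (simp add: continuous_on_eq_continuous_at)
  ultimately have "\<forall>\<^sub>F z in nhds 0. ?f z > p"
    using assms(1) by (intro order_tendstoD(1)[of _ 1]) (auto simp: continuous_within tendsto_nhds_iff)
  then obtain r where r: "r > 0" "\<And>z. norm z < r \<Longrightarrow> ?f z > p"
    by (auto simp: eventually_nhds_metric)
  define s where "s = min 1 (r / (2 * real CARD('n)))"
  have s: "0 < s" "s \<le> 1" using r by (auto simp: s_def)
  let ?A = "cbox 0 (\<chi> i. s) :: (real ^ 'n) set"
  have A1: "?A \<subseteq> cbox 0 1"
    using s(2) by (auto simp: mem_box_cart) (meson order_trans)
  have A2: "?f z > p" if "z \<in> ?A" for z
  proof (rule r(2))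
    have "norm z \<le> (\<Sum>i\<in>UNIV. \<bar>z $ i\<bar>)" by (rule norm_le_l1_cart)
    also have "\<dots> \<le> (\<Sum>i\<in>(UNIV :: 'n set). r / (2 * real CARD('n)))"
      using that by (intro sum_mono) (auto simp: mem_box_cart s_def)
    also have "\<dots> < r" using r(1) by simp
    finally show "norm z < r" .
  qed
  have meas: "?A \<in> sets \<T>"
    using A1 by (auto simp: torus_measure_def sets_restrict_space)
  have pos: "measure \<T> ?A > 0"
  proof -
    have "measure \<T> ?A = measure lebesgue ?A"
      using A1 by (simp add: torus_measure_def measure_restrict_space)
    also have "\<dots> > 0"
      using s(1) by (simp add: content_cbox_if_cart interval_eq_empty_cart)
    finally show ?thesis .
  qed
  have "measure \<T> ?A * p ^ N \<le> (LINT z|\<T>. ?f z ^ N)" for N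
  proof -
    have "measure \<T> ?A * p ^ N = (LINT z|\<T>. indicator ?A z * p ^ N)"
      using meas A1 by (simp add: Int_absorb2)
    also have "\<dots> \<le> (LINT z|\<T>. ?f z ^ N)"
    proof (rule integral_mono)
      show "integrable \<T> (\<lambda>z. indicator ?A z * p ^ N)"
        using meas by (intro integrable_mult_left integrable_real_indicator) (auto simp: torus.emeasure_finite less_top[symmetric])
      show "integrable \<T> (\<lambda>z. ?f z ^ N)"
        by (intro torus_continuous_integrable continuous_intros cont)
      show "indicator ?A z * p ^ N \<le> ?f z ^ N" if "z \<in> space \<T>" for z
        using A2[of z] assms cos_prod_bounds(1)[of z] by (auto simp: indicator_def intro!: power_mono)
    qed
    finally show ?thesis .
  qed
  with pos show ?thesis by (intro that) auto
qed

text \<open>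
  Off the diagonal the powers are at most \<open>q ^ N\<close> for some \<open>q < 1\<close>, while the normalising integrals are at
  least of the order of \<open>p ^ N\<close> for any \<open>p < 1\<close>. Choosing \<open>p\<close> between \<open>q\<close> and \<open>1\<close> gives geometric decay.
\<close>

lemma ex_approx_identity: "\<exists>K :: nat \<Rightarrow> real ^ 'n \<Rightarrow> real. approx_identity K"
proof -
  let ?f = "cos_prod :: real ^ 'n \<Rightarrow> real"
  define c where "c N = (LINT z|\<T>. ?f z ^ N)" for N
  define K where "K N z = ?f z ^ N * (1 / c N)" for N z
  have c_pos: "c N > 0" for N
  proof -
    obtain a where "a > 0" "a * (1 / 2) ^ N \<le> c N"
      using cos_prod_integral_lower[of "1 / 2", where 'n = 'n] by (auto simp: c_def)
    then show ?thesis by (smt (verit) divide_pos_pos mult_pos_pos zero_less_power)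
  qed
  have "kernel (K N)" for N
    unfolding kernel_def
  proof (intro conjI allI)
    show "smooth (K N)"
      unfolding K_def by (intro smooth_mult smooth_power smooth_cos_prod) (simp add: smooth_def Ck_const)
    have "?f (z + axis j 1) = ?f z" for z j
      unfolding cos_prod_def by (intro prod.cong) (auto simp: axis_def distrib_left cos_add)
    then show "torus_periodic (K N)" by (simp add: K_def torus_periodic_def)
    show "0 \<le> K N z" for z
      using c_pos[of N] cos_prod_bounds(1)[of z] by (simp add: K_def)
    show "K N (- z) = K N z" for z by (simp add: K_def cos_prod_def)
    show "(LINT z|\<T>. K N z) = 1"
      using c_pos[of N] by (simp add: K_def c_def[symmetric])
  qed
  moreover have "\<forall>\<^sub>F n in sequentially. \<forall>x\<in>cbox 0 1. d \<le> dist x y \<longrightarrow> K n (y - x) \<le> e"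
    if y: "y \<in> box 0 1" and d: "d > 0" and e: "e > 0" for y d e
  proof -
    obtain q where q: "0 \<le> q" "q < 1" "\<And>x. x \<in> cbox 0 1 \<Longrightarrow> d \<le> dist x y \<Longrightarrow> ?f (y - x) \<le> q"
      using cos_prod_concentrated[OF y d] by blast
    define p where "p = (1 + q) / 2"
    have p: "q < p" "p < 1" "0 \<le> p" "0 < p" using q by (auto simp: p_def)
    obtain a where a: "a > 0" "\<And>N. a * p ^ N \<le> c N"
      using cos_prod_integral_lower[OF p(2,3), where 'n = 'n] by (auto simp: c_def)
    have "(\<lambda>N. (q / p) ^ N / a) \<longlonglongrightarrow> 0 / a"
      using q p a by (intro tendsto_divide tendsto_const LIMSEQ_power_zero) auto
    then have "\<forall>\<^sub>F N in sequentially. (q / p) ^ N / a < e"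
      using e by (intro order_tendstoD(2)) auto
    then show ?thesis
    proof eventually_elim
      case (elim N)
      show ?case
      proof (intro ballI impI)
        fix x assume x: "x \<in> cbox 0 1" "d \<le> dist x y"
        have "K N (y - x) \<le> q ^ N / c N"
          using q(3)[OF x] cos_prod_bounds(1)[of "y - x"] c_pos[of N]
          by (simp add: K_def divide_right_mono power_mono)
        also have "\<dots> \<le> q ^ N / (a * p ^ N)"
          using a p q by (intro divide_left_mono) (auto simp: c_pos)
        also have "\<dots> = (q / p) ^ N / a" by (simp add: power_divide)
        finally show "K N (y - x) \<le> e" using elim by simp
      qed
    qed
  qed
  ultimately have "approx_identity K" by (auto simp: approx_identity_def)
  then show ?thesis by blast
qed

section \<open>Convolution on the torus\<close>

text \<open>
  The values of \<open>f\<close> on the unit cube determine the convolution, and its periodicity is inherited from \<open>K\<close>.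
\<close>

definition conv :: "(real ^ 'n \<Rightarrow> real) \<Rightarrow> (real ^ 'n \<Rightarrow> real) \<Rightarrow> real ^ 'n \<Rightarrow> real" where
  "conv f K y = (LINT x|\<T>. f x * K (y - x))"

lemma continuous_on_shift_reflect:
  "continuous_on UNIV f \<Longrightarrow> continuous_on UNIV (\<lambda>x. f (y - x :: 'a::real_normed_vector))"
  by (rule continuous_on_compose2[of UNIV f]) (auto intro!: continuous_intros)

lemma conv_integrable:
  fixes f K :: "real ^ 'n \<Rightarrow> real"
  assumes "integrable \<T> f" "torus_periodic K" "continuous_on UNIV K"
  shows "integrable \<T> (\<lambda>x. f x * K (y - x))"
proof -
  obtain B where "\<And>x. \<bar>K x\<bar> \<le> B" using torus_periodic_bounded[OF assms(2,3)] by blast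
  then show ?thesis
    by (intro integrable_mult_bounded[where B = B] assms(1) torus_borel_cont continuous_on_shift_reflect[OF assms(3)])
qed

lemma conv_sequence:
  fixes f :: "real ^ 'n \<Rightarrow> real"
  assumes f: "integrable \<T> f" and K: "\<And>n. continuous_on UNIV (k n)" "\<And>n x. \<bar>k n x\<bar> \<le> B"
    and lim: "\<And>x. (\<lambda>n. k n x) \<longlonglongrightarrow> k' x" and k': "continuous_on UNIV k'"
  shows "(\<lambda>n. LINT x|\<T>. f x * k n x) \<longlonglongrightarrow> (LINT x|\<T>. f x * k' x)"
proof (rule integral_dominated_convergence[where w = "\<lambda>x. B * \<bar>f x\<bar>"])
  show "AE x in \<T>. norm (f x * k n x) \<le> B * \<bar>f x\<bar>" for n
    using K(2) by (auto intro!: AE_I2 mult_right_mono simp: abs_mult mult.commute[of "\<bar>f _\<bar>"])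
  show "AE x in \<T>. (\<lambda>n. f x * k n x) \<longlonglongrightarrow> f x * k' x"
    by (intro AE_I2 tendsto_intros lim)
  show "integrable \<T> (\<lambda>x. B * \<bar>f x\<bar>)" using f by simp
  show "(\<lambda>x. f x * k n x) \<in> borel_measurable \<T>" for n
    by (intro borel_measurable_times borel_measurable_integrable[OF f] torus_borel_cont K)
  show "(\<lambda>x. f x * k' x) \<in> borel_measurable \<T>"
    by (intro borel_measurable_times borel_measurable_integrable[OF f] torus_borel_cont k')
qed

lemma continuous_conv:
  fixes f K :: "real ^ 'n \<Rightarrow> real"
  assumes f: "integrable \<T> f" and K: "torus_periodic K" "continuous_on UNIV K"
  shows "continuous_on UNIV (conv f K)"
  unfolding continuous_on_sequentially comp_def
proof (intro ballI allI impI)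
  fix y :: "nat \<Rightarrow> real ^ 'n" and a assume y: "(\<forall>n. y n \<in> UNIV) \<and> y \<longlonglongrightarrow> a"
  obtain B where B: "\<And>x. \<bar>K x\<bar> \<le> B" using torus_periodic_bounded[OF K] by blast
  have "isCont K z" for z using K(2) by (simp add: continuous_on_eq_continuous_at)
  then have "(\<lambda>n. K (y n - x)) \<longlonglongrightarrow> K (a - x)" for x
    using y by (intro isCont_tendsto_compose[of _ K] tendsto_intros) auto
  then show "(\<lambda>n. conv f K (y n)) \<longlonglongrightarrow> conv f K a"
    unfolding conv_def
    by (intro conv_sequence[where B = B] f continuous_on_shift_reflect[OF K(2)]) (auto intro: B)
qed

lemma periodic_conv: "torus_periodic K \<Longrightarrow> torus_periodic (conv f K)"
  unfolding torus_periodic_def conv_def by (simp add: diff_add_eq[symmetric])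

text \<open>
  All derivatives fall on the kernel. Its difference quotients are bounded by a Lipschitz constant, and
  so they may be integrated against \<open>f\<close> in the limit.
\<close>

lemma C1_conv:
  fixes f K :: "real ^ 'n \<Rightarrow> real"
  assumes f: "integrable \<T> f" and K: "C1_periodic K D"
  shows "C1_periodic (conv f K) (\<lambda>i. conv f (D i))"
  unfolding C1_periodic_def
proof (intro conjI allI)
  have K': "torus_periodic K" "continuous_on UNIV K"
    and D: "torus_periodic (D i)" "continuous_on UNIV (D i)" for i
    using K by (auto simp: C1_periodic_def)
  show "torus_periodic (conv f K)" "continuous_on UNIV (conv f K)"
    "torus_periodic (conv f (D i))" "continuous_on UNIV (conv f (D i))" for i
    by (intro periodic_conv continuous_conv f K' D)+
  fix i y
  obtain B where B: "\<And>x. \<bar>D i x\<bar> \<le> B" using torus_periodic_bounded[OF D] by blast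
  let ?q = "\<lambda>h x. (K (y - x + h *\<^sub>R axis i 1) - K (y - x)) / h"
  have "((\<lambda>h. (conv f K (y + h *\<^sub>R axis i 1) - conv f K y) / h) \<longlongrightarrow> conv f (D i) y) (at 0)"
    unfolding tendsto_at_iff_sequentially comp_def
  proof (intro allI impI)
    fix h :: "nat \<Rightarrow> real" assume h: "\<forall>n. h n \<in> UNIV - {0}" "h \<longlonglongrightarrow> 0"
    have eq: "(conv f K (y + h n *\<^sub>R axis i 1) - conv f K y) / h n
        = (LINT x|\<T>. f x * ?q (h n) x)" for n
    proof -
      have "conv f K (y + h n *\<^sub>R axis i 1) - conv f K y
          = (LINT x|\<T>. f x * K (y + h n *\<^sub>R axis i 1 - x) - f x * K (y - x))"
        unfolding conv_def by (rule Bochner_Integration.integral_diff[symmetric]) (intro conv_integrable f K')+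
      also have "\<dots> / h n = (LINT x|\<T>. (f x * K (y + h n *\<^sub>R axis i 1 - x) - f x * K (y - x)) / h n)"
        by simp
      also have "\<dots> = (LINT x|\<T>. f x * ?q (h n) x)"
        by (intro Bochner_Integration.integral_cong) (auto simp: algebra_simps diff_divide_distrib)
      finally show ?thesis .
    qed
    show "(\<lambda>n. (conv f K (y + h n *\<^sub>R axis i 1) - conv f K y) / h n) \<longlonglongrightarrow> conv f (D i) y"
      unfolding eq unfolding conv_def
    proof (rule conv_sequence[OF f, where B = B])
      show "continuous_on UNIV (?q (h n))" for n
      proof -
        have "continuous_on UNIV (\<lambda>x. K (y + h n *\<^sub>R axis i 1 - x))"
          by (rule continuous_on_shift_reflect[OF K'(2)])
        then have "continuous_on UNIV (\<lambda>x. K (y - x + h n *\<^sub>R axis i 1))"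
          by (simp add: algebra_simps)
        then show ?thesis
          using h by (intro continuous_on_divide continuous_on_diff continuous_on_const
              continuous_on_shift_reflect[OF K'(2)]) auto
      qed
      show "\<bar>?q (h n) x\<bar> \<le> B" for n x
        using C1_periodic_lipschitz[OF K B, of "y - x" "h n"] h
        unfolding abs_divide by (subst pos_divide_le_eq) auto
      show "(\<lambda>n. ?q (h n) x) \<longlonglongrightarrow> D i (y - x)" for x
      proof -
        have "((\<lambda>s. K (y - x + s *\<^sub>R axis i 1)) has_real_derivative D i (y - x)) (at 0)"
          using K by (auto simp: C1_periodic_def)
        then have "((\<lambda>s. (K (y - x + s *\<^sub>R axis i 1) - K (y - x)) / s) \<longlongrightarrow> D i (y - x)) (at 0)"
          by (simp add: DERIV_def)
        then show ?thesis
          by (rule filterlim_compose) (use h in \<open>auto simp: filterlim_at\<close>)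
      qed
    qed (intro continuous_on_shift_reflect[OF D(2)])
  qed
  then show "((\<lambda>s. conv f K (y + s *\<^sub>R axis i 1)) has_real_derivative conv f (D i) y) (at 0)"
    by (simp add: DERIV_def)
qed

interpretation torus_pair: pair_sigma_finite "\<T> :: (real ^ 'n) measure" "\<T> :: (real ^ 'n) measure"
  by standard

lemma torus_pair_diff_measurable:
  assumes "continuous_on UNIV (K :: real ^ 'n \<Rightarrow> real)"
  shows "(\<lambda>p. K (snd p - fst p)) \<in> borel_measurable (\<T> \<Otimes>\<^sub>M \<T>)"
proof -
  have id: "(\<lambda>x. x) \<in> borel_measurable (\<T> :: (real ^ 'n) measure)"
    by (intro torus_borel_measurable) simp
  have "(\<lambda>p. snd p - fst p) \<in> borel_measurable ((\<T> :: (real ^ 'n) measure) \<Otimes>\<^sub>M \<T>)"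
    by (intro borel_measurable_diff measurable_compose[OF measurable_fst id] measurable_compose[OF measurable_snd id])
  from measurable_compose[OF this borel_measurable_continuous_onI[OF assms]]
  show ?thesis .
qed

text \<open>
  Boundedness is asked of \<open>h\<close> only: in the applications \<open>f\<close> is a component of the vector field or its
  inner product with the gradient.
\<close>

lemma conv_Fubini:
  fixes f K :: "real ^ 'n \<Rightarrow> real"
  assumes f: "integrable \<T> f" and h: "h \<in> borel_measurable \<T>" "\<And>x. \<bar>h x\<bar> \<le> B"
    and K: "torus_periodic K" "continuous_on UNIV K"
  shows "(LINT y|\<T>. h y * conv f K y) = (LINT x|\<T>. f x * (LINT y|\<T>. h y * K (y - x)))"
proof -
  have fm: "f \<in> borel_measurable \<T>" using f by auto
  obtain C where C: "C \<ge> 0" "\<And>x. \<bar>K x\<bar> \<le> C" using torus_periodic_bounded[OF K] by blast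
  have B: "0 \<le> B" using h(2)[of 0] by linarith
  let ?F = "\<lambda>p. f (fst p) * (h (snd p) * K (snd p - fst p))"
  have hK: "integrable \<T> (\<lambda>y. h y * K (y - x))" for x
    using integrable_mult_bounded[OF _ h, of "\<lambda>y. K (y - x)"]
      torus_continuous_integrable[OF continuous_on_compose2[OF K(2), of UNIV "\<lambda>y. y - x"]]
    by (simp add: mult.commute continuous_on_diff)
  have bound: "(LINT y|\<T>. \<bar>h y * K (y - x)\<bar>) \<le> B * C" for x
  proof -
    have "(LINT y|\<T>. \<bar>h y * K (y - x)\<bar>) \<le> (LINT y|(\<T> :: (real ^ 'n) measure). B * C)"
    proof (rule integral_mono)
      show "\<bar>h y * K (y - x)\<bar> \<le> B * C" for y
        unfolding abs_mult using h(2) C B by (intro mult_mono) auto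
    qed (use hK in auto)
    then show ?thesis by simp
  qed
  have hK_meas: "(\<lambda>p. h (snd p) * K (snd p - fst p)) \<in> borel_measurable (\<T> \<Otimes>\<^sub>M \<T>)"
    by (intro borel_measurable_times measurable_compose[OF measurable_snd h(1)] torus_pair_diff_measurable K)
  have meas: "?F \<in> borel_measurable (\<T> \<Otimes>\<^sub>M \<T>)"
    by (intro borel_measurable_times[OF measurable_compose[OF measurable_fst fm] hK_meas])
  have meas2: "(\<lambda>x. LINT y|\<T>. \<bar>h y * K (y - x)\<bar>) \<in> borel_measurable \<T>"
  proof (rule torus.borel_measurable_lebesgue_integral)
    show "(\<lambda>(x, y). \<bar>h y * K (y - x)\<bar>) \<in> borel_measurable (\<T> \<Otimes>\<^sub>M \<T>)"
      using borel_measurable_abs[OF hK_meas] by (simp only: case_prod_unfold)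
  qed
  have int: "integrable (\<T> \<Otimes>\<^sub>M \<T>) ?F"
  proof (rule torus_pair.Fubini_integrable[OF meas])
    show "AE x in \<T>. integrable \<T> (\<lambda>y. ?F (x, y))"
      using hK by (intro AE_I2) simp
    have "integrable \<T> (\<lambda>x. \<bar>f x\<bar> * (LINT y|\<T>. \<bar>h y * K (y - x)\<bar>))"
      by (rule integrable_mult_bounded[where B = "B * C"]) (use f bound meas2 in auto)
    then show "integrable \<T> (\<lambda>x. LINT y|\<T>. norm (?F (x, y)))"
      by (simp add: abs_mult mult.assoc)
  qed
  have "(LINT y|\<T>. h y * conv f K y) = (LINT y|\<T>. LINT x|\<T>. ?F (x, y))"
    unfolding conv_def by (simp add: mult.left_commute[of "h _"] flip: integral_mult_right_zero)
  also have "\<dots> = (LINT x|\<T>. LINT y|\<T>. ?F (x, y))"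
    using torus_pair.Fubini_integral[of "\<lambda>x y. ?F (x, y)"] int by (simp add: case_prod_unfold)
  also have "\<dots> = (LINT x|\<T>. f x * (LINT y|\<T>. h y * K (y - x)))"
    by simp
  finally show ?thesis .
qed

lemma kernelD:
  assumes "kernel K"
  shows "smooth K" "torus_periodic K" "continuous_on UNIV K" "0 \<le> K z" "K (- z) = K z" "K (x - y) = K (y - x)"
proof -
  show "smooth K" "torus_periodic K" "0 \<le> K z" and ev: "K (- z) = K z" for z
    using assms by (auto simp: kernel_def)
  then show "continuous_on UNIV K" by (intro smooth_continuous)
  show "K (x - y) = K (y - x)" using ev[of "y - x"] by simp
qed

lemma kernel_mass:
  assumes "kernel K"
  shows "(LINT y|\<T>. K (y - x)) = 1" "(LINT y|\<T>. K (x - y)) = 1"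
proof -
  show "(LINT y|\<T>. K (y - x)) = 1"
    using torus_integral_shift[OF kernelD(2,3)[OF assms], of "- x"] assms
    by (simp add: kernel_def)
  then show "(LINT y|\<T>. K (x - y)) = 1"
    by (simp add: kernelD(6)[OF assms, of x])
qed

lemma integral_conv:
  assumes f: "integrable \<T> f" and K: "kernel K"
  shows "(LINT y|\<T>. conv f K y) = (LINT x|\<T>. f x)"
  using conv_Fubini[OF f, of "\<lambda>_. 1" 1 K] kernelD[OF K] kernel_mass[OF K] by simp

lemma conv_Fubini_kernel:
  assumes f: "integrable \<T> f" and h: "h \<in> borel_measurable \<T>" "\<And>x. \<bar>h x\<bar> \<le> B"
    and K: "kernel K"
  shows "(LINT y|\<T>. h y * conv f K y) = (LINT x|\<T>. f x * conv h K x)"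
  using conv_Fubini[OF f h kernelD(2,3)[OF K]] by (simp add: conv_def kernelD(6)[OF K])

text \<open>
  For fixed \<open>y\<close> the kernel is a probability density in \<open>x\<close>, and the variance of \<open>f\<close> is nonnegative.
\<close>

lemma conv_square_le:
  assumes f: "sq_integrable \<T> f" and K: "kernel K"
  shows "(conv f K y)\<^sup>2 \<le> conv (\<lambda>x. (f x)\<^sup>2) K y"
proof -
  let ?c = "conv f K y"
  note k = kernelD[OF K]
  have f1: "integrable \<T> f" by (rule torus.sq_integrable_imp_integrable[OF f])
  have f2: "integrable \<T> (\<lambda>x. (f x)\<^sup>2)" using f by (simp add: sq_integrable_def)
  have i: "integrable \<T> (\<lambda>x. (f x)\<^sup>2 * K (y - x))" "integrable \<T> (\<lambda>x. f x * K (y - x))"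
    "integrable \<T> (\<lambda>x. K (y - x))"
    by (intro conv_integrable f1 f2 k torus_continuous_integrable continuous_on_shift_reflect[OF k(3)])+
  have "0 \<le> (LINT x|\<T>. (f x - ?c)\<^sup>2 * K (y - x))"
    using k(4) by (intro integral_nonneg_AE AE_I2) simp
  also have "\<dots> = (LINT x|\<T>. (f x)\<^sup>2 * K (y - x) - 2 * ?c * (f x * K (y - x)) + ?c\<^sup>2 * K (y - x))"
    by (intro Bochner_Integration.integral_cong) (auto simp: power2_eq_square algebra_simps)
  also have "\<dots> = conv (\<lambda>x. (f x)\<^sup>2) K y - 2 * ?c * ?c + ?c\<^sup>2 * 1"
    using i kernel_mass(2)[OF K, of y] by (simp add: conv_def)
  finally show ?thesis by (simp add: power2_eq_square)
qed

lemma sq_integrable_continuous: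
  assumes "torus_periodic f" "continuous_on UNIV f"
  shows "sq_integrable \<T> f"
  by (metis torus.sq_integrable_bounded torus_borel_cont torus_periodic_bounded assms)

lemma conv_contraction:
  assumes f: "sq_integrable \<T> f" and K: "kernel K"
  shows "sq_integrable \<T> (conv f K)"
    and "(LINT y|\<T>. (conv f K y)\<^sup>2) \<le> (LINT x|\<T>. (f x)\<^sup>2)"
proof -
  note k = kernelD[OF K]
  have f1: "integrable \<T> f" by (rule torus.sq_integrable_imp_integrable[OF f])
  have f2: "integrable \<T> (\<lambda>x. (f x)\<^sup>2)" using f by (simp add: sq_integrable_def)
  show sq: "sq_integrable \<T> (conv f K)"
    by (intro sq_integrable_continuous periodic_conv continuous_conv f1 k)
  have "(LINT y|\<T>. (conv f K y)\<^sup>2) \<le> (LINT y|\<T>. conv (\<lambda>x. (f x)\<^sup>2) K y)"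
  proof (rule integral_mono)
    show "integrable \<T> (\<lambda>y. (conv f K y)\<^sup>2)" using sq by (simp add: sq_integrable_def)
    show "integrable \<T> (conv (\<lambda>x. (f x)\<^sup>2) K)"
      by (intro torus_continuous_integrable continuous_conv f2 k)
  qed (intro conv_square_le f K)
  also have "\<dots> = (LINT x|\<T>. (f x)\<^sup>2)" by (rule integral_conv[OF f2 K])
  finally show "(LINT y|\<T>. (conv f K y)\<^sup>2) \<le> (LINT x|\<T>. (f x)\<^sup>2)" .
qed

section \<open>Convergence of mollifications\<close>

lemma kernel_of_approx_identity: "approx_identity K \<Longrightarrow> kernel (K n)"
  by (simp add: approx_identity_def)

lemma conv_bounded:
  fixes h :: "real ^ 'n \<Rightarrow> real"
  assumes h: "h \<in> borel_measurable \<T>" "\<And>x. \<bar>h x\<bar> \<le> B" and K: "kernel K"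
  shows "\<bar>conv h K y\<bar> \<le> B"
proof -
  note k = kernelD[OF K]
  have int: "integrable \<T> h"
    by (intro torus.sq_integrable_imp_integrable torus.sq_integrable_bounded[where B = B] h)
  have "\<bar>conv h K y\<bar> \<le> (LINT x|\<T>. \<bar>h x * K (y - x)\<bar>)"
    unfolding conv_def by (rule integral_abs_bound)
  also have "\<dots> \<le> (LINT x|\<T>. B * K (y - x))"
  proof (rule integral_mono)
    show "integrable \<T> (\<lambda>x. \<bar>h x * K (y - x)\<bar>)"
      by (intro integrable_abs conv_integrable int k)
    show "integrable \<T> (\<lambda>x. B * K (y - x))"
      by (intro integrable_mult_right torus_continuous_integrable continuous_on_shift_reflect[OF k(3)])
    show "\<bar>h x * K (y - x)\<bar> \<le> B * K (y - x)" for x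
      using h(2)[of x] k(4)[of "y - x"] by (simp add: abs_mult mult_right_mono)
  qed
  also have "\<dots> = B" using kernel_mass(2)[OF K, of y] by simp
  finally show ?thesis .
qed

lemma conv_diff:
  fixes K :: "real ^ 'n \<Rightarrow> real"
  assumes "integrable \<T> f" "integrable \<T> g" "torus_periodic K" "continuous_on UNIV K"
  shows "conv (\<lambda>x. f x - g x) K y = conv f K y - conv g K y"
  using conv_integrable[OF assms(1,3,4), of y] conv_integrable[OF assms(2,3,4), of y]
  by (simp add: conv_def left_diff_distrib)

text \<open>
  Close to \<open>y\<close> the oscillation of \<open>g\<close> is small and the kernel has mass at most one; away from \<open>y\<close> the
  kernel is uniformly small.
\<close>

lemma conv_tendsto_at:
  fixes g :: "real ^ 'n \<Rightarrow> real"
  assumes K: "approx_identity K" and g: "continuous_on UNIV g" "\<And>x. \<bar>g x\<bar> \<le> B" and y: "y \<in> box 0 1"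
  shows "(\<lambda>n. conv g (K n) y) \<longlonglongrightarrow> g y"
proof (rule LIMSEQ_I)
  fix e :: real assume e: "e > 0"
  have B: "B \<ge> 0" using g(2)[of y] by linarith
  have "isCont g y" using g(1) by (simp add: continuous_on_eq_continuous_at)
  then obtain d where d: "d > 0" "\<And>x. dist x y < d \<Longrightarrow> dist (g x) (g y) < e / 2"
    using e unfolding continuous_at_eps_delta by (metis half_gt_zero)
  \<comment> \<open>With this bound on the kernel the far part contributes less than \<open>e / 2\<close>.\<close>
  define r where "r = e / (4 * B + 4)"
  have r: "r > 0" "2 * B * r < e / 2"
    using e B by (simp_all add: r_def field_simps)
  have "\<forall>\<^sub>F n in sequentially. \<forall>x\<in>cbox 0 1. d \<le> dist x y \<longrightarrow> K n (y - x) \<le> r"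
    using K y d(1) r(1) unfolding approx_identity_def by blast
  then obtain N where N: "\<And>n x. n \<ge> N \<Longrightarrow> x \<in> cbox 0 1 \<Longrightarrow> d \<le> dist x y \<Longrightarrow> K n (y - x) \<le> r"
    by (auto simp: eventually_sequentially)
  have "norm (conv g (K n) y - g y) < e" if n: "n \<ge> N" for n
  proof -
    note k = kernelD[OF kernel_of_approx_identity[OF K, of n]]
      kernel_mass[OF kernel_of_approx_identity[OF K, of n]]
    have gi: "integrable \<T> g" by (rule torus_continuous_integrable[OF g(1)])
    have Ki: "integrable \<T> (\<lambda>x. K n (y - x))"
      by (intro torus_continuous_integrable continuous_on_shift_reflect[OF k(3)])
    have gKi: "integrable \<T> (\<lambda>x. g x * K n (y - x))"
      by (intro conv_integrable gi k)
    have eq: "conv g (K n) y - g y = (LINT x|\<T>. (g x - g y) * K n (y - x))"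
      using k(8)[of y] gKi Ki by (simp add: conv_def left_diff_distrib)
    also have "\<bar>\<dots>\<bar> \<le> (LINT x|\<T>. \<bar>(g x - g y) * K n (y - x)\<bar>)"
      by (rule integral_abs_bound)
    also have "\<dots> \<le> (LINT x|\<T>. e / 2 * K n (y - x) + 2 * B * r)"
    proof (rule integral_mono)
      show "integrable \<T> (\<lambda>x. \<bar>(g x - g y) * K n (y - x)\<bar>)"
        using gKi Ki by (simp add: left_diff_distrib)
      show "integrable \<T> (\<lambda>x. e / 2 * K n (y - x) + 2 * B * r)"
        using Ki by simp
      fix x assume x: "x \<in> space (\<T> :: (real ^ 'n) measure)"
      show "\<bar>(g x - g y) * K n (y - x)\<bar> \<le> e / 2 * K n (y - x) + 2 * B * r"
      proof (cases "dist x y < d")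
        case True
        then have "\<bar>g x - g y\<bar> * K n (y - x) \<le> e / 2 * K n (y - x)"
          using d(2)[OF True] k(4) by (intro mult_right_mono) (auto simp: dist_real_def)
        moreover have "0 \<le> 2 * B * r" using B r by simp
        ultimately show ?thesis using k(4)[of "y - x"] by (simp add: abs_mult)
      next
        case False
        have "\<bar>g x - g y\<bar> * K n (y - x) \<le> (2 * B) * r"
          using N[OF n, of x] x False k(4) B g(2)[of x] g(2)[of y] by (intro mult_mono) auto
        moreover have "0 \<le> e / 2 * K n (y - x)" using e k(4)[of "y - x"] by simp
        ultimately show ?thesis using k(4)[of "y - x"] by (simp add: abs_mult)
      qed
    qed
    also have "\<dots> = e / 2 + 2 * B * r"
      using Ki k(8)[of y] by simp
    finally show ?thesis using r(2) by simp
  qed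
  then show "\<exists>N. \<forall>n\<ge>N. norm (conv g (K n) y - g y) < e" by blast
qed

lemma AE_torus_interior: "AE y in \<T>. y \<in> box 0 (1 :: real ^ 'n)"
proof -
  have "AE y in lebesgue. y \<notin> cbox 0 (1 :: real ^ 'n) - box 0 1"
    using negligible_frontier_interval[of 0 "1 :: real ^ 'n"]
    by (intro AE_not_in) (simp add: negligible_iff_null_sets)
  then show ?thesis
    unfolding torus_measure_def by (subst AE_restrict_space_iff) auto
qed

lemma conv_L2_tendsto_continuous:
  fixes g :: "real ^ 'n \<Rightarrow> real"
  assumes K: "approx_identity K" and g: "continuous_on UNIV g" "\<And>x. \<bar>g x\<bar> \<le> B"
  shows "(\<lambda>n. LINT y|\<T>. (conv g (K n) y - g y)\<^sup>2) \<longlonglongrightarrow> 0"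
proof -
  have gi: "integrable \<T> g" by (rule torus_continuous_integrable[OF g(1)])
  have gm: "g \<in> borel_measurable \<T>" by (rule torus_borel_cont[OF g(1)])
  have cm: "conv g (K n) \<in> borel_measurable \<T>" for n
    by (intro torus_borel_cont continuous_conv gi kernelD[OF kernel_of_approx_identity[OF K]])
  have "(\<lambda>n. LINT y|\<T>. (conv g (K n) y - g y)\<^sup>2) \<longlonglongrightarrow> (LINT y|(\<T> :: (real ^ 'n) measure). 0)"
  proof (rule integral_dominated_convergence[where w = "\<lambda>_. (2 * B)\<^sup>2"])
    show "AE y in \<T>. (\<lambda>n. (conv g (K n) y - g y)\<^sup>2) \<longlonglongrightarrow> 0"
      using AE_torus_interior
    proof eventually_elim
      case (elim y)
      have "(\<lambda>n. (conv g (K n) y - g y)\<^sup>2) \<longlonglongrightarrow> (g y - g y)\<^sup>2"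
        by (intro tendsto_intros conv_tendsto_at[OF K g elim])
      then show ?case by simp
    qed
    show "AE y in \<T>. norm ((conv g (K n) y - g y)\<^sup>2) \<le> (2 * B)\<^sup>2" for n
    proof (rule AE_I2)
      fix y
      have "\<bar>conv g (K n) y - g y\<bar> \<le> 2 * B"
        using conv_bounded[OF gm g(2) kernel_of_approx_identity[OF K], of n y] g(2)[of y] by linarith
      from power_mono[OF this, of 2] show "norm ((conv g (K n) y - g y)\<^sup>2) \<le> (2 * B)\<^sup>2"
        by simp
    qed
    show "(\<lambda>y. (conv g (K n) y - g y)\<^sup>2) \<in> borel_measurable \<T>" for n
      by (intro borel_measurable_power borel_measurable_diff cm gm)
  qed auto
  then show ?thesis by simp
qed

lemma two_squares: "(a + b)\<^sup>2 \<le> 2 * a\<^sup>2 + 2 * (b :: real)\<^sup>2"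
  using sum_squares_bound[of a b] by (simp add: power2_sum)

text \<open>
  A measurable function is an almost everywhere limit of continuous functions. Truncating all of them
  at the same height makes this convergence bounded.
\<close>

lemma L2_dense_continuous:
  fixes f :: "real ^ 'n \<Rightarrow> real"
  assumes f: "sq_integrable \<T> f" and e: "e > 0"
  obtains g B where "continuous_on UNIV g" "\<And>x. \<bar>g x\<bar> \<le> (B :: real)" "(LINT x|\<T>. (f x - g x)\<^sup>2) < e"
proof -
  have fm: "f \<in> borel_measurable \<T>" and f2: "integrable \<T> (\<lambda>x. (f x)\<^sup>2)"
    using f by (auto simp: sq_integrable_def)
  define c where "c R a = max (- real R) (min (real R) a)" for R and a :: real
  have c_bd: "\<bar>c R a\<bar> \<le> real R" for R a by (auto simp: c_def)
  have c_cont: "continuous_on UNIV (c R)" for R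
    unfolding c_def by (intro continuous_intros)
  have cm: "(\<lambda>x. c R (h x)) \<in> borel_measurable \<T>" if "h \<in> borel_measurable \<T>" for R and h :: "real ^ 'n \<Rightarrow> real"
    using measurable_compose[OF that borel_measurable_continuous_onI[OF c_cont[of R]]] .
  have "(\<lambda>R. LINT x|\<T>. (f x - c R (f x))\<^sup>2) \<longlonglongrightarrow> (LINT x|(\<T> :: (real ^ 'n) measure). 0)"
  proof (rule integral_dominated_convergence[where w = "\<lambda>x. (f x)\<^sup>2"])
    show "AE x in \<T>. (\<lambda>R. (f x - c R (f x))\<^sup>2) \<longlonglongrightarrow> 0"
    proof (rule AE_I2)
      fix x
      have "(\<lambda>R. (f x - c R (f x))\<^sup>2) \<longlonglongrightarrow> (f x - f x)\<^sup>2"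
        unfolding c_def by (intro tendsto_intros clip_tendsto)
      then show "(\<lambda>R. (f x - c R (f x))\<^sup>2) \<longlonglongrightarrow> 0" by simp
    qed
    show "AE x in \<T>. norm ((f x - c R (f x))\<^sup>2) \<le> (f x)\<^sup>2" for R
      by (intro AE_I2) (auto simp: c_def abs_le_square_iff[symmetric])
    show "(\<lambda>x. (f x - c R (f x))\<^sup>2) \<in> borel_measurable \<T>" for R
      by (intro borel_measurable_power borel_measurable_diff fm cm)
  qed (use f2 in auto)
  then have "\<forall>\<^sub>F R in sequentially. (LINT x|\<T>. (f x - c R (f x))\<^sup>2) < e / 4"
    using e by (intro order_tendstoD(2)) auto
  then obtain R where R: "(LINT x|\<T>. (f x - c R (f x))\<^sup>2) < e / 4"
    by (meson eventually_happens sequentially_bot)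
  have "f measurable_on cbox 0 1"
    using fm unfolding torus_measure_def by (subst measurable_on_iff_borel_measurable) auto
  then obtain N g where N: "negligible N" and g: "\<And>n. continuous_on UNIV (g n)"
      "\<And>x. x \<notin> N \<Longrightarrow> (\<lambda>n. g n x) \<longlonglongrightarrow> (if x \<in> cbox 0 1 then f x else 0)"
    unfolding measurable_on_def by blast
  have cg: "continuous_on UNIV (\<lambda>x. c R (g n x))" for n
    by (rule continuous_on_compose2[OF c_cont g(1)]) simp
  have "(\<lambda>n. LINT x|\<T>. (c R (f x) - c R (g n x))\<^sup>2) \<longlonglongrightarrow> (LINT x|(\<T> :: (real ^ 'n) measure). 0)"
  proof (rule integral_dominated_convergence[where w = "\<lambda>_. (2 * real R)\<^sup>2"])
    have "AE x in \<T>. x \<notin> N"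
      using N AE_not_in[of N lebesgue] unfolding torus_measure_def
      by (subst AE_restrict_space_iff) (auto simp: negligible_iff_null_sets)
    moreover have "AE x in \<T>. x \<in> cbox 0 (1 :: real ^ 'n)"
      by (intro AE_I2) simp
    ultimately show "AE x in \<T>. (\<lambda>n. (c R (f x) - c R (g n x))\<^sup>2) \<longlonglongrightarrow> 0"
    proof eventually_elim
      case (elim x)
      then have "(\<lambda>n. (c R (f x) - c R (g n x))\<^sup>2) \<longlonglongrightarrow> (c R (f x) - c R (f x))\<^sup>2"
        using g(2)[of x] unfolding c_def by (intro tendsto_intros) simp
      then show ?case by simp
    qed
    show "AE x in \<T>. norm ((c R (f x) - c R (g n x))\<^sup>2) \<le> (2 * real R)\<^sup>2" for n
    proof (rule AE_I2)
      fix x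
      have "\<bar>c R (f x) - c R (g n x)\<bar> \<le> 2 * real R"
        using c_bd[of R "f x"] c_bd[of R "g n x"] by linarith
      from power_mono[OF this, of 2] show "norm ((c R (f x) - c R (g n x))\<^sup>2) \<le> (2 * real R)\<^sup>2"
        by simp
    qed
    show "(\<lambda>x. (c R (f x) - c R (g n x))\<^sup>2) \<in> borel_measurable \<T>" for n
      by (intro borel_measurable_power borel_measurable_diff cm fm torus_borel_cont cg)
  qed auto
  then have "\<forall>\<^sub>F n in sequentially. (LINT x|\<T>. (c R (f x) - c R (g n x))\<^sup>2) < e / 4"
    using e by (intro order_tendstoD(2)) auto
  then obtain n where n: "(LINT x|\<T>. (c R (f x) - c R (g n x))\<^sup>2) < e / 4"
    by (meson eventually_happens sequentially_bot)
  have sq: "sq_integrable \<T> (\<lambda>x. c R (f x))" "sq_integrable \<T> (\<lambda>x. c R (g n x))"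
    by (intro torus.sq_integrable_bounded[where B = "real R"] cm fm torus_borel_cont g c_bd cg)+
  have i: "integrable \<T> (\<lambda>x. (f x - c R (f x))\<^sup>2)" "integrable \<T> (\<lambda>x. (c R (f x) - c R (g n x))\<^sup>2)"
     "integrable \<T> (\<lambda>x. (f x - c R (g n x))\<^sup>2)"
    using sq_integrable_diff[OF f sq(1)] sq_integrable_diff[OF sq] sq_integrable_diff[OF f sq(2)]
    by (auto simp: sq_integrable_def)
  have "(LINT x|\<T>. (f x - c R (g n x))\<^sup>2)
      \<le> (LINT x|\<T>. 2 * (f x - c R (f x))\<^sup>2 + 2 * (c R (f x) - c R (g n x))\<^sup>2)"
  proof (rule integral_mono)
    show "(f x - c R (g n x))\<^sup>2 \<le> 2 * (f x - c R (f x))\<^sup>2 + 2 * (c R (f x) - c R (g n x))\<^sup>2" for x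
      using two_squares[of "f x - c R (f x)" "c R (f x) - c R (g n x)"] by simp
  qed (use i in auto)
  also have "\<dots> = 2 * (LINT x|\<T>. (f x - c R (f x))\<^sup>2) + 2 * (LINT x|\<T>. (c R (f x) - c R (g n x))\<^sup>2)"
    using i by simp
  also have "\<dots> < e" using R n by simp
  finally show ?thesis by (intro that[of "\<lambda>x. c R (g n x)" "real R"] cg c_bd)
qed

text \<open>
  Continuous functions are dense, and replacing \<open>f\<close> by a nearby \<open>g\<close> changes the mollifications by no
  more than it changes \<open>f\<close>, because convolution contracts the norm.
\<close>

lemma conv_L2_tendsto:
  fixes f :: "real ^ 'n \<Rightarrow> real"
  assumes K: "approx_identity K" and f: "sq_integrable \<T> f"
  shows "(\<lambda>n. LINT y|\<T>. (conv f (K n) y - f y)\<^sup>2) \<longlonglongrightarrow> 0"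
proof (rule LIMSEQ_I)
  fix e :: real assume e: "e > 0"
  obtain g B where g: "continuous_on UNIV g" "\<And>x. \<bar>g x\<bar> \<le> B" and fg: "(LINT x|\<T>. (f x - g x)\<^sup>2) < e / 9"
    using L2_dense_continuous[OF f, of "e / 9"] e by auto
  have "\<forall>\<^sub>F n in sequentially. (LINT y|\<T>. (conv g (K n) y - g y)\<^sup>2) < e / 9"
    using conv_L2_tendsto_continuous[OF K g] e by (intro order_tendstoD(2)) auto
  then obtain N where N: "\<And>n. n \<ge> N \<Longrightarrow> (LINT y|\<T>. (conv g (K n) y - g y)\<^sup>2) < e / 9"
    by (auto simp: eventually_sequentially)
  have sg: "sq_integrable \<T> g"
    by (intro torus.sq_integrable_bounded[where B = B] torus_borel_cont g)
  have "norm ((LINT y|\<T>. (conv f (K n) y - f y)\<^sup>2) - 0) < e" if n: "n \<ge> N" for n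
  proof -
    note k = kernel_of_approx_identity[OF K, of n]
    note sfg = sq_integrable_diff[OF f sg]
    have eq: "conv f (K n) y = conv (\<lambda>x. f x - g x) (K n) y + conv g (K n) y" for y
      using conv_diff[OF torus.sq_integrable_imp_integrable[OF f] torus.sq_integrable_imp_integrable[OF sg] kernelD(2,3)[OF k]] by simp
    have i: "integrable \<T> (\<lambda>y. (conv (\<lambda>x. f x - g x) (K n) y)\<^sup>2)"
        "integrable \<T> (\<lambda>y. (conv g (K n) y - g y)\<^sup>2)"
        "integrable \<T> (\<lambda>y. (f y - g y)\<^sup>2)"
        "integrable \<T> (\<lambda>y. (conv f (K n) y - f y)\<^sup>2)"
      using conv_contraction(1)[OF sfg k] sfg sq_integrable_diff[OF conv_contraction(1)[OF sg k] sg]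
        sq_integrable_diff[OF conv_contraction(1)[OF f k] f]
      by (auto simp: sq_integrable_def)
    have "(LINT y|\<T>. (conv f (K n) y - f y)\<^sup>2) \<le>
      (LINT y|\<T>. 3 * ((conv (\<lambda>x. f x - g x) (K n) y)\<^sup>2 + (conv g (K n) y - g y)\<^sup>2 + (f y - g y)\<^sup>2))"
    proof (rule integral_mono)
      fix y
      show "(conv f (K n) y - f y)\<^sup>2 \<le> 3 * ((conv (\<lambda>x. f x - g x) (K n) y)\<^sup>2 + (conv g (K n) y - g y)\<^sup>2 + (f y - g y)\<^sup>2)"
        using three_squares[of "conv (\<lambda>x. f x - g x) (K n) y" "conv g (K n) y - g y" "g y - f y"]
        by (simp add: eq add_diff_eq power2_commute[of "g y" "f y"])
    qed (use i in auto)
    also have "\<dots> = 3 * ((LINT y|\<T>. (conv (\<lambda>x. f x - g x) (K n) y)\<^sup>2)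
        + (LINT y|\<T>. (conv g (K n) y - g y)\<^sup>2) + (LINT y|\<T>. (f y - g y)\<^sup>2))"
      using i by simp
    also have "\<dots> < e"
      using conv_contraction(2)[OF sfg k] fg N[OF n] by simp
    finally show ?thesis by simp
  qed
  then show "\<exists>N. \<forall>n\<ge>N. norm ((LINT y|\<T>. (conv f (K n) y - f y)\<^sup>2) - 0) < e" by blast
qed

lemma conv_weak_tendsto:
  assumes K: "approx_identity K" and f: "sq_integrable \<T> f" and g: "sq_integrable \<T> g"
  shows "(\<lambda>n. LINT y|\<T>. g y * conv f (K n) y) \<longlonglongrightarrow> (LINT y|\<T>. g y * f y)"
proof -
  have c: "sq_integrable \<T> (conv f (K n))" for n
    by (intro conv_contraction(1) f kernel_of_approx_identity K)
  have "(\<lambda>n. LINT y|\<T>. (conv f (K n) y - f y) * g y) \<longlonglongrightarrow> 0"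
    by (rule integral_mult_tendsto_L2[OF _ conv_L2_tendsto[OF K f] g order_refl])
      (intro sq_integrable_diff c f)
  moreover have "(LINT y|\<T>. (conv f (K n) y - f y) * g y)
      = (LINT y|\<T>. g y * conv f (K n) y) - (LINT y|\<T>. g y * f y)" for n
    using sq_integrable_mult[OF g c] sq_integrable_mult[OF g f] by (simp add: algebra_simps)
  ultimately show ?thesis by (simp add: LIM_zero_iff)
qed

section \<open>Divergence-free fields tested with differentiable functions\<close>

lemma periodic_reflect:
  assumes "torus_periodic g"
  shows "torus_periodic (\<lambda>x. g (y - x))"
  unfolding torus_periodic_def
proof (intro allI)
  fix x i
  have "g (y - (x + axis i 1)) = g (y - (x + axis i 1) + axis i 1)"
    by (rule assms[unfolded torus_periodic_def, rule_format, symmetric])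
  also have "y - (x + axis i 1) + axis i 1 = y - x" by simp
  finally show "g (y - (x + axis i 1)) = g (y - x)" .
qed

lemma C1_periodic_reflect:
  assumes "C1_periodic f D"
  shows "C1_periodic (\<lambda>x. f (y - x)) (\<lambda>i x. - D i (y - x))"
  unfolding C1_periodic_def
proof (intro conjI allI)
  have f: "torus_periodic f" "continuous_on UNIV f" and D: "torus_periodic (D i)" "continuous_on UNIV (D i)" for i
    using assms by (auto simp: C1_periodic_def)
  show "torus_periodic (\<lambda>x. f (y - x))" "continuous_on UNIV (\<lambda>x. f (y - x))"
    by (rule periodic_reflect[OF f(1)], rule continuous_on_shift_reflect[OF f(2)])
  fix i
  show "torus_periodic (\<lambda>x. - D i (y - x))"
    using periodic_reflect[OF D(1)] by (simp add: torus_periodic_def)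
  show "continuous_on UNIV (\<lambda>x. - D i (y - x))"
    by (intro continuous_on_minus continuous_on_shift_reflect[OF D(2)])
  fix x
  have "((\<lambda>s. f (y - x + s *\<^sub>R axis i 1)) has_real_derivative D i (y - x + (- 0) *\<^sub>R axis i 1)) (at (- 0))"
    by (rule C1_periodic_along[OF assms])
  then have "((\<lambda>s. f (y - x + (- s) *\<^sub>R axis i 1)) has_real_derivative - D i (y - x + (- 0) *\<^sub>R axis i 1)) (at 0)"
    by (rule DERIV_mirror[THEN iffD1])
  then show "((\<lambda>s. f (y - (x + s *\<^sub>R axis i 1))) has_real_derivative - D i (y - x)) (at 0)"
    by (simp add: algebra_simps)
qed

lemma smooth_reflect: "smooth f \<Longrightarrow> smooth (\<lambda>x. f (y - x))"
  using smooth_affine[of "\<lambda>x. - x" f y] bounded_linear_minus[OF bounded_linear_ident] by simp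

lemma partial_deriv_reflect:
  assumes "smooth f" "torus_periodic f"
  shows "partial_deriv i (\<lambda>x. f (y - x)) x = - partial_deriv i f (y - x)"
  using C1_periodic_reflect[OF C1_periodic_smooth[OF assms], of y]
    C1_periodic_smooth[OF smooth_reflect[OF assms(1)] periodic_reflect[OF assms(2)], of y]
    DERIV_unique unfolding C1_periodic_def by blast

text \<open>
  The divergence is assumed to vanish only when tested with kernels, because these are
  countably many conditions up to the choice of \<open>y\<close>. If \<open>D i\<close> is mollified, the derivative can be moved to
  the kernel and then, by Fubini's theorem, the kernel to \<open>b i\<close>.
\<close>

lemma divergence_free_C1:
  fixes b :: "'n \<Rightarrow> real ^ 'n \<Rightarrow> real"
  assumes K: "approx_identity K" and b: "\<And>i. sq_integrable \<T> (b i)"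
    and div: "\<And>n y. (\<Sum>i\<in>UNIV. conv (b i) (partial_deriv i (K n)) y) = 0"
    and \<psi>: "C1_periodic \<psi> D"
  shows "(\<Sum>i\<in>UNIV. LINT x|\<T>. b i x * D i x) = 0"
proof -
  have \<psi>': "torus_periodic \<psi>" "continuous_on UNIV \<psi>" and D: "torus_periodic (D i)" "continuous_on UNIV (D i)" for i
    using \<psi> by (auto simp: C1_periodic_def)
  have bi: "integrable \<T> (b i)" for i
    by (rule torus.sq_integrable_imp_integrable[OF b])
  obtain B where B: "\<And>x. \<bar>\<psi> x\<bar> \<le> B" using torus_periodic_bounded[OF \<psi>'] by blast
  have zero: "(\<Sum>i\<in>UNIV. LINT x|\<T>. b i x * conv (D i) (K n) x) = 0" for n
  proof -
    note ker = kernel_of_approx_identity[OF K, of n]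
    note k = kernelD[OF ker]
    have CK: "C1_periodic (K n) (\<lambda>i. partial_deriv i (K n))" by (rule C1_periodic_smooth[OF k(1,2)])
    then have pd: "torus_periodic (partial_deriv i (K n))" "continuous_on UNIV (partial_deriv i (K n))" for i
      by (auto simp: C1_periodic_def)
    have parts: "(LINT y|\<T>. \<psi> y * partial_deriv i (K n) (y - x)) = - conv (D i) (K n) x" for i x
    proof -
      have "C1_periodic (\<lambda>y. K n (x - y)) (\<lambda>i y. - partial_deriv i (K n) (x - y))"
        by (rule C1_periodic_reflect[OF CK])
      moreover have "partial_deriv i (K n) (y - x) = - partial_deriv i (K n) (x - y)" for i y
        using partial_deriv_reflect[OF k(1,2), of i 0 "x - y"] k(5) by simp
      ultimately have "C1_periodic (\<lambda>y. K n (x - y)) (\<lambda>i y. partial_deriv i (K n) (y - x))"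
        by simp
      from integral_by_parts_periodic[OF \<psi> this, of i]
      show ?thesis by (simp add: conv_def)
    qed
    have "(LINT x|\<T>. b i x * conv (D i) (K n) x) = - (LINT y|\<T>. \<psi> y * conv (b i) (partial_deriv i (K n)) y)" for i
      using conv_Fubini[OF bi torus_borel_cont[OF \<psi>'(2)] B pd] by (simp add: parts)
    then have "(\<Sum>i\<in>UNIV. LINT x|\<T>. b i x * conv (D i) (K n) x)
        = - (\<Sum>i\<in>UNIV. LINT y|\<T>. \<psi> y * conv (b i) (partial_deriv i (K n)) y)"
      by (simp add: sum_negf)
    also have "(\<Sum>i\<in>UNIV. LINT y|\<T>. \<psi> y * conv (b i) (partial_deriv i (K n)) y)
        = (LINT y|\<T>. (\<Sum>i\<in>UNIV. \<psi> y * conv (b i) (partial_deriv i (K n)) y))"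
      by (intro Bochner_Integration.integral_sum[symmetric] torus_continuous_integrable continuous_on_mult
          \<psi>' continuous_conv bi pd)
    also have "\<dots> = 0" by (simp add: sum_distrib_left[symmetric] div)
    finally show ?thesis by simp
  qed
  have "(\<lambda>n. \<Sum>i\<in>UNIV. LINT x|\<T>. b i x * conv (D i) (K n) x)
      \<longlonglongrightarrow> (\<Sum>i\<in>UNIV. LINT x|\<T>. b i x * D i x)"
    by (intro tendsto_sum conv_weak_tendsto K b sq_integrable_continuous D)
  then show ?thesis by (simp add: zero LIMSEQ_const_iff)
qed

section \<open>A smooth convex approximation of the absolute value\<close>

text \<open>
  This is the function \<open>\<beta>\<close> of the introduction. Its linear growth corresponds to \<open>\<bar>\<beta>'\<bar> \<le> 1\<close>.
\<close>

definition soft_abs :: "real \<Rightarrow> real" where "soft_abs s = sqrt (1 + s\<^sup>2) - 1"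

definition soft_sgn :: "real \<Rightarrow> real" where "soft_sgn s = s / sqrt (1 + s\<^sup>2)"

definition soft_sgn' :: "real \<Rightarrow> real" where "soft_sgn' s = 1 / ((1 + s\<^sup>2) * sqrt (1 + s\<^sup>2))"

lemma one_plus_square_pos: "0 < 1 + (s :: real)\<^sup>2"
  by (simp add: add_pos_nonneg)

lemma soft_abs_DERIV: "(soft_abs has_real_derivative soft_sgn s) (at s)"
  unfolding soft_abs_def[abs_def] soft_sgn_def using one_plus_square_pos[of s]
  by (auto intro!: derivative_eq_intros simp: field_simps)

lemma soft_sgn_DERIV: "(soft_sgn has_real_derivative soft_sgn' s) (at s)"
proof -
  let ?r = "sqrt (1 + s\<^sup>2)"
  note p = one_plus_square_pos[of s]
  have r: "?r > 0" "?r * ?r = 1 + s\<^sup>2" using p by auto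
  have d: "((\<lambda>s. sqrt (1 + s\<^sup>2)) has_real_derivative s / ?r) (at s)"
    using p by (auto intro!: derivative_eq_intros simp: field_simps)
  have "((\<lambda>s. s / sqrt (1 + s\<^sup>2)) has_real_derivative (1 * ?r - s * (s / ?r)) / (?r * ?r)) (at s)"
    by (rule DERIV_divide[OF DERIV_ident d]) (use r in auto)
  also have "(1 * ?r - s * (s / ?r)) / (?r * ?r) = soft_sgn' s"
  proof -
    have "1 * ?r - s * (s / ?r) = (?r * ?r - s\<^sup>2) / ?r"
      using r(1) by (simp add: field_simps power2_eq_square)
    then show ?thesis using r by (simp add: soft_sgn'_def mult.commute)
  qed
  finally show ?thesis by (simp add: soft_sgn_def[abs_def])
qed

lemma soft_sgn'_nonneg: "0 \<le> soft_sgn' s"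
  using one_plus_square_pos[of s] by (simp add: soft_sgn'_def)

lemma soft_sgn'_le_1: "soft_sgn' s \<le> 1"
proof -
  have "1 * 1 \<le> (1 + s\<^sup>2) * sqrt (1 + s\<^sup>2)"
    by (intro mult_mono) auto
  then show ?thesis by (simp add: soft_sgn'_def divide_le_eq_1)
qed

lemma soft_sgn_bounded: "\<bar>soft_sgn s\<bar> \<le> 1"
proof -
  have "\<bar>s\<bar> \<le> sqrt (1 + s\<^sup>2)" by (rule real_le_rsqrt) simp
  then show ?thesis
    using one_plus_square_pos[of s] by (simp add: soft_sgn_def abs_divide divide_le_eq)
qed

lemma soft_abs_lipschitz: "\<bar>soft_abs a - soft_abs b\<bar> \<le> \<bar>a - b\<bar>"
  using field_differentiable_bound[of UNIV soft_abs soft_sgn 1 a b] soft_abs_DERIV soft_sgn_bounded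
  by simp

lemma soft_sgn_lipschitz: "\<bar>soft_sgn a - soft_sgn b\<bar> \<le> \<bar>a - b\<bar>"
  using field_differentiable_bound[of UNIV soft_sgn soft_sgn' 1 a b] soft_sgn_DERIV soft_sgn'_nonneg soft_sgn'_le_1
  by simp

lemma continuous_soft_abs: "continuous_on UNIV soft_abs"
  by (rule DERIV_continuous_on[where D = soft_sgn]) (rule soft_abs_DERIV)

lemma soft_abs_integrable:
  assumes "integrable M h"
  shows "integrable M (\<lambda>x. soft_abs (h x))"
proof (rule Bochner_Integration.integrable_bound[OF assms])
  show "(\<lambda>x. soft_abs (h x)) \<in> borel_measurable M"
    by (rule measurable_compose[OF borel_measurable_integrable[OF assms]
          borel_measurable_continuous_onI[OF continuous_soft_abs]])
  show "AE x in M. norm (soft_abs (h x)) \<le> norm (h x)"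
    using soft_abs_lipschitz[of _ 0] by (intro AE_I2) (simp add: soft_abs_def)
qed

lemma continuous_soft_sgn: "continuous_on UNIV soft_sgn"
  by (rule DERIV_continuous_on[where D = soft_sgn']) (rule soft_sgn_DERIV)

lemma soft_sgn_measurable: "h \<in> borel_measurable M \<Longrightarrow> (\<lambda>x. soft_sgn (h x)) \<in> borel_measurable M"
  by (rule measurable_compose[OF _ borel_measurable_continuous_onI[OF continuous_soft_sgn]])

lemma continuous_soft_sgn': "continuous_on UNIV soft_sgn'"
  unfolding soft_sgn'_def using one_plus_square_pos
  by (intro continuous_intros) (auto simp: less_imp_neq[symmetric])

lemma soft_abs_nonneg: "0 \<le> soft_abs s" and soft_abs_eq_0_iff: "soft_abs s = 0 \<longleftrightarrow> s = 0"
  by (auto simp: soft_abs_def)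

lemma soft_abs_convex: "soft_abs t - soft_abs s \<le> soft_sgn t * (t - s)"
proof -
  \<comment> \<open>The Cauchy-Schwarz inequality for the vectors \<open>(1, s)\<close> and \<open>(1, t)\<close>.\<close>
  have "1 + s * t \<le> sqrt (1 + s\<^sup>2) * sqrt (1 + t\<^sup>2)"
  proof -
    have "(1 + s * t)\<^sup>2 \<le> (1 + s\<^sup>2) * (1 + t\<^sup>2)"
      using sum_squares_bound[of s t] by (simp add: power2_eq_square algebra_simps)
    then show ?thesis by (simp add: real_sqrt_mult[symmetric] real_le_rsqrt)
  qed
  then have "(1 + s * t) / sqrt (1 + t\<^sup>2) \<le> sqrt (1 + s\<^sup>2)"
    using one_plus_square_pos[of t] by (simp add: pos_divide_le_eq)
  moreover have "sqrt (1 + t\<^sup>2) = (1 + t\<^sup>2) / sqrt (1 + t\<^sup>2)"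
    using one_plus_square_pos[of t] by (simp add: real_div_sqrt)
  ultimately show ?thesis
    by (simp add: soft_abs_def soft_sgn_def right_diff_distrib power2_eq_square add_divide_distrib diff_divide_distrib mult.commute)
qed

section \<open>Entropy production at a fixed time\<close>

text \<open>
  The time derivative of \<open>conv w K y\<close> if \<open>w\<close> solves the equation: the Laplacian of \<open>w\<close> minus the divergence
  of \<open>w b\<close>, tested with the kernel centred at \<open>y\<close>.
\<close>

definition mollified_flux :: "(real ^ 'n \<Rightarrow> real) \<Rightarrow> (real ^ 'n \<Rightarrow> real) \<Rightarrow> ('n \<Rightarrow> real ^ 'n \<Rightarrow> real) \<Rightarrow> real ^ 'n \<Rightarrow> real" where
  "mollified_flux K w b y = (\<Sum>i\<in>UNIV. conv w (partial_deriv i (partial_deriv i K)) y - conv (\<lambda>x. w x * b i x) (partial_deriv i K) y)"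

text \<open>
  Time is frozen here: \<open>w\<close>, \<open>b\<close> and \<open>G\<close> stand for the difference of two solutions, the vector field and
  the weak gradient of \<open>w\<close> at a time at which all of them are square-integrable.
\<close>

context
  fixes K :: "nat \<Rightarrow> real ^ 'n \<Rightarrow> real" and b G :: "'n \<Rightarrow> real ^ 'n \<Rightarrow> real" and w :: "real ^ 'n \<Rightarrow> real"
  assumes K: "approx_identity K" and b: "\<And>i. sq_integrable \<T> (b i)"
    and div: "\<And>n y. (\<Sum>i\<in>UNIV. conv (b i) (partial_deriv i (K n)) y) = 0"
    and w: "sq_integrable \<T> w" and G: "\<And>i. sq_integrable \<T> (G i)"
    and weak: "\<And>\<psi> i. smooth \<psi> \<Longrightarrow> torus_periodic \<psi> \<Longrightarrow>
       (LINT x|\<T>. w x * partial_deriv i \<psi> x) = - (LINT x|\<T>. G i x * \<psi> x)"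
begin

lemma conv_partial_deriv:
  assumes "smooth k" "torus_periodic k"
  shows "conv w (partial_deriv i k) y = conv (G i) k y"
proof -
  have "(LINT x|\<T>. w x * partial_deriv i (\<lambda>x. k (y - x)) x) = - (LINT x|\<T>. G i x * k (y - x))"
    by (intro weak smooth_reflect periodic_reflect assms)
  then show ?thesis by (simp add: partial_deriv_reflect[OF assms] conv_def)
qed

lemma mollifier_props: "kernel (K n)" "smooth (K n)" "torus_periodic (K n)" "continuous_on UNIV (K n)"
  "C1_periodic (K n) (\<lambda>i. partial_deriv i (K n))"
  using kernel_of_approx_identity[OF K] kernelD C1_periodic_smooth by blast+

lemma integrable_w: "integrable \<T> w" and integrable_G: "integrable \<T> (G i)"
  by (intro torus.sq_integrable_imp_integrable w G)+

lemma C1_mollified: "C1_periodic (conv w (K n)) (\<lambda>i. conv (G i) (K n))"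
proof -
  have "(\<lambda>i. conv w (partial_deriv i (K n))) = (\<lambda>i. conv (G i) (K n))"
    using conv_partial_deriv[OF mollifier_props(2,3)] by (intro ext) simp
  then show ?thesis using C1_conv[OF integrable_w mollifier_props(5)[of n]] by (simp only:)
qed

text \<open>
  This says that the integral of \<open>b \<bullet> \<nabla>(w \<phi>)\<close> vanishes. It holds when \<open>w\<close> is replaced by its mollification,
  and square-integrability of \<open>b\<close>, \<open>w\<close> and \<open>G\<close> permits passing to the limit.
\<close>

lemma transport_by_parts:
  assumes \<phi>: "C1_periodic \<phi> D"
  shows "(\<Sum>i\<in>UNIV. LINT x|\<T>. w x * b i x * D i x) = - (\<Sum>i\<in>UNIV. LINT x|\<T>. b i x * G i x * \<phi> x)"
proof -
  have \<phi>': "torus_periodic \<phi>" "continuous_on UNIV \<phi>" and D: "torus_periodic (D i)" "continuous_on UNIV (D i)" for i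
    using \<phi> by (auto simp: C1_periodic_def)
  obtain B where B: "\<And>x. \<bar>\<phi> x\<bar> \<le> B" using torus_periodic_bounded[OF \<phi>'] by blast
  have bD: "sq_integrable \<T> (\<lambda>x. b i x * D i x)" for i
  proof -
    obtain C where "\<And>x. \<bar>D i x\<bar> \<le> C" using torus_periodic_bounded[OF D] by blast
    then show ?thesis by (intro sq_integrable_mult_bounded[where B = C] b torus_borel_cont D)
  qed
  have b\<phi>: "sq_integrable \<T> (\<lambda>x. b i x * \<phi> x)" for i
    by (intro sq_integrable_mult_bounded[where B = B] b torus_borel_cont \<phi>' B)
  note c = conv_contraction(1)[OF _ mollifier_props(1)]
  have "(\<Sum>i\<in>UNIV. LINT x|\<T>. b i x * \<phi> x * conv (G i) (K n) x) +
      (\<Sum>i\<in>UNIV. LINT x|\<T>. b i x * D i x * conv w (K n) x) = 0" for n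
  proof -
    have "(\<Sum>i\<in>UNIV. LINT x|\<T>. b i x * (conv (G i) (K n) x * \<phi> x + conv w (K n) x * D i x)) = 0"
      by (rule divergence_free_C1[OF K b div C1_periodic_mult[OF C1_mollified \<phi>]])
    moreover have "(LINT x|\<T>. b i x * (conv (G i) (K n) x * \<phi> x + conv w (K n) x * D i x))
      = (LINT x|\<T>. b i x * \<phi> x * conv (G i) (K n) x) + (LINT x|\<T>. b i x * D i x * conv w (K n) x)" for i
      by (subst Bochner_Integration.integral_add[symmetric,
            OF sq_integrable_mult[OF b\<phi> c[OF G]] sq_integrable_mult[OF bD c[OF w]]])
        (simp add: algebra_simps)
    ultimately show ?thesis by (simp add: sum.distrib)
  qed
  moreover have "(\<lambda>n. (\<Sum>i\<in>UNIV. LINT x|\<T>. b i x * \<phi> x * conv (G i) (K n) x) +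
      (\<Sum>i\<in>UNIV. LINT x|\<T>. b i x * D i x * conv w (K n) x))
    \<longlonglongrightarrow> (\<Sum>i\<in>UNIV. LINT x|\<T>. b i x * \<phi> x * G i x) +
      (\<Sum>i\<in>UNIV. LINT x|\<T>. b i x * D i x * w x)"
    by (intro tendsto_add tendsto_sum conv_weak_tendsto K w G b\<phi> bD)
  ultimately have "(\<Sum>i\<in>UNIV. LINT x|\<T>. b i x * \<phi> x * G i x) +
      (\<Sum>i\<in>UNIV. LINT x|\<T>. b i x * D i x * w x) = 0"
    by (simp add: LIMSEQ_const_iff)
  then show ?thesis by (simp add: mult_ac)
qed

lemma integrable_bG: "integrable \<T> (\<lambda>x. \<Sum>i\<in>UNIV. b i x * G i x)"
  by (intro Bochner_Integration.integrable_sum sq_integrable_mult b G)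

lemma soft_sgn_mollified_C1:
  "C1_periodic (\<lambda>y. soft_sgn (conv w (K n) y)) (\<lambda>i y. soft_sgn' (conv w (K n) y) * conv (G i) (K n) y)"
  by (rule C1_periodic_compose[OF C1_mollified soft_sgn_DERIV continuous_soft_sgn'])

text \<open>
  In the transport term the derivative of the kernel has disappeared; what is left is the
  mollification of the integrable function \<open>b \<bullet> G\<close>.
\<close>

lemma mollified_flux_eq:
  "mollified_flux (K n) w b y = (\<Sum>i\<in>UNIV. conv (G i) (partial_deriv i (K n)) y) - conv (\<lambda>x. \<Sum>i\<in>UNIV. b i x * G i x) (K n) y"
proof -
  have "conv w (partial_deriv i (partial_deriv i (K n))) y = conv (G i) (partial_deriv i (K n)) y" for i
    using mollifier_props(5) by (intro conv_partial_deriv smooth_partial_deriv mollifier_props) (auto simp: C1_periodic_def)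
  moreover have "(\<Sum>i\<in>UNIV. conv (\<lambda>x. w x * b i x) (partial_deriv i (K n)) y) = conv (\<lambda>x. \<Sum>i\<in>UNIV. b i x * G i x) (K n) y"
  proof -
    have "integrable \<T> (\<lambda>x. b i x * G i x * K n (y - x))" for i
      using conv_integrable[OF sq_integrable_mult[OF b G] mollifier_props(3,4)] .
    then have "conv (\<lambda>x. \<Sum>i\<in>UNIV. b i x * G i x) (K n) y = (\<Sum>i\<in>UNIV. LINT x|\<T>. b i x * G i x * K n (y - x))"
      by (simp add: conv_def sum_distrib_right)
    then show ?thesis
      using transport_by_parts[OF C1_periodic_reflect[OF mollifier_props(5)[of n], of y]]
      by (simp add: conv_def sum_negf)
  qed
  ultimately show ?thesis by (simp add: mollified_flux_def sum_subtractf)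
qed

text \<open>
  Integration by parts turns the diffusion term into minus the integral of \<open>\<beta>''(W) \<bar>\<nabla>W\<bar>\<^sup>2\<close>, which is
  dropped. In the transport term the kernel is moved to the bounded factor.
\<close>

lemma soft_sgn_flux_le:
  "(LINT y|\<T>. soft_sgn (conv w (K n) y) * mollified_flux (K n) w b y)
   \<le> - (LINT x|\<T>. (\<Sum>i\<in>UNIV. b i x * G i x) * conv (\<lambda>y. soft_sgn (conv w (K n) y)) (K n) x)"
proof -
  let ?s = "\<lambda>y. soft_sgn (conv w (K n) y)" and ?S = "\<lambda>x. \<Sum>i\<in>UNIV. b i x * G i x"
  have C: "C1_periodic (conv (G i) (K n)) (\<lambda>j. conv (G i) (partial_deriv j (K n)))" for i
    by (rule C1_conv[OF integrable_G mollifier_props(5)])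
  have cs: "continuous_on UNIV ?s" using soft_sgn_mollified_C1 by (auto simp: C1_periodic_def)
  have cG: "continuous_on UNIV (conv (G i) (partial_deriv j (K n)))" for i j
    using C by (auto simp: C1_periodic_def)
  have i: "integrable \<T> (\<lambda>y. ?s y * conv (G i) (partial_deriv i (K n)) y)" for i
    by (intro torus_continuous_integrable continuous_on_mult cs cG)
  have i2: "integrable \<T> (\<lambda>y. ?s y * conv ?S (K n) y)"
    by (intro torus_continuous_integrable continuous_on_mult cs continuous_conv integrable_bG mollifier_props)
  have dissip: "(LINT y|\<T>. ?s y * conv (G i) (partial_deriv i (K n)) y) \<le> 0" for i
  proof -
    have "(LINT y|\<T>. ?s y * conv (G i) (partial_deriv i (K n)) y)
      = - (LINT y|\<T>. conv (G i) (K n) y * (soft_sgn' (conv w (K n) y) * conv (G i) (K n) y))"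
      using integral_by_parts_periodic[OF C soft_sgn_mollified_C1, of i i] by (simp add: mult.commute)
    also have "\<dots> = - (LINT y|\<T>. soft_sgn' (conv w (K n) y) * (conv (G i) (K n) y)\<^sup>2)"
      by (simp add: power2_eq_square mult_ac)
    also have "\<dots> \<le> 0" by (simp add: soft_sgn'_nonneg)
    finally show ?thesis .
  qed
  have "(LINT y|\<T>. ?s y * mollified_flux (K n) w b y)
    = (\<Sum>i\<in>UNIV. LINT y|\<T>. ?s y * conv (G i) (partial_deriv i (K n)) y) - (LINT y|\<T>. ?s y * conv ?S (K n) y)"
    unfolding mollified_flux_eq using i i2 by (simp add: right_diff_distrib sum_distrib_left)
  also have "\<dots> \<le> - (LINT y|\<T>. ?s y * conv ?S (K n) y)"
    using sum_nonpos[of UNIV, OF dissip] by simp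
  also have "(LINT y|\<T>. ?s y * conv ?S (K n) y) = (LINT x|\<T>. ?S x * conv ?s (K n) x)"
    by (rule conv_Fubini_kernel[OF integrable_bG torus_borel_cont[OF cs] soft_sgn_bounded mollifier_props(1)])
  finally show ?thesis .
qed

lemma mollified_measurable: "conv w (K n) \<in> borel_measurable \<T>"
  by (rule sq_integrable_measurable[OF conv_contraction(1)[OF w mollifier_props(1)]])

lemma soft_sgn_mollified_L2:
  "(\<lambda>n. LINT x|\<T>. (soft_sgn (conv w (K n) x) - soft_sgn (w x))\<^sup>2) \<longlonglongrightarrow> 0"
proof (rule tendsto_sandwich[OF _ _ tendsto_const conv_L2_tendsto[OF K w]])
  have sd: "sq_integrable \<T> (\<lambda>x. conv w (K n) x - w x)" for n
    by (intro sq_integrable_diff conv_contraction w mollifier_props)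
  show "\<forall>\<^sub>F n in sequentially. (LINT x|\<T>. (soft_sgn (conv w (K n) x) - soft_sgn (w x))\<^sup>2)
      \<le> (LINT x|\<T>. (conv w (K n) x - w x)\<^sup>2)"
  proof (rule always_eventually, rule allI, rule integral_mono_AE')
    fix n
    show "integrable \<T> (\<lambda>x. (conv w (K n) x - w x)\<^sup>2)"
      using sd by (simp add: sq_integrable_def)
    show "AE x in \<T>. (soft_sgn (conv w (K n) x) - soft_sgn (w x))\<^sup>2 \<le> (conv w (K n) x - w x)\<^sup>2"
      by (intro AE_I2) (simp add: abs_le_square_iff[symmetric] soft_sgn_lipschitz)
  qed auto
qed auto

text \<open>
  The mollification of \<open>\<beta>'(W)\<close> converges to \<open>\<beta>'(w)\<close>, and so the limit is the integral of \<open>\<beta>'(w) b \<bullet> G\<close>.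
  The same integral is the limit of the integrals of \<open>b \<bullet> \<nabla>(\<beta>(W))\<close>, and these vanish.
\<close>

lemma commutator_vanishes:
  "(\<lambda>n. LINT x|\<T>. (\<Sum>i\<in>UNIV. b i x * G i x) * conv (\<lambda>y. soft_sgn (conv w (K n) y)) (K n) x) \<longlonglongrightarrow> 0"
proof -
  let ?s = "\<lambda>n y. soft_sgn (conv w (K n) y)" and ?S = "\<lambda>x. \<Sum>i\<in>UNIV. b i x * G i x"
  have wm: "w \<in> borel_measurable \<T>" by (rule sq_integrable_measurable[OF w])
  have sm: "(\<lambda>x. soft_sgn (w x)) \<in> borel_measurable \<T>" "?s n \<in> borel_measurable \<T>" for n
    by (intro soft_sgn_measurable wm mollified_measurable)+
  have ssq: "sq_integrable \<T> (\<lambda>x. soft_sgn (w x))" "sq_integrable \<T> (?s n)" for n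
    by (intro torus.sq_integrable_bounded[where B = 1] sm soft_sgn_bounded)+
  note kc = conv_contraction[OF _ mollifier_props(1)]
  have sdb: "\<bar>soft_sgn a - soft_sgn b\<bar> \<le> 2" for a b
    using soft_sgn_bounded[of a] soft_sgn_bounded[of b] by linarith
  \<comment> \<open>The error of the mollified \<open>\<beta>'(W)\<close> is that of \<open>\<beta>'(W)\<close>, contracted, plus that of mollifying \<open>\<beta>'(w)\<close>.\<close>
  have L2: "(\<lambda>n. LINT x|\<T>. (conv (?s n) (K n) x - soft_sgn (w x))\<^sup>2) \<longlonglongrightarrow> 0"
  proof (rule tendsto_sandwich[OF _ _ tendsto_const])
    show "(\<lambda>n. 2 * (LINT x|\<T>. (?s n x - soft_sgn (w x))\<^sup>2)
        + 2 * (LINT x|\<T>. (conv (\<lambda>x. soft_sgn (w x)) (K n) x - soft_sgn (w x))\<^sup>2)) \<longlonglongrightarrow> 0"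
      using tendsto_add[OF tendsto_mult_left[OF soft_sgn_mollified_L2, of 2]
          tendsto_mult_left[OF conv_L2_tendsto[OF K ssq(1)], of 2]] by simp
    show "\<forall>\<^sub>F n in sequentially. (LINT x|\<T>. (conv (?s n) (K n) x - soft_sgn (w x))\<^sup>2)
      \<le> 2 * (LINT x|\<T>. (?s n x - soft_sgn (w x))\<^sup>2)
        + 2 * (LINT x|\<T>. (conv (\<lambda>x. soft_sgn (w x)) (K n) x - soft_sgn (w x))\<^sup>2)"
    proof (intro always_eventually allI)
      fix n
      let ?d = "\<lambda>x. ?s n x - soft_sgn (w x)" and ?c = "\<lambda>x. conv (\<lambda>x. soft_sgn (w x)) (K n) x - soft_sgn (w x)"
      have sqd: "sq_integrable \<T> ?d" by (intro sq_integrable_diff ssq)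
      have i: "integrable \<T> (\<lambda>x. (conv ?d (K n) x)\<^sup>2)" "integrable \<T> (\<lambda>x. (?c x)\<^sup>2)"
        using kc(1)[OF sqd] sq_integrable_diff[OF kc(1)[OF ssq(1)] ssq(1)] by (auto simp: sq_integrable_def)
      have eq: "conv ?d (K n) x = conv (?s n) (K n) x - conv (\<lambda>x. soft_sgn (w x)) (K n) x" for x
        by (intro conv_diff torus.sq_integrable_imp_integrable ssq mollifier_props)
      have "(LINT x|\<T>. (conv (?s n) (K n) x - soft_sgn (w x))\<^sup>2)
          \<le> (LINT x|\<T>. 2 * (conv ?d (K n) x)\<^sup>2 + 2 * (?c x)\<^sup>2)"
      proof (rule integral_mono_AE')
        show "AE x in \<T>. (conv (?s n) (K n) x - soft_sgn (w x))\<^sup>2 \<le> 2 * (conv ?d (K n) x)\<^sup>2 + 2 * (?c x)\<^sup>2"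
        proof (rule AE_I2)
          fix x
          show "(conv (?s n) (K n) x - soft_sgn (w x))\<^sup>2 \<le> 2 * (conv ?d (K n) x)\<^sup>2 + 2 * (?c x)\<^sup>2"
            using two_squares[of "conv ?d (K n) x" "?c x"] by (simp add: eq)
        qed
      qed (use i in auto)
      also have "\<dots> = 2 * (LINT x|\<T>. (conv ?d (K n) x)\<^sup>2) + 2 * (LINT x|\<T>. (?c x)\<^sup>2)"
        using i by simp
      also have "(LINT x|\<T>. (conv ?d (K n) x)\<^sup>2) \<le> (LINT x|\<T>. (?d x)\<^sup>2)"
        by (rule kc(2)[OF sqd])
      finally show "(LINT x|\<T>. (conv (?s n) (K n) x - soft_sgn (w x))\<^sup>2)
        \<le> 2 * (LINT x|\<T>. (?d x)\<^sup>2) + 2 * (LINT x|\<T>. (?c x)\<^sup>2)"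
        by simp
    qed
  qed auto
  have cb: "\<bar>conv (?s n) (K n) x\<bar> \<le> 1" for n x
    by (intro conv_bounded sm soft_sgn_bounded mollifier_props)
  have cm': "conv (?s n) (K n) \<in> borel_measurable \<T>" for n
    by (rule sq_integrable_measurable[OF kc(1)[OF ssq(2)]])
  have part1: "(\<lambda>n. LINT x|\<T>. (conv (?s n) (K n) x - soft_sgn (w x)) * ?S x) \<longlonglongrightarrow> 0"
  proof (rule torus.integral_tendsto_L2_bounded[OF _ _ L2 integrable_bG])
    show "(\<lambda>x. conv (?s n) (K n) x - soft_sgn (w x)) \<in> borel_measurable \<T>" for n
      by (intro borel_measurable_diff cm' sm)
    show "\<bar>conv (?s n) (K n) x - soft_sgn (w x)\<bar> \<le> 2" for n x
      using cb[of n x] soft_sgn_bounded[of "w x"] by linarith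
  qed
  have part2: "(LINT x|\<T>. soft_sgn (w x) * ?S x) = 0"
  proof -
    have lim: "(\<lambda>n. LINT x|\<T>. b i x * (?s n x * conv (G i) (K n) x))
        \<longlonglongrightarrow> (LINT x|\<T>. soft_sgn (w x) * (b i x * G i x))" for i
    proof -
      have sqb: "sq_integrable \<T> (\<lambda>x. b i x * ?s n x)" for n
        by (intro sq_integrable_mult_bounded[where B = 1] b sm soft_sgn_bounded)
      have le: "(LINT x|\<T>. (b i x * ?s n x)\<^sup>2) \<le> (LINT x|\<T>. (b i x)\<^sup>2)" for n
      proof (rule integral_mono_AE')
        show "AE x in \<T>. (b i x * ?s n x)\<^sup>2 \<le> (b i x)\<^sup>2"
        proof (rule AE_I2)
          fix x
          have "\<bar>b i x\<bar> * \<bar>?s n x\<bar> \<le> \<bar>b i x\<bar> * 1"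
            by (intro mult_left_mono soft_sgn_bounded) simp
          then show "(b i x * ?s n x)\<^sup>2 \<le> (b i x)\<^sup>2"
            by (simp only: abs_le_square_iff[symmetric] abs_mult mult_1_right)
        qed
      qed (use b in \<open>auto simp: sq_integrable_def\<close>)
      have sqG: "sq_integrable \<T> (\<lambda>x. conv (G i) (K n) x - G i x)" for n
        by (intro sq_integrable_diff kc G)
      \<comment> \<open>Convergence of the gradients, against a bounded sequence in \<open>L\<^sup>2\<close>; then of \<open>\<beta>'(W)\<close>, against a fixed integrable function.\<close>
      have A: "(\<lambda>n. LINT x|\<T>. (conv (G i) (K n) x - G i x) * (b i x * ?s n x)) \<longlonglongrightarrow> 0"
        by (rule integral_mult_tendsto_L2[OF sqG conv_L2_tendsto[OF K G] sqb le])
      have B: "(\<lambda>n. LINT x|\<T>. (?s n x - soft_sgn (w x)) * (b i x * G i x)) \<longlonglongrightarrow> 0"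
        by (rule torus.integral_tendsto_L2_bounded[OF _ sdb soft_sgn_mollified_L2 sq_integrable_mult[OF b G]])
          (intro borel_measurable_diff sm)
      have i1: "integrable \<T> (\<lambda>x. (?s n x - soft_sgn (w x)) * (b i x * G i x))" for n
        using integrable_mult_bounded[OF sq_integrable_mult[OF b G] borel_measurable_diff[OF sm(2) sm(1)] sdb]
        by (simp add: mult.commute)
      have i2: "integrable \<T> (\<lambda>x. soft_sgn (w x) * (b i x * G i x))"
        using integrable_mult_bounded[OF sq_integrable_mult[OF b G] sm(1) soft_sgn_bounded]
        by (simp add: mult.commute)
      have "(LINT x|\<T>. b i x * (?s n x * conv (G i) (K n) x))
        = (LINT x|\<T>. (conv (G i) (K n) x - G i x) * (b i x * ?s n x))
          + (LINT x|\<T>. (?s n x - soft_sgn (w x)) * (b i x * G i x))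
          + (LINT x|\<T>. soft_sgn (w x) * (b i x * G i x))" for n
      proof -
        have "(LINT x|\<T>. b i x * (?s n x * conv (G i) (K n) x))
          = (LINT x|\<T>. (conv (G i) (K n) x - G i x) * (b i x * ?s n x)
             + (?s n x - soft_sgn (w x)) * (b i x * G i x) + soft_sgn (w x) * (b i x * G i x))"
          by (intro Bochner_Integration.integral_cong) (auto simp: algebra_simps)
        then show ?thesis
          using sq_integrable_mult[OF sqG sqb] i1 i2 by simp
      qed
      then show ?thesis
        using tendsto_add[OF tendsto_add[OF A B] tendsto_const[of "LINT x|\<T>. soft_sgn (w x) * (b i x * G i x)"]]
        by simp
    qed
    have "(\<Sum>i\<in>UNIV. LINT x|\<T>. b i x * (?s n x * conv (G i) (K n) x)) = 0" for n
      by (rule divergence_free_C1[OF K b div C1_periodic_compose[OF C1_mollified soft_abs_DERIV continuous_soft_sgn]])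
    moreover have "(\<lambda>n. \<Sum>i\<in>UNIV. LINT x|\<T>. b i x * (?s n x * conv (G i) (K n) x))
        \<longlonglongrightarrow> (\<Sum>i\<in>UNIV. LINT x|\<T>. soft_sgn (w x) * (b i x * G i x))"
      by (intro tendsto_sum lim)
    ultimately have "(\<Sum>i\<in>UNIV. LINT x|\<T>. soft_sgn (w x) * (b i x * G i x)) = 0"
      by (simp add: LIMSEQ_const_iff)
    moreover have "integrable \<T> (\<lambda>x. soft_sgn (w x) * (b i x * G i x))" for i
      using integrable_mult_bounded[OF sq_integrable_mult[OF b G] sm(1) soft_sgn_bounded]
      by (simp add: mult.commute)
    ultimately show ?thesis by (simp add: sum_distrib_left)
  qed
  have "(LINT x|\<T>. ?S x * conv (?s n) (K n) x)
      = (LINT x|\<T>. (conv (?s n) (K n) x - soft_sgn (w x)) * ?S x)" for n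
  proof -
    have "integrable \<T> (\<lambda>x. conv (?s n) (K n) x * ?S x)" "integrable \<T> (\<lambda>x. soft_sgn (w x) * ?S x)"
      using integrable_mult_bounded[OF integrable_bG cm' cb] integrable_mult_bounded[OF integrable_bG sm(1) soft_sgn_bounded]
      by (simp_all add: mult.commute)
    then have "(LINT x|\<T>. conv (?s n) (K n) x * ?S x - soft_sgn (w x) * ?S x)
        = (LINT x|\<T>. conv (?s n) (K n) x * ?S x) - (LINT x|\<T>. soft_sgn (w x) * ?S x)"
      by (rule Bochner_Integration.integral_diff)
    then show ?thesis
      by (simp only: part2 left_diff_distrib diff_0_right mult.commute[of "?S _"])
  qed
  with part1 show ?thesis by simp
qed

text \<open>
  The majorant does not depend on \<open>n\<close>, and its integral over time is finite; this is the
  domination for the passage to the limit under the time integral.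
\<close>

lemma commutator_bounded:
  "\<bar>LINT x|\<T>. (\<Sum>i\<in>UNIV. b i x * G i x) * conv (\<lambda>y. soft_sgn (conv w (K n) y)) (K n) x\<bar>
   \<le> (LINT x|\<T>. (\<Sum>i\<in>UNIV. (b i x)\<^sup>2 + (G i x)\<^sup>2))"
proof -
  let ?S = "\<lambda>x. \<Sum>i\<in>UNIV. b i x * G i x" and ?c = "conv (\<lambda>y. soft_sgn (conv w (K n) y)) (K n)"
  have cb: "\<bar>?c x\<bar> \<le> 1" for x
    by (intro conv_bounded soft_sgn_measurable mollified_measurable soft_sgn_bounded mollifier_props)
  have "\<bar>LINT x|\<T>. ?S x * ?c x\<bar> \<le> (LINT x|\<T>. \<bar>?S x * ?c x\<bar>)"
    by (rule integral_abs_bound)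
  also have "\<dots> \<le> (LINT x|\<T>. (\<Sum>i\<in>UNIV. (b i x)\<^sup>2 + (G i x)\<^sup>2))"
  proof (rule integral_mono_AE')
    show "integrable \<T> (\<lambda>x. \<Sum>i\<in>UNIV. (b i x)\<^sup>2 + (G i x)\<^sup>2)"
      using b G by (intro Bochner_Integration.integrable_sum Bochner_Integration.integrable_add) (auto simp: sq_integrable_def)
    show "AE x in \<T>. \<bar>?S x * ?c x\<bar> \<le> (\<Sum>i\<in>UNIV. (b i x)\<^sup>2 + (G i x)\<^sup>2)"
    proof (rule AE_I2)
      fix x
      have "\<bar>?S x * ?c x\<bar> \<le> \<bar>?S x\<bar> * 1"
        unfolding abs_mult by (intro mult_left_mono cb) simp
      also have "\<dots> \<le> (\<Sum>i\<in>UNIV. \<bar>b i x * G i x\<bar>)" by (simp add: sum_abs)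
      also have "\<dots> \<le> (\<Sum>i\<in>UNIV. (b i x)\<^sup>2 + (G i x)\<^sup>2)" by (intro sum_mono abs_mult_le_squares)
      finally show "\<bar>?S x * ?c x\<bar> \<le> (\<Sum>i\<in>UNIV. (b i x)\<^sup>2 + (G i x)\<^sup>2)" .
    qed
  qed (auto intro!: AE_I2 sum_nonneg)
  finally show ?thesis .
qed

lemma soft_abs_mollified_tendsto:
  "(\<lambda>n. LINT x|\<T>. soft_abs (conv w (K n) x)) \<longlonglongrightarrow> (LINT x|\<T>. soft_abs (w x))"
proof -
  have wm: "w \<in> borel_measurable \<T>" by (rule sq_integrable_measurable[OF w])
  have sd: "sq_integrable \<T> (\<lambda>x. \<bar>conv w (K n) x - w x\<bar>)" for n
    using sq_integrable_diff[OF conv_contraction(1)[OF w mollifier_props(1)[of n]] w]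
    unfolding sq_integrable_def power2_abs by (intro conjI borel_measurable_abs) auto
  have one: "sq_integrable \<T> (\<lambda>x :: real ^ 'n. 1)"
    by (intro torus.sq_integrable_bounded[where B = 1]) auto
  have lim: "(\<lambda>n. LINT x|\<T>. \<bar>conv w (K n) x - w x\<bar> * 1) \<longlonglongrightarrow> 0"
    by (rule integral_mult_tendsto_L2[OF sd _ one order_refl]) (use conv_L2_tendsto[OF K w] in simp)
  have ic: "integrable \<T> (\<lambda>x. soft_abs (conv w (K n) x))" "integrable \<T> (\<lambda>x. soft_abs (w x))" for n
    by (intro soft_abs_integrable torus.sq_integrable_imp_integrable conv_contraction w mollifier_props)+
  have "\<bar>(LINT x|\<T>. soft_abs (conv w (K n) x)) - (LINT x|\<T>. soft_abs (w x))\<bar>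
      \<le> (LINT x|\<T>. \<bar>conv w (K n) x - w x\<bar> * 1)" for n
  proof -
    have "(LINT x|\<T>. soft_abs (conv w (K n) x)) - (LINT x|\<T>. soft_abs (w x))
        = (LINT x|\<T>. soft_abs (conv w (K n) x) - soft_abs (w x))"
      using ic by simp
    also have "\<bar>\<dots>\<bar> \<le> (LINT x|\<T>. \<bar>soft_abs (conv w (K n) x) - soft_abs (w x)\<bar>)"
      by (rule integral_abs_bound)
    also have "\<dots> \<le> (LINT x|\<T>. \<bar>conv w (K n) x - w x\<bar> * 1)"
      using torus.sq_integrable_imp_integrable[OF sd]
      by (intro integral_mono_AE') (auto intro!: AE_I2 soft_abs_lipschitz)
    finally show ?thesis .
  qed
  then have "\<forall>\<^sub>F n in sequentially. norm ((LINT x|\<T>. soft_abs (conv w (K n) x)) - (LINT x|\<T>. soft_abs (w x)))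
      \<le> (LINT x|\<T>. \<bar>conv w (K n) x - w x\<bar> * 1)"
    by (intro always_eventually allI) (simp only: real_norm_def)
  from Lim_null_comparison[OF this lim] show ?thesis
    by (rule LIM_zero_cancel)
qed

end

section \<open>Integration in time\<close>

abbreviation \<I> :: "real \<Rightarrow> real measure" where
  "\<I> T \<equiv> lebesgue_on {0..T}"

lemma finite_measure_interval: "finite_measure (\<I> T)"
  by (rule finite_measure_lebesgue_on) simp

lemma interval_borel_measurable:
  "f \<in> borel_measurable borel \<Longrightarrow> f \<in> borel_measurable (\<I> T)"
  by (intro measurable_restrict_space1) (simp add: measurable_completion)

lemma flat_1_bounds: "0 \<le> flat 1 s" "flat 1 s \<le> 1"
  by (auto simp: flat_def)

lemma flat_11_bounds: "0 \<le> flat [:1, 1:] s" "flat [:1, 1:] s \<le> 1"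
proof -
  have "(1 + u) * exp (- u) \<le> 1" for u :: real
    using exp_ge_add_one_self[of u] by (simp add: exp_minus divide_inverse[symmetric] divide_le_eq)
  from this[of "1 / s"] show "flat [:1, 1:] s \<le> 1" by (simp add: flat_def)
qed (auto simp: flat_def)

lemma flat_scaled_tendsto:
  "(\<lambda>n. flat p (real n * a)) \<longlonglongrightarrow> (if a > 0 then poly p 0 else 0)"
proof (cases "a > 0")
  case True
  have "(\<lambda>n. 1 / real n * (1 / a)) \<longlonglongrightarrow> 0 * (1 / a)"
    by (intro tendsto_mult lim_inverse_n' tendsto_const)
  then have u: "(\<lambda>n. 1 / (real n * a)) \<longlonglongrightarrow> 0" by simp
  have "(\<lambda>n. poly p (1 / (real n * a)) * exp (- (1 / (real n * a)))) \<longlonglongrightarrow> poly p 0 * exp (- 0)"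
    by (intro tendsto_mult tendsto_exp tendsto_minus u tendsto_compose[OF poly_isCont[unfolded isCont_def] u, simplified] isCont_tendsto_compose[OF poly_isCont u])
  moreover have "\<forall>\<^sub>F n in sequentially. poly p (1 / (real n * a)) * exp (- (1 / (real n * a))) = flat p (real n * a)"
    using eventually_gt_at_top[of 0] by eventually_elim (use True in \<open>simp add: flat_def\<close>)
  ultimately show ?thesis using True by (simp add: Lim_transform_eventually)
next
  case False
  then have "real n * a \<le> 0" for n by (simp add: mult_nonneg_nonpos)
  then have "flat p (real n * a) = 0" for n unfolding flat_def by (simp only: not_less[symmetric] if_False)
  then show ?thesis using False by simp
qed

lemma integral_indicator_interval:
  fixes h :: "real \<Rightarrow> real"
  assumes h: "integrable (\<I> T) h" and ab: "0 \<le> a" "b \<le> T"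
    and A: "A \<in> sets borel" "\<And>t. t \<in> {0..T} \<Longrightarrow> t \<noteq> a \<Longrightarrow> t \<noteq> b \<Longrightarrow> t \<in> A \<longleftrightarrow> t \<in> {a..b}"
  shows "(LINT t|\<I> T. indicator A t * h t) = integral {a..b} h"
proof -
  have "integrable (\<I> T) (\<lambda>t. h t * indicator A t)"
    by (rule integrable_mult_bounded[where B = 1, OF h]) (use A in \<open>auto intro: interval_borel_measurable simp: indicator_def\<close>)
  then have "(LINT t|\<I> T. indicator A t * h t) = integral {0..T} (\<lambda>t. indicator A t * h t)"
    by (intro lebesgue_integral_eq_integral) (simp_all add: mult.commute)
  also have "\<dots> = integral {0..T} (\<lambda>t. if t \<in> {a..b} then h t else 0)"
    by (rule integral_spike[where S = "{a, b}"]) (use A(2) in \<open>auto simp: indicator_def\<close>)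
  also have "\<dots> = integral {a..b} h"
    unfolding integral_restrict_Int using ab by (simp add: Int_absorb1)
  finally show ?thesis .
qed

lemma interval_integrable_HK:
  fixes h :: "real \<Rightarrow> real"
  assumes "integrable (\<I> T) h"
  shows "h integrable_on {0..T}"
  using has_integral_integral_lebesgue_on[OF assms] by auto

text \<open>
  Lebesgue's differentiation theorem: almost everywhere, \<open>h\<close> is the limit of its averages over small
  intervals.
\<close>

lemma AE_zero_from_intervals:
  fixes h :: "real \<Rightarrow> real"
  assumes h: "integrable (\<I> T) h"
    and zero: "\<And>a b. 0 < a \<Longrightarrow> a < b \<Longrightarrow> b < T \<Longrightarrow> integral {a..b} h = 0"
  shows "AE t in \<I> T. h t = 0"
proof -
  define f where "f t = (if t \<in> {0..T} then h t else 0)" for t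
  have "(\<lambda>t. if t \<in> {0..T} then h t else 0) integrable_on UNIV"
    using interval_integrable_HK[OF h] by (simp only: integrable_restrict_UNIV)
  then have "f integrable_on UNIV" by (simp only: f_def[abs_def])
  then have "f integrable_on cbox a b" for a b
    by (rule integrable_on_subcbox) simp
  from integrable_ccontinuous_explicit[of f, OF this] obtain N where N: "negligible N"
    "\<And>x e. x \<notin> N \<Longrightarrow> 0 < e \<Longrightarrow> \<exists>d>0. \<forall>h. 0 < h \<and> h < d \<longrightarrow>
        norm (integral (cbox x (x + h *\<^sub>R One)) f /\<^sub>R h ^ DIM(real) - f x) < e" by blast
  have key: "h x = 0" if x: "x \<in> {0..T}" "x \<noteq> 0" "x \<noteq> T" "x \<notin> N" for x
  proof (rule ccontr)
    assume "h x \<noteq> 0"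
    then have e: "\<bar>h x\<bar> > 0" by simp
    obtain d where d: "d > 0" "\<And>r. 0 < r \<Longrightarrow> r < d \<Longrightarrow> \<bar>integral {x..x + r} f / r - f x\<bar> < \<bar>h x\<bar>"
      using N(2)[OF x(4) e] by (auto simp: divide_inverse mult.commute)
    \<comment> \<open>A step that is short enough for the differentiation theorem and stays inside the interval.\<close>
    define r where "r = min (d / 2) ((T - x) / 2)"
    have r: "0 < r" "r < d" "x + r < T" using d x by (auto simp: r_def min_def field_simps)
    have "integral {x..x + r} f = integral {x..x + r} h"
      by (rule integral_cong) (use r x in \<open>auto simp: f_def\<close>)
    also have "\<dots> = 0" by (rule zero) (use r x in auto)
    finally show False using d(2)[OF r(1,2)] x by (simp add: f_def)
  qed
  have "AE t in lebesgue. t \<notin> N \<union> {0, T}"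
    using N(1) by (intro AE_not_in) (simp add: negligible_iff_null_sets[symmetric])
  then have "AE t in lebesgue. t \<in> {0..T} \<longrightarrow> h t = 0"
    by (rule eventually_mono) (use key in auto)
  then show ?thesis
    by (subst AE_restrict_space_iff) auto
qed

lemma AE_zero_from_initial_intervals:
  fixes h :: "real \<Rightarrow> real"
  assumes h: "integrable (\<I> T) h"
    and zero: "\<And>c. 0 < c \<Longrightarrow> c < T \<Longrightarrow> (LINT t|\<I> T. indicator {..<c} t * h t) = 0"
  shows "AE t in \<I> T. h t = 0"
proof (rule AE_zero_from_intervals[OF h])
  fix a b :: real assume ab: "0 < a" "a < b" "b < T"
  have z: "integral {0..c} h = 0" if "0 < c" "c < T" for c
  proof -
    have "(LINT t|\<I> T. indicator {..<c} t * h t) = integral {0..c} h"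
      by (rule integral_indicator_interval[OF h]) (use that in auto)
    then show ?thesis using zero[OF that] by simp
  qed
  have "h integrable_on {0..b}"
    by (rule integrable_subinterval_real[OF interval_integrable_HK[OF h]]) (use ab in auto)
  then have "integral {0..a} h + integral {a..b} h = integral {0..b} h"
    by (intro Henstock_Kurzweil_Integration.integral_combine) (use ab in auto)
  then show "integral {a..b} h = 0" using z[of a] z[of b] ab by simp
qed

text \<open>
  The products of flat functions are smooth, vanish outside \<open>{a..b}\<close> and increase to the indicator
  of the open interval.
\<close>

lemma AE_zero_from_bumps:
  fixes h :: "real \<Rightarrow> real"
  assumes h: "integrable (\<I> T) h"
    and zero: "\<And>n a b. 0 < a \<Longrightarrow> a < b \<Longrightarrow> b < T \<Longrightarrow>
      (LINT t|\<I> T. flat 1 (real n * (t - a)) * flat 1 (real n * (b - t)) * h t) = 0"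
  shows "AE t in \<I> T. h t = 0"
proof (rule AE_zero_from_intervals[OF h])
  fix a b :: real assume ab: "0 < a" "a < b" "b < T"
  have fm: "(\<lambda>t. flat p (r * t + s)) \<in> borel_measurable (\<I> T)" for p r s
    by (intro interval_borel_measurable borel_measurable_continuous_onI
        continuous_on_compose2[OF smooth_continuous[OF smooth_flat]] continuous_intros) auto
  have m1: "(\<lambda>t. flat 1 (real n * (t - a)) * flat 1 (real n * (b - t))) \<in> borel_measurable (\<I> T)" for n
    using borel_measurable_times[OF fm[of 1 "real n" "- (real n * a)"] fm[of 1 "- real n" "real n * b"]]
    by (simp add: right_diff_distrib)
  have "(\<lambda>n. LINT t|\<I> T. flat 1 (real n * (t - a)) * flat 1 (real n * (b - t)) * h t)
      \<longlonglongrightarrow> (LINT t|\<I> T. indicator {a<..<b} t * h t)"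
  proof (rule integral_dominated_convergence[where w = "\<lambda>t. \<bar>h t\<bar>"])
    show "AE t in \<I> T. (\<lambda>n. flat 1 (real n * (t - a)) * flat 1 (real n * (b - t)) * h t)
        \<longlonglongrightarrow> indicator {a<..<b} t * h t"
    proof (rule AE_I2)
      fix t
      have "(\<lambda>n. flat 1 (real n * (t - a)) * flat 1 (real n * (b - t)) * h t)
        \<longlonglongrightarrow> (if t - a > 0 then poly 1 0 else 0) * (if b - t > 0 then poly 1 0 else 0) * h t"
        by (intro tendsto_mult flat_scaled_tendsto tendsto_const)
      then show "(\<lambda>n. flat 1 (real n * (t - a)) * flat 1 (real n * (b - t)) * h t)
        \<longlonglongrightarrow> indicator {a<..<b} t * h t"
        by (simp add: indicator_def split: if_splits)
    qed
    show "AE t in \<I> T. norm (flat 1 (real n * (t - a)) * flat 1 (real n * (b - t)) * h t) \<le> \<bar>h t\<bar>" for n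
      by (intro AE_I2) (simp add: abs_mult flat_1_bounds mult_le_one mult_left_le_one_le)
    show "(\<lambda>t. flat 1 (real n * (t - a)) * flat 1 (real n * (b - t)) * h t) \<in> borel_measurable (\<I> T)" for n
      by (intro borel_measurable_times[OF m1] borel_measurable_integrable[OF h])
    show "(\<lambda>t. indicator {a<..<b} t * h t) \<in> borel_measurable (\<I> T)"
      by (intro borel_measurable_times[OF interval_borel_measurable] borel_measurable_integrable[OF h]) simp
  qed (use h in auto)
  then have "(LINT t|\<I> T. indicator {a<..<b} t * h t) = 0"
    using zero[OF ab] by (simp add: LIMSEQ_const_iff)
  also have "(LINT t|\<I> T. indicator {a<..<b} t * h t) = integral {a..b} h"
    by (rule integral_indicator_interval[OF h]) (use ab in auto)
  finally show "integral {a..b} h = 0" .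
qed

definition primitive :: "real \<Rightarrow> (real \<Rightarrow> real) \<Rightarrow> real \<Rightarrow> real" where
  "primitive T F t = (LINT s|\<I> T. indicator {..t} s * F s)"

lemma indicator_mult_integrable:
  fixes F :: "real \<Rightarrow> real"
  assumes "integrable (\<I> T) F" "A \<in> sets borel"
  shows "integrable (\<I> T) (\<lambda>s. indicator A s * F s)"
proof -
  have "integrable (\<I> T) (\<lambda>s. F s * indicator A s)"
    by (rule integrable_mult_bounded[where B = 1, OF assms(1)])
      (use assms in \<open>auto intro: interval_borel_measurable simp: indicator_def\<close>)
  then show ?thesis by (simp add: mult.commute)
qed

lemma AE_interval_neq: "AE s in \<I> T. s \<noteq> a"
proof -
  have "AE s in lebesgue. s \<notin> {a}"
    by (intro AE_not_in) (simp add: negligible_iff_null_sets[symmetric])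
  then show ?thesis by (subst AE_restrict_space_iff) (auto elim: eventually_mono)
qed

lemma continuous_primitive:
  assumes F: "integrable (\<I> T) F"
  shows "continuous_on UNIV (primitive T F)"
  unfolding continuous_on_sequentially comp_def
proof (intro ballI allI impI)
  fix x :: "nat \<Rightarrow> real" and a assume x: "(\<forall>n. x n \<in> UNIV) \<and> x \<longlonglongrightarrow> a"
  show "(\<lambda>n. primitive T F (x n)) \<longlonglongrightarrow> primitive T F a"
    unfolding primitive_def
  proof (rule integral_dominated_convergence[where w = "\<lambda>s. \<bar>F s\<bar>"])
    show "AE s in \<I> T. (\<lambda>n. indicator {..x n} s * F s) \<longlonglongrightarrow> indicator {..a} s * F s"
      using AE_interval_neq[of a T]
    proof eventually_elim
      case (elim s)
      have "\<forall>\<^sub>F n in sequentially. indicator {..x n} s = (indicator {..a} s :: real)"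
      proof (cases "s < a")
        case True
        then have "\<forall>\<^sub>F n in sequentially. s < x n" using x by (auto intro: order_tendstoD)
        then show ?thesis using True by (auto elim!: eventually_mono simp: indicator_def)
      next
        case False
        then have "\<forall>\<^sub>F n in sequentially. x n < s" using x elim by (auto intro: order_tendstoD)
        then show ?thesis using False elim by (auto elim!: eventually_mono simp: indicator_def)
      qed
      then have "(\<lambda>n. indicator {..x n} s :: real) \<longlonglongrightarrow> indicator {..a} s" by (rule tendsto_eventually)
      then show ?case by (intro tendsto_mult tendsto_const)
    qed
    show "AE s in \<I> T. norm (indicator {..x n} s * F s) \<le> \<bar>F s\<bar>" for n
      by (intro AE_I2) (simp add: indicator_def)
  qed (use F in \<open>auto intro!: borel_measurable_integrable indicator_mult_integrable\<close>)
qed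

lemma primitive_bounded:
  assumes F: "integrable (\<I> T) F"
  shows "\<bar>primitive T F t\<bar> \<le> (LINT s|\<I> T. \<bar>F s\<bar>)"
proof -
  have "\<bar>primitive T F t\<bar> \<le> (LINT s|\<I> T. \<bar>indicator {..t} s * F s\<bar>)"
    unfolding primitive_def by (rule integral_abs_bound)
  also have "\<dots> \<le> (LINT s|\<I> T. \<bar>F s\<bar>)"
    using F by (intro integral_mono indicator_mult_integrable integrable_abs) (auto simp: indicator_def)
  finally show ?thesis .
qed

text \<open>
  A smooth approximation, as \<open>r\<close> grows, of the positive part of \<open>c - t\<close>. The derivative is again explicit
  and approximates minus the indicator of \<open>{..<c}\<close>.
\<close>

definition cutoff :: "real \<Rightarrow> real \<Rightarrow> real \<Rightarrow> real" where
  "cutoff r c t = (c - t) * flat 1 (r * (c - t))"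

lemma cutoff_DERIV: "(cutoff r c has_real_derivative - flat [:1, 1:] (r * (c - t))) (at t)"
proof -
  have "((\<lambda>t. flat 1 (r * (c - t))) has_real_derivative flat ([:0, 0, 1:] * (1 - pderiv 1)) (r * (c - t)) * (- r)) (at t)"
    by (rule DERIV_chain2[OF flat_DERIV]) (auto intro!: derivative_eq_intros)
  moreover have "((\<lambda>t. c - t) has_real_derivative - 1) (at t)" by (auto intro!: derivative_eq_intros)
  ultimately have "((\<lambda>t. (c - t) * flat 1 (r * (c - t))) has_real_derivative
      - 1 * flat 1 (r * (c - t)) + flat ([:0, 0, 1:] * (1 - pderiv 1)) (r * (c - t)) * (- r) * (c - t)) (at t)"
    by (rule DERIV_mult[rotated])
  also have "- 1 * flat 1 (r * (c - t)) + flat ([:0, 0, 1:] * (1 - pderiv 1)) (r * (c - t)) * (- r) * (c - t)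
      = - flat [:1, 1:] (r * (c - t))"
  proof -
    have 1: "flat ([:0, 0, 1:] * (1 - pderiv 1)) s * s = flat [:0, 1:] s" for s
      by (simp add: flat_def)
    have 2: "flat [:1, 1:] s = flat 1 s + flat [:0, 1:] s" for s
      by (simp add: flat_def distrib_right)
    have 3: "flat q (r * (c - t)) * (- r) * (c - t) = - (flat q (r * (c - t)) * (r * (c - t)))" for q
      by simp
    show ?thesis unfolding 3 1 2 by simp
  qed
  finally show ?thesis by (simp add: cutoff_def[abs_def])
qed

lemma smooth_cutoff: "smooth (cutoff r c)"
proof -
  have 1: "smooth (\<lambda>t. flat 1 (- r * t + r * c))"
    by (rule smooth_affine[OF bounded_linear_mult_right smooth_flat])
  have 2: "smooth (\<lambda>t :: real. (- t) + c)"
    by (rule smooth_affine[OF bounded_linear_minus[OF bounded_linear_ident], where f = "\<lambda>x. x"])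
      (simp add: smooth_def Ck_linear)
  have "cutoff r c = (\<lambda>t. ((- t) + c) * flat 1 (- r * t + r * c))"
    by (auto simp: cutoff_def algebra_simps)
  then show ?thesis using smooth_mult[OF 2 1] by simp
qed

lemma cutoff_eq_0: "0 \<le> r \<Longrightarrow> c \<le> t \<Longrightarrow> cutoff r c t = 0"
  using mult_nonneg_nonpos[of r "c - t"] by (auto simp: cutoff_def flat_def)

lemma integral_indicator_diff:
  assumes "0 \<le> s" "c \<le> (T :: real)"
  shows "(LINT t|\<I> T. indicator {s..<c} t) = max 0 (c - s)"
proof -
  have int: "integrable (\<I> T) (\<lambda>t. 1 :: real)"
    using finite_measure.integrable_const[OF finite_measure_interval] .
  show ?thesis
  proof (cases "s \<le> c")
    case True
    have "(LINT t|\<I> T. indicator {s..<c} t * 1) = integral {s..c} (\<lambda>t. 1 :: real)"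
      by (rule integral_indicator_interval[OF int]) (use assms in auto)
    then show ?thesis using True by simp
  qed auto
qed

text \<open>
  The hypothesis is the weak form of \<open>W' = F\<close> with \<open>W = 0\<close> at time zero. As \<open>n\<close> grows it becomes
  \<open>\<integral>\<^sub>0\<^sup>c W = \<integral>\<^sub>0\<^sup>c (c - t) F\<close>, and by Fubini's theorem the right-hand side is \<open>\<integral>\<^sub>0\<^sup>c primitive T F\<close>.
\<close>

lemma AE_eq_primitive:
  fixes W F :: "real \<Rightarrow> real"
  assumes W: "integrable (\<I> T) W" and F: "integrable (\<I> T) F"
    and eq: "\<And>n c. 0 < c \<Longrightarrow> c < T \<Longrightarrow>
      (LINT t|\<I> T. - flat [:1, 1:] (real n * (c - t)) * W t + cutoff (real n) c t * F t) = 0"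
  shows "AE t in \<I> T. W t = primitive T F t"
proof -
  let ?M = "\<I> T"
  interpret M: finite_measure ?M by (rule finite_measure_interval)
  interpret MM: pair_sigma_finite ?M ?M by standard
  have V: "integrable ?M (primitive T F)"
    by (intro M.integrable_const_bound[of _ "LINT s|?M. \<bar>F s\<bar>"])
      (auto intro!: AE_I2 primitive_bounded[OF F] interval_borel_measurable borel_measurable_continuous_onI continuous_primitive[OF F])
  have "AE t in ?M. W t - primitive T F t = 0"
  proof (rule AE_zero_from_initial_intervals[where h = "\<lambda>t. W t - primitive T F t"])
    show "integrable ?M (\<lambda>t. W t - primitive T F t)" using W V by simp
    fix c :: real assume c: "0 < c" "c < T"
    have fm: "(\<lambda>t. flat p (real n * (c - t))) \<in> borel_measurable ?M" for p n
      by (intro interval_borel_measurable borel_measurable_continuous_onI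
          continuous_on_compose2[OF smooth_continuous[OF smooth_flat]] continuous_intros) auto
    have cfm: "cutoff (real n) c \<in> borel_measurable ?M" for n
      by (intro interval_borel_measurable borel_measurable_continuous_onI smooth_continuous smooth_cutoff)
    have Wm: "W \<in> borel_measurable ?M" and Fm: "F \<in> borel_measurable ?M" using W F by auto
    have "(\<lambda>n. LINT t|?M. - flat [:1, 1:] (real n * (c - t)) * W t + cutoff (real n) c t * F t)
        \<longlonglongrightarrow> (LINT t|?M. - (indicator {..<c} t * W t) + max 0 (c - t) * F t)"
    proof (rule integral_dominated_convergence[where w = "\<lambda>t. \<bar>W t\<bar> + T * \<bar>F t\<bar>"])
      show "AE t in ?M. (\<lambda>n. - flat [:1, 1:] (real n * (c - t)) * W t + cutoff (real n) c t * F t)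
          \<longlonglongrightarrow> - (indicator {..<c} t * W t) + max 0 (c - t) * F t"
      proof (rule AE_I2)
        fix t
        have "(\<lambda>n. - flat [:1, 1:] (real n * (c - t)) * W t + (c - t) * flat 1 (real n * (c - t)) * F t)
          \<longlonglongrightarrow> - (if c - t > 0 then poly [:1, 1:] 0 else 0) * W t + (c - t) * (if c - t > 0 then poly 1 0 else 0) * F t"
          by (intro tendsto_add tendsto_mult tendsto_minus flat_scaled_tendsto tendsto_const)
        moreover have "- (if c - t > 0 then poly [:1, 1:] 0 else 0) * W t + (c - t) * (if c - t > 0 then poly 1 0 else 0) * F t
          = - (indicator {..<c} t * W t) + max 0 (c - t) * F t"
          by (simp add: indicator_def max_def)
        ultimately show "(\<lambda>n. - flat [:1, 1:] (real n * (c - t)) * W t + cutoff (real n) c t * F t)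
          \<longlonglongrightarrow> - (indicator {..<c} t * W t) + max 0 (c - t) * F t"
          by (simp only: cutoff_def)
      qed
      show "AE t in ?M. norm (- flat [:1, 1:] (real n * (c - t)) * W t + cutoff (real n) c t * F t) \<le> \<bar>W t\<bar> + T * \<bar>F t\<bar>" for n
      proof (rule AE_I2)
        fix t assume t: "t \<in> space ?M"
        have "\<bar>flat [:1, 1:] (real n * (c - t)) * W t\<bar> \<le> 1 * \<bar>W t\<bar>"
          unfolding abs_mult using flat_11_bounds by (intro mult_right_mono) auto
        moreover have "\<bar>cutoff (real n) c t\<bar> \<le> T"
        proof (cases "t \<le> c")
          case True
          have "\<bar>cutoff (real n) c t\<bar> \<le> \<bar>c - t\<bar> * 1"
            unfolding cutoff_def abs_mult using flat_1_bounds by (intro mult_left_mono) auto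
          then show ?thesis using True t c by auto
        next
          case False
          then show ?thesis using cutoff_eq_0[of "real n" c t] c by simp
        qed
        then have "\<bar>cutoff (real n) c t * F t\<bar> \<le> T * \<bar>F t\<bar>"
          unfolding abs_mult by (intro mult_right_mono) auto
        ultimately show "norm (- flat [:1, 1:] (real n * (c - t)) * W t + cutoff (real n) c t * F t) \<le> \<bar>W t\<bar> + T * \<bar>F t\<bar>"
          by simp
      qed
      show "integrable ?M (\<lambda>t. \<bar>W t\<bar> + T * \<bar>F t\<bar>)" using W F by simp
      show "(\<lambda>t. - flat [:1, 1:] (real n * (c - t)) * W t + cutoff (real n) c t * F t) \<in> borel_measurable ?M" for n
        by (intro borel_measurable_add borel_measurable_times borel_measurable_uminus fm cfm Wm Fm)
      show "(\<lambda>t. - (indicator {..<c} t * W t) + max 0 (c - t) * F t) \<in> borel_measurable ?M"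
        by (intro borel_measurable_add borel_measurable_times borel_measurable_uminus Wm Fm interval_borel_measurable) auto
    qed
    then have lim: "(LINT t|?M. - (indicator {..<c} t * W t) + max 0 (c - t) * F t) = 0"
      using eq[OF c] by (simp add: LIMSEQ_const_iff)
    have iW: "integrable ?M (\<lambda>t. indicator {..<c} t * W t)" and iV: "integrable ?M (\<lambda>t. indicator {..<c} t * primitive T F t)"
      by (intro indicator_mult_integrable W V; simp)+
    have iF: "integrable ?M (\<lambda>t. max 0 (c - t) * F t)"
    proof -
      have "integrable ?M (\<lambda>t. F t * max 0 (c - t))"
        by (rule integrable_mult_bounded[where B = T, OF F]) (use c in \<open>auto intro!: interval_borel_measurable\<close>)
      then show ?thesis by (simp add: mult.commute)
    qed
    have WF: "(LINT t|?M. indicator {..<c} t * W t) = (LINT t|?M. max 0 (c - t) * F t)"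
      using lim iW iF by simp
    have "(LINT t|?M. indicator {..<c} t * primitive T F t) = (LINT t|?M. LINT s|?M. indicator {s..<c} t * F s)"
    proof (rule Bochner_Integration.integral_cong[OF refl])
      fix t
      show "indicator {..<c} t * primitive T F t = (LINT s|?M. indicator {s..<c} t * F s)"
        unfolding primitive_def
        by (subst integral_mult_right_zero[symmetric]) (auto intro!: Bochner_Integration.integral_cong simp: indicator_def)
    qed
    also have "\<dots> = (LINT s|?M. LINT t|?M. indicator {s..<c} t * F s)"
    proof (rule MM.Fubini_integral)
      have id: "(\<lambda>x. x) \<in> borel_measurable ?M" by (intro interval_borel_measurable) simp
      have f: "(\<lambda>p. fst p) \<in> borel_measurable (?M \<Otimes>\<^sub>M ?M)" "(\<lambda>p. snd p) \<in> borel_measurable (?M \<Otimes>\<^sub>M ?M)"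
        by (rule measurable_compose[OF measurable_fst id], rule measurable_compose[OF measurable_snd id])
      have sets: "{p \<in> space (?M \<Otimes>\<^sub>M ?M). fst p \<le> snd p \<and> snd p < c} \<in> sets (?M \<Otimes>\<^sub>M ?M)"
        using f by (intro sets.sets_Collect_conj borel_measurable_le borel_measurable_less) auto
      have ind: "(\<lambda>p. indicator {fst p..<c} (snd p) :: real) \<in> borel_measurable (?M \<Otimes>\<^sub>M ?M)"
      proof -
        have "(\<lambda>p. indicator {p \<in> space (?M \<Otimes>\<^sub>M ?M). fst p \<le> snd p \<and> snd p < c} p :: real) \<in> borel_measurable (?M \<Otimes>\<^sub>M ?M)"
          by (rule borel_measurable_indicator[OF sets])
        then show ?thesis by (rule measurable_cong[THEN iffD1, rotated]) (auto simp: indicator_def)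
      qed
      have "integrable (?M \<Otimes>\<^sub>M ?M) (\<lambda>p. F (fst p) * indicator {fst p..<c} (snd p))"
      proof (rule integrable_mult_bounded[where B = 1, OF _ ind])
        show "integrable (?M \<Otimes>\<^sub>M ?M) (\<lambda>p. F (fst p))"
        proof (rule MM.Fubini_integrable)
          show "(\<lambda>p. F (fst p)) \<in> borel_measurable (?M \<Otimes>\<^sub>M ?M)" by (rule measurable_compose[OF measurable_fst Fm])
        qed (use F in auto)
      qed (auto simp: indicator_def)
      then show "integrable (?M \<Otimes>\<^sub>M ?M) (\<lambda>(s, t). indicator {s..<c} t * F s)"
        by (simp add: case_prod_unfold mult.commute)
    qed
    also have "\<dots> = (LINT s|?M. max 0 (c - s) * F s)"
    proof (rule Bochner_Integration.integral_cong[OF refl])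
      fix s assume "s \<in> space ?M"
      then show "(LINT t|?M. indicator {s..<c} t * F s) = max 0 (c - s) * F s"
        using integral_indicator_diff[of s c T] c by simp
    qed
    finally have VF: "(LINT t|?M. indicator {..<c} t * primitive T F t) = (LINT t|?M. max 0 (c - t) * F t)" .
    show "(LINT t|?M. indicator {..<c} t * (W t - primitive T F t)) = 0"
      using iW iV WF VF by (simp add: right_diff_distrib)
  qed
  then show ?thesis by simp
qed

text \<open>
  The chain rule for an absolutely continuous function, as an inequality. On a partition of \<open>{0..t}\<close> the
  convexity of \<open>\<beta>\<close> bounds each increment of \<open>\<beta>(V)\<close> by \<open>\<beta>'(V)\<close> at the right end point times the increment
  of \<open>V\<close>. The sum is the integral of \<open>F\<close> against a step function \<open>Q N\<close>, which converges to \<open>\<beta>'(V)\<close> because \<open>V\<close>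
  is continuous.
\<close>

lemma soft_abs_primitive_le:
  assumes F: "integrable (\<I> T) F" and t: "0 < t" "t \<le> T"
  shows "soft_abs (primitive T F t) \<le> (LINT s|\<I> T. indicator {..t} s * (soft_sgn (primitive T F s) * F s))"
proof -
  let ?M = "\<I> T" and ?V = "primitive T F"
  have Fm: "F \<in> borel_measurable ?M" using F by auto
  define p where "p N k = real k * t / real N" for N k
  define Q where "Q N s = (\<Sum>k<N. indicator {p N k<..p N (Suc k)} s * soft_sgn (?V (p N (Suc k))))" for N s
  \<comment> \<open>The set \<open>{..0}\<close> meets the time interval in a null set.\<close>
  have V0: "?V 0 = 0"
  proof -
    have "?V 0 = (LINT s|?M. 0)"
      unfolding primitive_def
    proof (rule integral_cong_AE)
      show "AE s in ?M. indicator {..0} s * F s = 0"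
        using AE_interval_neq[of 0 T] AE_space by eventually_elim (auto simp: indicator_def)
    qed (use F in \<open>auto intro!: borel_measurable_integrable indicator_mult_integrable\<close>)
    then show ?thesis by simp
  qed
  have incr: "?V b - ?V a = (LINT s|?M. indicator {a<..b} s * F s)" if "a \<le> b" for a b
  proof -
    have "?V b - ?V a = (LINT s|?M. indicator {..b} s * F s - indicator {..a} s * F s)"
      unfolding primitive_def by (rule Bochner_Integration.integral_diff[symmetric]) (intro indicator_mult_integrable F; simp)+
    also have "\<dots> = (LINT s|?M. indicator {a<..b} s * F s)"
      using that by (intro Bochner_Integration.integral_cong) (auto simp: indicator_def)
    finally show ?thesis .
  qed
  \<comment> \<open>Each \<open>s\<close> lies in exactly one cell, whose right end point is found by rounding \<open>s * N / t\<close> up.\<close>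
  have Qval: "Q N s = indicator {0<..t} s * soft_sgn (?V (of_int \<lceil>s * real N / t\<rceil> * t / real N))" if N: "N > 0" for N s
  proof -
    have mem: "s \<in> {p N k<..p N (Suc k)} \<longleftrightarrow> \<lceil>s * real N / t\<rceil> = int k + 1" for k
    proof -
      have "s \<in> {p N k<..p N (Suc k)} \<longleftrightarrow> real k < s * real N / t \<and> s * real N / t \<le> real k + 1"
        using t N by (simp add: p_def field_simps)
      also have "\<dots> \<longleftrightarrow> \<lceil>s * real N / t\<rceil> = int k + 1"
        by (simp add: ceiling_eq_iff)
      finally show ?thesis .
    qed
    show ?thesis
    proof (cases "s \<in> {0<..t}")
      case True
      define z where "z = nat (\<lceil>s * real N / t\<rceil> - 1)"
      have pos: "0 < s * real N / t" using True t N by simp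
      have le: "s * real N / t \<le> real N" using True t N by (simp add: field_simps)
      have c1: "1 \<le> \<lceil>s * real N / t\<rceil>" using pos by linarith
      have c2: "\<lceil>s * real N / t\<rceil> \<le> int N" using le by (simp add: ceiling_le_iff)
      have z: "int z + 1 = \<lceil>s * real N / t\<rceil>" "z < N" using c1 c2 N by (auto simp: z_def)
      have "Q N s = (\<Sum>k<N. if k = z then soft_sgn (?V (p N (Suc k))) else 0)"
        unfolding Q_def using z(1) by (intro sum.cong refl) (auto simp: indicator_def mem simp del: greaterThanAtMost_iff)
      also have "\<dots> = soft_sgn (?V (p N (Suc z)))" using z(2) by simp
      also have "p N (Suc z) = of_int \<lceil>s * real N / t\<rceil> * t / real N"
        unfolding p_def z(1)[symmetric] by simp
      finally show ?thesis using True by simp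
    next
      case False
      have "indicator {p N k<..p N (Suc k)} s = (0 :: real)" if "k < N" for k
      proof -
        have "real (Suc k) * t \<le> real N * t" using that t by (intro mult_right_mono) auto
        then have "0 \<le> p N k" "p N (Suc k) \<le> t" using that t
          by (auto simp: p_def pos_divide_le_eq mult.commute simp del: of_nat_Suc)
        then show ?thesis using False by (auto simp: indicator_def)
      qed
      then show ?thesis using False by (simp add: Q_def)
    qed
  qed
  have Qm: "Q N \<in> borel_measurable ?M" for N
    unfolding Q_def by (intro borel_measurable_sum borel_measurable_times interval_borel_measurable) auto
  have Qb: "\<bar>Q N s\<bar> \<le> 1" if "N > 0" for N s
    unfolding Qval[OF that] using soft_sgn_bounded by (auto simp: indicator_def)
  have Vm: "(\<lambda>s. soft_sgn (?V s)) \<in> borel_measurable ?M"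
    by (intro interval_borel_measurable borel_measurable_continuous_onI
        continuous_on_compose2[OF continuous_soft_sgn continuous_primitive[OF F]]) simp
  have im: "(indicator A :: real \<Rightarrow> real) \<in> borel_measurable ?M" if "A \<in> sets borel" for A
    by (intro interval_borel_measurable borel_measurable_indicator that)
  have step: "soft_abs (?V t) \<le> (LINT s|?M. Q N s * F s)" if N: "N > 0" for N
  proof -
    have "soft_abs (?V t) = soft_abs (?V (p N N)) - soft_abs (?V (p N 0))"
      using N V0 by (simp add: p_def soft_abs_def)
    also have "\<dots> = (\<Sum>k<N. soft_abs (?V (p N (Suc k))) - soft_abs (?V (p N k)))"
      by (rule sum_lessThan_telescope[symmetric])
    also have "\<dots> \<le> (\<Sum>k<N. soft_sgn (?V (p N (Suc k))) * (?V (p N (Suc k)) - ?V (p N k)))"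
      by (intro sum_mono soft_abs_convex)
    also have "\<dots> = (\<Sum>k<N. LINT s|?M. indicator {p N k<..p N (Suc k)} s * soft_sgn (?V (p N (Suc k))) * F s)"
    proof (intro sum.cong refl)
      fix k
      have "p N k \<le> p N (Suc k)" using t by (simp add: p_def divide_right_mono)
      from incr[OF this] show "soft_sgn (?V (p N (Suc k))) * (?V (p N (Suc k)) - ?V (p N k))
          = (LINT s|?M. indicator {p N k<..p N (Suc k)} s * soft_sgn (?V (p N (Suc k))) * F s)"
        by (simp add: integral_mult_right_zero[symmetric] mult_ac del: integral_mult_right_zero)
    qed
    also have "\<dots> = (LINT s|?M. (\<Sum>k<N. indicator {p N k<..p N (Suc k)} s * soft_sgn (?V (p N (Suc k))) * F s))"
    proof (rule Bochner_Integration.integral_sum[symmetric])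
      fix k
      have "integrable ?M (\<lambda>s. indicator {p N k<..p N (Suc k)} s * (soft_sgn (?V (p N (Suc k))) * F s))"
        by (intro indicator_mult_integrable integrable_mult_right F) simp
      then show "integrable ?M (\<lambda>s. indicator {p N k<..p N (Suc k)} s * soft_sgn (?V (p N (Suc k))) * F s)"
        by (simp add: mult.assoc)
    qed
    also have "\<dots> = (LINT s|?M. Q N s * F s)" by (simp only: Q_def sum_distrib_right)
    finally show ?thesis .
  qed
  have "(\<lambda>N. LINT s|?M. Q (Suc N) s * F s) \<longlonglongrightarrow> (LINT s|?M. indicator {0<..t} s * soft_sgn (?V s) * F s)"
  proof (rule integral_dominated_convergence[where w = "\<lambda>s. \<bar>F s\<bar>"])
    show "AE s in ?M. (\<lambda>N. Q (Suc N) s * F s) \<longlonglongrightarrow> indicator {0<..t} s * soft_sgn (?V s) * F s"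
    proof (rule AE_I2)
      fix s
      have "(\<lambda>N. of_int \<lceil>s * real (Suc N) / t\<rceil> * t / real (Suc N)) \<longlonglongrightarrow> s"
      proof (rule LIM_zero_cancel, rule Lim_null_comparison)
        show "\<forall>\<^sub>F N in sequentially. norm (of_int \<lceil>s * real (Suc N) / t\<rceil> * t / real (Suc N) - s) \<le> t * inverse (real (Suc N))"
        proof (intro always_eventually allI)
          fix N
          let ?c = "of_int \<lceil>s * real (Suc N) / t\<rceil> - s * real (Suc N) / t"
          have c: "0 \<le> ?c" "?c \<le> 1" by linarith+
          have eq: "of_int \<lceil>s * real (Suc N) / t\<rceil> * t / real (Suc N) - s = ?c * (t * inverse (real (Suc N)))"
            using t by (simp add: field_simps del: of_nat_Suc)
          have "norm (?c * (t * inverse (real (Suc N)))) = ?c * (t * inverse (real (Suc N)))"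
            using c t by (simp add: abs_mult del: of_nat_Suc)
          also have "\<dots> \<le> 1 * (t * inverse (real (Suc N)))" using c t by (intro mult_right_mono) auto
          finally show "norm (of_int \<lceil>s * real (Suc N) / t\<rceil> * t / real (Suc N) - s) \<le> t * inverse (real (Suc N))"
            unfolding eq by (simp only: mult_1_left)
        qed
        show "(\<lambda>N. t * inverse (real (Suc N))) \<longlonglongrightarrow> 0"
          using tendsto_mult_left[OF LIMSEQ_inverse_real_of_nat, of t] by simp
      qed
      moreover have "isCont (\<lambda>s. soft_sgn (?V s)) s"
      proof -
        have "continuous_on UNIV (\<lambda>s. soft_sgn (?V s))"
          by (rule continuous_on_compose2[OF continuous_soft_sgn continuous_primitive[OF F]]) simp
        then show ?thesis by (simp add: continuous_on_eq_continuous_at)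
      qed
      ultimately have "(\<lambda>N. soft_sgn (?V (of_int \<lceil>s * real (Suc N) / t\<rceil> * t / real (Suc N)))) \<longlonglongrightarrow> soft_sgn (?V s)"
        by (intro isCont_tendsto_compose[of s "\<lambda>s. soft_sgn (?V s)"])
      then show "(\<lambda>N. Q (Suc N) s * F s) \<longlonglongrightarrow> indicator {0<..t} s * soft_sgn (?V s) * F s"
        unfolding Qval[OF zero_less_Suc] by (intro tendsto_mult tendsto_const)
    qed
    show "AE s in ?M. norm (Q (Suc N) s * F s) \<le> \<bar>F s\<bar>" for N
      using Qb[of "Suc N"] by (intro AE_I2) (simp add: abs_mult mult_left_le_one_le)
    show "(\<lambda>s. Q (Suc N) s * F s) \<in> borel_measurable ?M" for N
      by (intro borel_measurable_times Qm Fm)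
    show "(\<lambda>s. indicator {0<..t} s * soft_sgn (?V s) * F s) \<in> borel_measurable ?M"
      by (intro borel_measurable_times Fm Vm im) auto
  qed (use F in auto)
  then have "soft_abs (?V t) \<le> (LINT s|?M. indicator {0<..t} s * soft_sgn (?V s) * F s)"
    by (rule LIMSEQ_le_const) (use step in auto)
  also have "\<dots> = (LINT s|?M. indicator {..t} s * (soft_sgn (?V s) * F s))"
  proof (rule integral_cong_AE)
    show "AE s in ?M. indicator {0<..t} s * soft_sgn (?V s) * F s = indicator {..t} s * (soft_sgn (?V s) * F s)"
      using AE_interval_neq[of 0 T] AE_space by eventually_elim (auto simp: indicator_def)
    show "(\<lambda>s. indicator {0<..t} s * soft_sgn (?V s) * F s) \<in> borel_measurable ?M"
      "(\<lambda>s. indicator {..t} s * (soft_sgn (?V s) * F s)) \<in> borel_measurable ?M"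
      by (intro borel_measurable_times Fm Vm im; simp)+
  qed
  finally show ?thesis .
qed

section \<open>Borel representatives on space-time\<close>

lemma lebesgue_on_measurable_AE:
  fixes f g :: "'a::euclidean_space \<Rightarrow> real"
  assumes S: "S \<in> sets lebesgue" and f: "f \<in> borel_measurable (lebesgue_on S)"
    and ae: "AE x in lebesgue_on S. f x = g x"
  shows "g \<in> borel_measurable (lebesgue_on S)"
proof -
  have "AE x in lebesgue. (if x \<in> S then f x else 0) = (if x \<in> S then g x else 0)"
    using ae S by (subst (asm) AE_restrict_space_iff) (auto elim!: eventually_mono)
  from borel_measurable_AE[OF _ this] f show ?thesis
    using borel_measurable_if[OF S] by blast
qed

lemma lebesgue_on_integral_AE:
  fixes f g :: "'a::euclidean_space \<Rightarrow> real"
  assumes S: "S \<in> sets lebesgue" and f: "f \<in> borel_measurable (lebesgue_on S)"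
    and ae: "AE x in lebesgue_on S. f x = g x"
  shows "(LINT x|lebesgue_on S. g x) = (LINT x|lebesgue_on S. f x)"
  using ae by (intro integral_cong_AE lebesgue_on_measurable_AE[OF S f ae] f) (auto elim: eventually_mono)

lemma torus_integral_AE:
  fixes f g :: "real ^ 'n \<Rightarrow> real"
  assumes "f \<in> borel_measurable \<T>" "AE x in \<T>. f x = g x"
  shows "(LINT x|\<T>. g x) = (LINT x|\<T>. f x)"
  using assms unfolding torus_measure_def by (intro lebesgue_on_integral_AE) auto

lemma time_integral_AE:
  fixes f g :: "real \<Rightarrow> real"
  assumes "f \<in> borel_measurable (\<I> T)" "AE x in \<I> T. f x = g x"
  shows "(LINT x|\<I> T. g x) = (LINT x|\<I> T. f x)"
  using assms by (intro lebesgue_on_integral_AE) auto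

text \<open>
  Product measure in time and space, to which Fubini's theorem applies; \<open>spacetime_measure\<close> lives on a
  larger \<open>\<sigma>\<close>-algebra.
\<close>

abbreviation slab :: "real \<Rightarrow> (real \<times> (real ^ 'n)) measure" where
  "slab T \<equiv> \<I> T \<Otimes>\<^sub>M \<T>"

interpretation time: finite_measure "\<I> T" for T
  by (rule finite_measure_interval)

interpretation slab: pair_sigma_finite "\<I> T" "\<T> :: (real ^ 'n) measure" for T
  by standard

lemma AE_slab_iff:
  fixes T :: real
  shows "(AE t in \<I> T. AE x in (\<T> :: (real ^ 'n) measure). P t x) \<longleftrightarrow>
   (AE t in lborel. AE x in lborel. (t, x) \<in> {0..T} \<times> cbox 0 1 \<longrightarrow> P t x)"
proof -
  have 1: "(AE x in (\<T> :: (real ^ 'n) measure). Q x) \<longleftrightarrow> (AE x in lborel. x \<in> cbox 0 1 \<longrightarrow> Q x)" for Q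
    unfolding torus_measure_def by (subst AE_restrict_space_iff) (auto simp: AE_completion_iff)
  have 2: "(AE t in \<I> T. Q t) \<longleftrightarrow> (AE t in lborel. t \<in> {0..T} \<longrightarrow> Q t)" for Q
    by (subst AE_restrict_space_iff) (auto simp: AE_completion_iff)
  have 3: "(t \<in> {0..T} \<longrightarrow> (AE x in lborel. x \<in> cbox 0 1 \<longrightarrow> P t x)) \<longleftrightarrow>
      (AE x in lborel. (t, x) \<in> {0..T} \<times> cbox 0 1 \<longrightarrow> P t x)" for t
    by (cases "t \<in> {0..T}") auto
  show ?thesis unfolding 1 2 3 ..
qed

lemma slab_borel_measurable:
  fixes g :: "real \<times> (real ^ 'n) \<Rightarrow> real"
  assumes "g \<in> borel_measurable borel"
  shows "g \<in> borel_measurable (slab T)"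
proof -
  have "(\<lambda>x. x) \<in> borel_measurable (\<I> T)" "(\<lambda>x. x) \<in> borel_measurable (\<T> :: (real ^ 'n) measure)"
    by (intro interval_borel_measurable torus_borel_measurable; simp)+
  then have "(\<lambda>p. (fst p, snd p)) \<in> slab T \<rightarrow>\<^sub>M (borel \<Otimes>\<^sub>M (borel :: (real ^ 'n) measure))"
    by (intro measurable_Pair measurable_compose[OF measurable_fst] measurable_compose[OF measurable_snd])
  then have "(\<lambda>p. p) \<in> slab T \<rightarrow>\<^sub>M (borel :: (real \<times> (real ^ 'n)) measure)" by (simp add: borel_prod)
  from measurable_compose[OF this assms] show ?thesis .
qed

lemma spacetime_sets: "{0..T :: real} \<times> cbox 0 (1 :: real ^ 'n) \<in> sets lebesgue"
proof -
  have "{0..T} \<times> cbox 0 (1 :: real ^ 'n) \<in> sets borel"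
    by (intro borel_closed closed_Times) auto
  then show ?thesis by (intro sets_completionI_sets) simp
qed

lemma AE_slab_of_spacetime:
  assumes "AE p in spacetime_measure T. P p"
  shows "AE t in \<I> T. AE x in (\<T> :: (real ^ 'n) measure). P (t, x)"
proof -
  have "AE p in lborel. p \<in> {0..T} \<times> cbox 0 (1 :: real ^ 'n) \<longrightarrow> P p"
    using assms spacetime_sets unfolding spacetime_measure_def
    by (subst (asm) AE_restrict_space_iff) (auto simp: AE_completion_iff)
  then have "AE p in (lborel :: real measure) \<Otimes>\<^sub>M lborel. p \<in> {0..T} \<times> cbox 0 (1 :: real ^ 'n) \<longrightarrow> P p"
    by (simp only: lborel_prod)
  from lborel_pair.AE_pair[OF this] show ?thesis
    unfolding AE_slab_iff by simp
qed

lemma AE_spacetime_of_slab: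
  fixes g :: "real \<times> (real ^ 'n) \<Rightarrow> real"
  assumes g: "g \<in> borel_measurable borel"
    and ae: "AE t in \<I> T. AE x in \<T>. g (t, x) = 0"
  shows "AE p in spacetime_measure T. g p = 0"
proof -
  let ?S = "{0..T} \<times> cbox 0 (1 :: real ^ 'n)"
  have S: "?S \<in> sets borel" by (intro borel_closed closed_Times) auto
  have "{p. p \<in> ?S \<longrightarrow> g p = 0} = (- ?S) \<union> (g -` {0} \<inter> space borel)" by auto
  also have "\<dots> \<in> sets borel" using S measurable_sets[OF g, of "{0}"] by auto
  finally have "{p \<in> space ((lborel :: real measure) \<Otimes>\<^sub>M lborel). p \<in> ?S \<longrightarrow> g p = 0} \<in> sets ((lborel :: real measure) \<Otimes>\<^sub>M lborel)"
    by (simp only: lborel_prod) simp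
  then have "AE p in (lborel :: real measure) \<Otimes>\<^sub>M lborel. p \<in> ?S \<longrightarrow> g p = 0"
    using ae by (intro lborel_pair.AE_pair_measure) (auto simp: AE_slab_iff)
  then have "AE p in lborel. p \<in> ?S \<longrightarrow> g p = 0" by (simp only: lborel_prod)
  then show ?thesis
    using spacetime_sets unfolding spacetime_measure_def
    by (subst AE_restrict_space_iff) (auto simp: AE_completion_iff)
qed

lemma borel_representative:
  fixes f :: "real \<times> (real ^ 'n) \<Rightarrow> real"
  assumes f: "f \<in> borel_measurable (spacetime_measure T)"
  obtains g where "g \<in> borel_measurable borel" "AE p in spacetime_measure T. f p = g p"
proof -
  let ?S = "{0..T} \<times> cbox 0 (1 :: real ^ 'n)"
  have "(\<lambda>p. if p \<in> ?S then f p else 0) \<in> borel_measurable lebesgue"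
    using f borel_measurable_if[OF spacetime_sets] unfolding spacetime_measure_def by blast
  from completion_ex_borel_measurable_real[OF this]
  obtain g where g: "g \<in> borel_measurable lborel" "AE p in lborel. (if p \<in> ?S then f p else 0) = g p" by blast
  have "AE p in spacetime_measure T. f p = g p"
    using g(2) spacetime_sets unfolding spacetime_measure_def
    by (subst AE_restrict_space_iff) (auto simp: AE_completion_iff elim!: eventually_mono)
  with g(1) show ?thesis by (intro that) auto
qed

text \<open>
  The map \<open>\<pi>\<close> is the identity or a coordinate of a vector.
\<close>

lemma L2_representative:
  fixes u :: "real \<Rightarrow> real ^ 'n \<Rightarrow> 'b::euclidean_space" and \<pi> :: "'b \<Rightarrow> real"
  assumes u: "in_L2_L2 T u" and \<pi>: "\<pi> \<in> borel_measurable borel" "\<And>v. \<bar>\<pi> v\<bar> \<le> norm v"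
  obtains g where "g \<in> borel_measurable borel" "sq_integrable (slab T) g"
    "AE p in spacetime_measure T. \<pi> (u (fst p) (snd p)) = g p"
    "AE t in \<I> T. AE x in \<T>. \<pi> (u t x) = g (t, x)"
proof -
  have "(\<lambda>p. u (fst p) (snd p)) \<in> borel_measurable (spacetime_measure T)"
    using u by (simp add: in_L2_L2_def spacetime_measurable_def case_prod_unfold)
  from measurable_compose[OF this \<pi>(1)]
  obtain g where g: "g \<in> borel_measurable borel" "AE p in spacetime_measure T. \<pi> (u (fst p) (snd p)) = g p"
    using borel_representative by blast
  have ae: "AE t in \<I> T. AE x in \<T>. \<pi> (u t x) = g (t, x)"
    using AE_slab_of_spacetime[OF g(2)] by simp
  have gm: "g \<in> borel_measurable (slab T)" by (rule slab_borel_measurable[OF g(1)])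
  have "(\<integral>\<^sup>+ p. ennreal ((g p)\<^sup>2) \<partial>slab T) = (\<integral>\<^sup>+ t. \<integral>\<^sup>+ x. ennreal ((g (t, x))\<^sup>2) \<partial>\<T> \<partial>\<I> T)"
    by (rule torus.nn_integral_fst[symmetric]) (intro measurable_compose[OF _ measurable_ennreal] borel_measurable_power gm)
  also have "\<dots> \<le> (\<integral>\<^sup>+ t. L2_norm_sq (u t) \<partial>\<I> T)"
  proof (rule nn_integral_mono_AE, use ae in eventually_elim)
    case (elim t)
    show ?case unfolding L2_norm_sq_def
    proof (rule nn_integral_mono_AE, use elim in eventually_elim)
      case (elim x)
      have "\<bar>\<pi> (u t x)\<bar>\<^sup>2 \<le> (norm (u t x))\<^sup>2" by (intro power_mono \<pi>) simp
      then show ?case using elim by (simp add: ennreal_leI)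
    qed
  qed
  also have "\<dots> < \<infinity>" using u by (simp add: in_L2_L2_def)
  finally have "integrable (slab T) (\<lambda>p. (g p)\<^sup>2)"
    by (intro integrableI_bounded borel_measurable_power gm) simp
  with gm have "sq_integrable (slab T) g" by (simp add: sq_integrable_def)
  with g ae show ?thesis by (intro that)
qed

lemma slab_slices:
  assumes "sq_integrable (slab T) g"
  shows "AE t in \<I> T. sq_integrable (\<T> :: (real ^ 'n) measure) (\<lambda>x. g (t, x))"
proof -
  have "integrable (slab T) (\<lambda>p. (g p)\<^sup>2)" and gm: "g \<in> borel_measurable (slab T)"
    using assms by (auto simp: sq_integrable_def)
  from slab.AE_integrable_fst'[OF this(1)] AE_space
  show ?thesis
  proof eventually_elim
    case (elim t)
    have "(\<lambda>x. g (t, x)) \<in> borel_measurable \<T>"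
      by (rule measurable_compose[OF measurable_Pair1'[OF elim(2)] gm])
    with elim show ?case by (simp add: sq_integrable_def)
  qed
qed

lemma finite_measure_slab: "finite_measure (slab T :: (real \<times> (real ^ 'n)) measure)"
  by (intro finite_measure_pair_measure finite_measure_interval torus.finite_measure_axioms)

section \<open>Mollification on space-time\<close>

lemma time_conv_integrable:
  fixes K :: "real ^ 'n \<Rightarrow> real"
  assumes g: "integrable (slab T) g" and K: "torus_periodic K" "continuous_on UNIV K"
  shows "integrable (\<I> T) (\<lambda>t. conv (\<lambda>x. g (t, x)) K y)"
proof -
  obtain B where B: "\<And>x. \<bar>K x\<bar> \<le> B" using torus_periodic_bounded[OF K] by blast
  have "integrable (slab T) (\<lambda>p. g p * K (y - snd p))"
  proof (rule integrable_mult_bounded[OF g])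
    show "(\<lambda>p. K (y - snd p)) \<in> borel_measurable (slab T)"
      by (rule measurable_compose[OF measurable_snd torus_borel_cont[OF continuous_on_shift_reflect[OF K(2)]]])
  qed (rule B)
  from slab.integrable_fst'[OF this] show ?thesis by (simp add: conv_def)
qed

lemma slab_conv_measurable:
  fixes K :: "real ^ 'n \<Rightarrow> real"
  assumes g: "g \<in> borel_measurable (slab T)" and K: "continuous_on UNIV K"
  shows "(\<lambda>p. conv (\<lambda>x. g (fst p, x)) K (snd p)) \<in> borel_measurable (slab T)"
  unfolding conv_def
proof (rule torus.borel_measurable_lebesgue_integral)
  let ?M = "slab T \<Otimes>\<^sub>M (\<T> :: (real ^ 'n) measure)"
  have id: "(\<lambda>x. x) \<in> borel_measurable (\<T> :: (real ^ 'n) measure)"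
    by (intro torus_borel_measurable) simp
  have "(\<lambda>q. (fst (fst q), snd q)) \<in> ?M \<rightarrow>\<^sub>M slab T"
    by (intro measurable_Pair measurable_compose[OF measurable_fst measurable_fst] measurable_snd)
  from measurable_compose[OF this g]
  have 1: "(\<lambda>q. g (fst (fst q), snd q)) \<in> borel_measurable ?M" .
  have "(\<lambda>q. snd (fst q) - snd q) \<in> borel_measurable ?M"
    by (intro borel_measurable_diff measurable_compose[OF measurable_snd id]
        measurable_compose[OF measurable_compose[OF measurable_fst measurable_snd] id])
  from measurable_compose[OF this borel_measurable_continuous_onI[OF K]]
  have "(\<lambda>q. K (snd (fst q) - snd q)) \<in> borel_measurable ?M" .
  from borel_measurable_times[OF 1 this]
  show "(\<lambda>(p, x). g (fst p, x) * K (snd p - x)) \<in> borel_measurable ?M"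
    by (simp only: case_prod_unfold)
qed

lemma slab_conv_integrable:
  fixes K :: "real ^ 'n \<Rightarrow> real"
  assumes g: "integrable (slab T) g" and K: "torus_periodic K" "continuous_on UNIV K"
  shows "integrable (slab T) (\<lambda>p. conv (\<lambda>x. g (fst p, x)) K (snd p))"
proof (rule slab.Fubini_integrable)
  obtain B where B: "B \<ge> 0" "\<And>x. \<bar>K x\<bar> \<le> B" using torus_periodic_bounded[OF K] by blast
  have gm: "g \<in> borel_measurable (slab T)" using g by auto
  note cm = slab_conv_measurable[OF gm K(2)]
  show "(\<lambda>p. conv (\<lambda>x. g (fst p, x)) K (snd p)) \<in> borel_measurable (slab T)" by (rule cm)
  note slice = slab.AE_integrable_fst'[OF g]
  show "AE t in \<I> T. integrable \<T> (\<lambda>y. conv (\<lambda>x. g (fst (t, y), x)) K (snd (t, y)))"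
    using slice
  proof eventually_elim
    case (elim t)
    show ?case unfolding fst_conv snd_conv by (intro torus_continuous_integrable continuous_conv elim K)
  qed
  show "integrable (\<I> T) (\<lambda>t. LINT y|\<T>. norm (conv (\<lambda>x. g (fst (t, y), x)) K (snd (t, y))))"
  proof (rule Bochner_Integration.integrable_bound)
    show "integrable (\<I> T) (\<lambda>t. B * (LINT x|\<T>. norm (g (t, x))))"
      by (intro integrable_mult_right slab.integrable_fst'[OF integrable_norm[OF g]])
    show "(\<lambda>t. LINT y|\<T>. norm (conv (\<lambda>x. g (fst (t, y), x)) K (snd (t, y)))) \<in> borel_measurable (\<I> T)"
    proof (rule torus.borel_measurable_lebesgue_integral)
      show "(\<lambda>(t, y). norm (conv (\<lambda>x. g (fst (t, y), x)) K (snd (t, y)))) \<in> borel_measurable (slab T)"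
        using measurable_compose[OF cm borel_measurable_norm] by (simp only: case_prod_unfold fst_conv snd_conv)
    qed
    show "AE t in \<I> T. norm (LINT y|\<T>. norm (conv (\<lambda>x. g (fst (t, y), x)) K (snd (t, y))))
        \<le> norm (B * (LINT x|\<T>. norm (g (t, x))))"
      using slice
    proof eventually_elim
      case (elim t)
      have "\<bar>conv (\<lambda>x. g (t, x)) K y\<bar> \<le> B * (LINT x|\<T>. \<bar>g (t, x)\<bar>)" for y
      proof -
        have "\<bar>conv (\<lambda>x. g (t, x)) K y\<bar> \<le> (LINT x|\<T>. \<bar>g (t, x) * K (y - x)\<bar>)"
          unfolding conv_def by (rule integral_abs_bound)
        also have "\<dots> \<le> (LINT x|\<T>. B * \<bar>g (t, x)\<bar>)"
        proof (rule integral_mono)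
          show "integrable \<T> (\<lambda>x. \<bar>g (t, x) * K (y - x)\<bar>)" by (intro integrable_abs conv_integrable elim K)
          show "integrable \<T> (\<lambda>x. B * \<bar>g (t, x)\<bar>)" using elim by simp
          show "\<bar>g (t, x) * K (y - x)\<bar> \<le> B * \<bar>g (t, x)\<bar>" for x
            using B(2)[of "y - x"] mult_left_mono[of "\<bar>K (y - x)\<bar>" B "\<bar>g (t, x)\<bar>"] by (simp add: abs_mult mult.commute)
        qed
        finally show ?thesis by simp
      qed
      then have "(LINT y|\<T>. \<bar>conv (\<lambda>x. g (t, x)) K y\<bar>) \<le> (LINT y|(\<T> :: (real ^ 'n) measure). B * (LINT x|\<T>. \<bar>g (t, x)\<bar>))"
        by (intro integral_mono integrable_abs torus_continuous_integrable continuous_conv elim K) auto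
      moreover have "0 \<le> (LINT x|\<T>. \<bar>g (t, x)\<bar>)" by simp
      ultimately show ?case using B by simp
    qed
  qed
qed

section \<open>Test functions of product form\<close>

lemma partial_deriv_cmult:
  assumes "smooth f"
  shows "partial_deriv i (\<lambda>x. c * f x) = (\<lambda>x. c * partial_deriv i f x)"
proof
  fix x
  have "((\<lambda>x. c * f x) has_derivative (\<lambda>h. c * frechet_derivative f (at x) h)) (at x)"
    by (intro has_derivative_mult_right smooth_has_derivative assms)
  from frechet_derivative_at[OF this]
  show "partial_deriv i (\<lambda>x. c * f x) x = c * partial_deriv i f x"
    by (metis partial_deriv_def)
qed

lemma partial_deriv_K:
  fixes K :: "real ^ 'n \<Rightarrow> real"
  assumes K: "smooth K" "torus_periodic K"
  shows "smooth (partial_deriv i K)" "torus_periodic (partial_deriv i K)" "continuous_on UNIV (partial_deriv i K)"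
  using C1_periodic_smooth[OF K] smooth_partial_deriv[OF K(1)] by (auto simp: C1_periodic_def)

lemma partial_deriv2_K:
  fixes K :: "real ^ 'n \<Rightarrow> real"
  assumes K: "smooth K" "torus_periodic K"
  shows "torus_periodic (partial_deriv i (partial_deriv i K))" "continuous_on UNIV (partial_deriv i (partial_deriv i K))"
  using C1_periodic_smooth[OF partial_deriv_K(1,2)[OF K]] by (auto simp: C1_periodic_def)

context
  fixes \<eta> :: "real \<Rightarrow> real" and K :: "real ^ 'n \<Rightarrow> real" and y :: "real ^ 'n"
  assumes \<eta>: "smooth \<eta>" and K: "smooth K" "torus_periodic K"
begin

lemma test_function_product:
  assumes "compact S" "S \<subseteq> I" "\<And>t. t \<in> I - S \<Longrightarrow> \<eta> t = 0"
  shows "test_function I (\<lambda>t x. \<eta> t * K (y - x))"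
  unfolding test_function_def
proof (intro conjI allI exI[of _ S])
  have 1: "smooth (\<lambda>p :: real \<times> (real ^ 'n). \<eta> (fst p + 0))"
    by (rule smooth_affine[OF bounded_linear_fst \<eta>])
  have 2: "smooth (\<lambda>p :: real \<times> (real ^ 'n). K (- snd p + y))"
    by (rule smooth_affine[OF bounded_linear_minus[OF bounded_linear_snd] K(1)])
  show "smooth (\<lambda>(t, x). \<eta> t * K (y - x))"
    using smooth_mult[OF 1 2] by (simp add: case_prod_unfold)
  show "torus_periodic (\<lambda>x. \<eta> t * K (y - x))" for t
    using periodic_reflect[OF K(2), of y] by (simp add: torus_periodic_def)
qed (use assms in auto)

lemma partial_deriv_product:
  "partial_deriv i (\<lambda>x. \<eta> t * K (y - x)) = (\<lambda>x. (- \<eta> t) * partial_deriv i K (y - x))"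
  unfolding partial_deriv_cmult[OF smooth_reflect[OF K(1)]] by (simp add: partial_deriv_reflect[OF K])

lemma laplacian_product:
  "laplacian (\<lambda>x. \<eta> t * K (y - x)) x = \<eta> t * (\<Sum>i\<in>UNIV. partial_deriv i (partial_deriv i K) (y - x))"
  unfolding laplacian_def partial_deriv_product
  unfolding partial_deriv_cmult[OF smooth_reflect[OF partial_deriv_K(1)[OF K]]]
  by (simp add: partial_deriv_reflect[OF partial_deriv_K(1,2)[OF K]] sum_distrib_left)

lemma inner_grad_product:
  "v \<bullet> grad (\<lambda>x. \<eta> t * K (y - x)) x = - \<eta> t * (\<Sum>i\<in>UNIV. v $ i * partial_deriv i K (y - x))"
  unfolding grad_def partial_deriv_product
  by (simp add: inner_vec_def sum_distrib_left mult_ac sum_negf)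

end

section \<open>The mollified equations\<close>

lemma divergence_free_mollified:
  fixes K :: "real ^ 'n \<Rightarrow> real" and b :: "real \<Rightarrow> real ^ 'n \<Rightarrow> real ^ 'n"
  assumes div: "divergence_free T b" and K: "smooth K" "torus_periodic K"
    and b': "\<And>i. sq_integrable (slab T) (b' i)"
    and rep: "\<And>i. AE t in \<I> T. AE x in \<T>. b t x $ i = b' i (t, x)"
  shows "AE t in \<I> T. (\<Sum>i\<in>UNIV. conv (\<lambda>x. b' i (t, x)) (partial_deriv i K) y) = 0"
proof (rule AE_zero_from_bumps)
  let ?h = "\<lambda>t. \<Sum>i\<in>UNIV. conv (\<lambda>x. b' i (t, x)) (partial_deriv i K) y"
  note pK = partial_deriv_K[OF K]
  show h: "integrable (\<I> T) ?h"
    by (intro Bochner_Integration.integrable_sum time_conv_integrable pK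
        finite_measure.sq_integrable_imp_integrable[OF finite_measure_slab] b')
  fix n :: nat and a c :: real assume ac: "0 < a" "a < c" "c < T"
  define \<eta> where "\<eta> t = flat 1 (real n * (t - a)) * flat 1 (real n * (c - t))" for t
  have \<eta>: "smooth \<eta>"
  proof -
    have "smooth (\<lambda>t. flat 1 (real n * t + (- real n * a)))" "smooth (\<lambda>t. flat 1 ((- real n) * t + real n * c))"
      by (rule smooth_affine[OF bounded_linear_mult_right smooth_flat])+
    from smooth_mult[OF this] show ?thesis
      unfolding \<eta>_def[abs_def] by (simp add: algebra_simps)
  qed
  have \<eta>0: "\<eta> t = 0" if "t \<in> {0<..<T} - {a..c}" for t
  proof -
    have "t < a \<or> c < t" using that by auto
    then show ?thesis
    proof
      assume "t < a"
      then have "real n * (t - a) \<le> 0" by (intro mult_nonneg_nonpos) auto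
      then show ?thesis by (simp add: \<eta>_def flat_def)
    next
      assume "c < t"
      then have "real n * (c - t) \<le> 0" by (intro mult_nonneg_nonpos) auto
      then show ?thesis by (simp add: \<eta>_def flat_def)
    qed
  qed
  have "test_function {0<..<T} (\<lambda>t x. \<eta> t * K (y - x))"
    by (rule test_function_product[OF \<eta> K, of "{a..c}"]) (use ac \<eta>0 in auto)
  with div have "(LINT t|\<I> T. LINT x|\<T>. b t x \<bullet> grad (\<lambda>x. \<eta> t * K (y - x)) x) = 0"
    unfolding divergence_free_def by blast
  moreover have "(LINT t|\<I> T. LINT x|\<T>. b t x \<bullet> grad (\<lambda>x. \<eta> t * K (y - x)) x)
      = (LINT t|\<I> T. - \<eta> t * ?h t)"
  proof (rule time_integral_AE)
    show "(\<lambda>t. - \<eta> t * ?h t) \<in> borel_measurable (\<I> T)"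
      by (intro borel_measurable_times borel_measurable_uminus interval_borel_measurable
          borel_measurable_continuous_onI smooth_continuous \<eta> borel_measurable_integrable[OF h])
    have "AE t in \<I> T. \<forall>i. AE x in \<T>. b t x $ i = b' i (t, x)"
      unfolding AE_all_countable using rep by blast
    moreover have "AE t in \<I> T. \<forall>i. sq_integrable \<T> (\<lambda>x. b' i (t, x))"
      unfolding AE_all_countable using slab_slices[OF b'] by blast
    ultimately show "AE t in \<I> T. - \<eta> t * ?h t = (LINT x|\<T>. b t x \<bullet> grad (\<lambda>x. \<eta> t * K (y - x)) x)"
    proof eventually_elim
      case (elim t)
      have "integrable \<T> (\<lambda>x. b' i (t, x) * partial_deriv i K (y - x))" for i
        by (intro conv_integrable torus.sq_integrable_imp_integrable elim(2)[rule_format] pK)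
      then have eq: "- \<eta> t * ?h t = (LINT x|\<T>. - \<eta> t * (\<Sum>i\<in>UNIV. b' i (t, x) * partial_deriv i K (y - x)))"
        and int: "integrable \<T> (\<lambda>x. - \<eta> t * (\<Sum>i\<in>UNIV. b' i (t, x) * partial_deriv i K (y - x)))"
        by (simp_all add: conv_def)
      have "(LINT x|\<T>. b t x \<bullet> grad (\<lambda>x. \<eta> t * K (y - x)) x)
        = (LINT x|\<T>. - \<eta> t * (\<Sum>i\<in>UNIV. b' i (t, x) * partial_deriv i K (y - x)))"
      proof (rule torus_integral_AE[OF borel_measurable_integrable[OF int]])
        have "AE x in \<T>. \<forall>i. b t x $ i = b' i (t, x)"
          unfolding AE_all_countable using elim(1) .
        then show "AE x in \<T>. - \<eta> t * (\<Sum>i\<in>UNIV. b' i (t, x) * partial_deriv i K (y - x)) = b t x \<bullet> grad (\<lambda>x. \<eta> t * K (y - x)) x"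
          by eventually_elim (simp add: inner_grad_product[OF \<eta> K])
      qed
      with eq show ?case by simp
    qed
  qed
  ultimately have "(LINT t|\<I> T. - (\<eta> t * ?h t)) = 0" by simp
  then have "(LINT t|\<I> T. \<eta> t * ?h t) = 0" by simp
  then show "(LINT t|\<I> T. flat 1 (real n * (t - a)) * flat 1 (real n * (c - t)) * ?h t) = 0"
    by (simp only: \<eta>_def)
qed

lemma mollified_flux_time_integrable:
  fixes K :: "real ^ 'n \<Rightarrow> real"
  assumes K: "smooth K" "torus_periodic K" and w: "sq_integrable (slab T) w" and b: "\<And>i. sq_integrable (slab T) (b i)"
  shows "integrable (\<I> T) (\<lambda>t. mollified_flux K (\<lambda>x. w (t, x)) (\<lambda>i x. b i (t, x)) y)"
  unfolding mollified_flux_def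
  by (intro Bochner_Integration.integrable_sum Bochner_Integration.integrable_diff
      time_conv_integrable[where g = w] time_conv_integrable[where g = "\<lambda>p. w p * b _ p"]
      partial_deriv_K[OF K] partial_deriv2_K[OF K] sq_integrable_mult w b
      finite_measure.sq_integrable_imp_integrable[OF finite_measure_slab])

lemma mollified_flux_slab_integrable:
  fixes K :: "real ^ 'n \<Rightarrow> real"
  assumes K: "smooth K" "torus_periodic K" and w: "sq_integrable (slab T) w" and b: "\<And>i. sq_integrable (slab T) (b i)"
  shows "integrable (slab T) (\<lambda>p. mollified_flux K (\<lambda>x. w (fst p, x)) (\<lambda>i x. b i (fst p, x)) (snd p))"
  unfolding mollified_flux_def
  by (intro Bochner_Integration.integrable_sum Bochner_Integration.integrable_diff
      slab_conv_integrable[where g = w] slab_conv_integrable[where g = "\<lambda>p. w p * b _ p"]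
      partial_deriv_K[OF K] partial_deriv2_K[OF K] sq_integrable_mult w b
      finite_measure.sq_integrable_imp_integrable[OF finite_measure_slab])

text \<open>
  Testing with \<open>\<eta> t * K (y - x)\<close> turns the equation into the weak form of an ordinary differential
  equation for the mollified solution at the point \<open>y\<close>.
\<close>

lemma distributional_solution_mollified:
  fixes K :: "real ^ 'n \<Rightarrow> real" and b :: "real \<Rightarrow> real ^ 'n \<Rightarrow> real ^ 'n"
  assumes sol: "distributional_solution T b u0 u" and K: "smooth K" "torus_periodic K"
    and b': "\<And>i. sq_integrable (slab T) (b' i)"
    and rep: "\<And>i. AE t in \<I> T. AE x in \<T>. b t x $ i = b' i (t, x)"
    and u': "sq_integrable (slab T) u'"
    and repu: "AE t in \<I> T. AE x in \<T>. u t x = u' (t, x)"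
    and \<eta>: "smooth \<eta>" "\<And>t. (\<eta> has_real_derivative \<eta>' t) (at t)" "\<eta>' \<in> borel_measurable borel"
    and c: "0 < c" "c < T" "\<And>t. c \<le> t \<Longrightarrow> \<eta> t = 0"
  shows "(LINT t|\<I> T. \<eta>' t * conv (\<lambda>x. u' (t, x)) K y
      + \<eta> t * mollified_flux K (\<lambda>x. u' (t, x)) (\<lambda>i x. b' i (t, x)) y) = - \<eta> 0 * conv u0 K y"
proof -
  let ?U = "\<lambda>t. conv (\<lambda>x. u' (t, x)) K y" and ?F = "\<lambda>t. mollified_flux K (\<lambda>x. u' (t, x)) (\<lambda>i x. b' i (t, x)) y"
  let ?\<phi> = "\<lambda>t x. \<eta> t * K (y - x)"
  note pK = partial_deriv_K[OF K] and pK2 = partial_deriv2_K[OF K]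
  have Kc: "continuous_on UNIV K" by (rule smooth_continuous[OF K(1)])
  have U: "integrable (\<I> T) ?U"
    by (intro time_conv_integrable K Kc finite_measure.sq_integrable_imp_integrable[OF finite_measure_slab] u')
  have F: "integrable (\<I> T) ?F"
    by (rule mollified_flux_time_integrable[OF K u' b'])
  have "test_function {0..<T} ?\<phi>"
    by (rule test_function_product[OF \<eta>(1) K, of "{0..c}"]) (use c in auto)
  with sol have "(LINT t|\<I> T. LINT x|\<T>.
        u t x * (deriv (\<lambda>s. ?\<phi> s x) t + b t x \<bullet> grad (?\<phi> t) x + laplacian (?\<phi> t) x))
     + (LINT x|\<T>. u0 x * ?\<phi> 0 x) = 0"
    unfolding distributional_solution_def by blast
  moreover have "(LINT x|\<T>. u0 x * ?\<phi> 0 x) = \<eta> 0 * conv u0 K y"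
    unfolding conv_def by (subst integral_mult_right_zero[symmetric]) (simp add: mult_ac)
  moreover have "(LINT t|\<I> T. LINT x|\<T>.
        u t x * (deriv (\<lambda>s. ?\<phi> s x) t + b t x \<bullet> grad (?\<phi> t) x + laplacian (?\<phi> t) x))
      = (LINT t|\<I> T. \<eta>' t * ?U t + \<eta> t * ?F t)"
  proof (rule time_integral_AE)
    show "(\<lambda>t. \<eta>' t * ?U t + \<eta> t * ?F t) \<in> borel_measurable (\<I> T)"
      by (intro borel_measurable_add borel_measurable_times[OF interval_borel_measurable]
          borel_measurable_continuous_onI smooth_continuous \<eta> borel_measurable_integrable[OF U] borel_measurable_integrable[OF F])
    have "AE t in \<I> T. \<forall>i. AE x in \<T>. b t x $ i = b' i (t, x)"
      unfolding AE_all_countable using rep by blast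
    moreover have "AE t in \<I> T. \<forall>i. sq_integrable \<T> (\<lambda>x. b' i (t, x))"
      unfolding AE_all_countable using slab_slices[OF b'] by blast
    ultimately show "AE t in \<I> T. \<eta>' t * ?U t + \<eta> t * ?F t = (LINT x|\<T>.
        u t x * (deriv (\<lambda>s. ?\<phi> s x) t + b t x \<bullet> grad (?\<phi> t) x + laplacian (?\<phi> t) x))"
      using repu slab_slices[OF u']
    proof eventually_elim
      case (elim t)
      let ?u = "\<lambda>x. u' (t, x)"
      have u1: "integrable \<T> ?u" by (rule torus.sq_integrable_imp_integrable[OF elim(4)])
      have i0: "integrable \<T> (\<lambda>x. ?u x * K (y - x))"
        by (intro conv_integrable u1 K Kc)
      have i2: "integrable \<T> (\<lambda>x. ?u x * partial_deriv i (partial_deriv i K) (y - x))" for i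
        by (intro conv_integrable u1 pK2)
      have i1: "integrable \<T> (\<lambda>x. ?u x * b' i (t, x) * partial_deriv i K (y - x))" for i
        by (intro conv_integrable sq_integrable_mult elim(4) elim(2)[rule_format] pK)
      let ?G = "\<lambda>x. \<eta>' t * (?u x * K (y - x)) + \<eta> t * (\<Sum>i\<in>UNIV. ?u x * partial_deriv i (partial_deriv i K) (y - x) - ?u x * b' i (t, x) * partial_deriv i K (y - x))"
      have int: "integrable \<T> ?G"
        by (intro Bochner_Integration.integrable_add integrable_mult_right Bochner_Integration.integrable_sum
            Bochner_Integration.integrable_diff i0 i1 i2)
      have eq: "\<eta>' t * ?U t + \<eta> t * ?F t = (LINT x|\<T>. ?G x)"
        using i0 i1 i2 unfolding mollified_flux_def conv_def by simp
      have "(LINT x|\<T>. u t x * (deriv (\<lambda>s. ?\<phi> s x) t + b t x \<bullet> grad (?\<phi> t) x + laplacian (?\<phi> t) x)) = (LINT x|\<T>. ?G x)"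
      proof (rule torus_integral_AE[OF borel_measurable_integrable[OF int]])
        have "AE x in \<T>. \<forall>i. b t x $ i = b' i (t, x)"
          unfolding AE_all_countable using elim(1) .
        then show "AE x in \<T>. ?G x = u t x * (deriv (\<lambda>s. ?\<phi> s x) t + b t x \<bullet> grad (?\<phi> t) x + laplacian (?\<phi> t) x)"
          using elim(3)
        proof eventually_elim
          case (elim x)
          have "deriv (\<lambda>s. ?\<phi> s x) t = \<eta>' t * K (y - x)"
            by (intro DERIV_imp_deriv DERIV_cmult_right \<eta>)
          then show ?case
            unfolding inner_grad_product[OF \<eta>(1) K] laplacian_product[OF \<eta>(1) K]
            using elim by (simp add: algebra_simps sum_subtractf sum_distrib_left sum_negf)
        qed
      qed
      with eq show ?case by simp
    qed
  qed
  ultimately show ?thesis by simp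
qed

lemma weak_gradient_representative:
  fixes f :: "real ^ 'n \<Rightarrow> real"
  assumes G: "weak_gradient f G" and f: "AE x in \<T>. f x = f' x" "sq_integrable \<T> f'"
    and g: "\<And>i. AE x in \<T>. G x $ i = g i x" "\<And>i. sq_integrable \<T> (g i)"
    and \<psi>: "smooth \<psi>" "torus_periodic \<psi>"
  shows "(LINT x|\<T>. f' x * partial_deriv i \<psi> x) = - (LINT x|\<T>. g i x * \<psi> x)"
proof -
  have "(LINT x|\<T>. f x * partial_deriv i \<psi> x) = (LINT x|\<T>. f' x * partial_deriv i \<psi> x)"
    by (rule torus_integral_AE[OF borel_measurable_times[OF sq_integrable_measurable[OF f(2)]
            torus_borel_cont[OF partial_deriv_K(3)[OF \<psi>]]]])
      (use f(1) in \<open>auto elim!: eventually_mono\<close>)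
  moreover have "(LINT x|\<T>. (G x $ i) * \<psi> x) = (LINT x|\<T>. g i x * \<psi> x)"
    by (rule torus_integral_AE[OF borel_measurable_times[OF sq_integrable_measurable[OF g(2)]
            torus_borel_cont[OF smooth_continuous[OF \<psi>(1)]]]])
      (use g(1)[of i] in \<open>auto elim!: eventually_mono\<close>)
  ultimately show ?thesis using G \<psi> unfolding weak_gradient_def by metis
qed

lemma mollified_flux_diff:
  fixes K :: "real ^ 'n \<Rightarrow> real"
  assumes K: "smooth K" "torus_periodic K" and f: "sq_integrable \<T> f" and g: "sq_integrable \<T> g"
    and b: "\<And>i. sq_integrable \<T> (b i)"
  shows "mollified_flux K (\<lambda>x. f x - g x) b y = mollified_flux K f b y - mollified_flux K g b y"
proof -
  note i = torus.sq_integrable_imp_integrable[OF f] torus.sq_integrable_imp_integrable[OF g]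
  have A: "conv (\<lambda>x. (f x - g x) * b i x) (partial_deriv i K) y = conv (\<lambda>x. f x * b i x) (partial_deriv i K) y - conv (\<lambda>x. g x * b i x) (partial_deriv i K) y" for i
    unfolding left_diff_distrib by (intro conv_diff sq_integrable_mult f g b partial_deriv_K[OF K])
  have B: "conv (\<lambda>x. f x - g x) (partial_deriv i (partial_deriv i K)) y
      = conv f (partial_deriv i (partial_deriv i K)) y - conv g (partial_deriv i (partial_deriv i K)) y" for i
    by (intro conv_diff i partial_deriv2_K[OF K])
  show ?thesis
    unfolding mollified_flux_def A B by (simp add: sum_subtractf)
qed

text \<open>
  The exceptional null set of times depends on \<open>n\<close> and \<open>y\<close>. Countably many \<open>y\<close> are enough, since the
  mollified divergence is continuous in \<open>y\<close>.
\<close>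

lemma AE_divergence_free_mollified:
  fixes K :: "nat \<Rightarrow> real ^ 'n \<Rightarrow> real" and b :: "real \<Rightarrow> real ^ 'n \<Rightarrow> real ^ 'n"
  assumes div: "divergence_free T b" and K: "\<And>n. smooth (K n)" "\<And>n. torus_periodic (K n)"
    and b': "\<And>i. sq_integrable (slab T) (b' i)"
    and rep: "\<And>i. AE t in \<I> T. AE x in \<T>. b t x $ i = b' i (t, x)"
  shows "AE t in \<I> T. \<forall>n y. (\<Sum>i\<in>UNIV. conv (\<lambda>x. b' i (t, x)) (partial_deriv i (K n)) y) = 0"
proof -
  obtain D :: "(real ^ 'n) set" where D: "countable D" "\<And>X. open X \<Longrightarrow> X \<noteq> {} \<Longrightarrow> \<exists>d\<in>D. d \<in> X"
    using countable_dense_setE by blast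
  have "AE t in \<I> T. \<forall>n. \<forall>y\<in>D. (\<Sum>i\<in>UNIV. conv (\<lambda>x. b' i (t, x)) (partial_deriv i (K n)) y) = 0"
    unfolding AE_all_countable AE_ball_countable[OF D(1)]
    using divergence_free_mollified[OF div K b' rep] by blast
  moreover have "AE t in \<I> T. \<forall>i. sq_integrable \<T> (\<lambda>x. b' i (t, x))"
    unfolding AE_all_countable using slab_slices[OF b'] by blast
  ultimately show ?thesis
  proof eventually_elim
    case (elim t)
    show ?case
    proof (intro allI)
      fix n y
      let ?f = "\<lambda>y. \<Sum>i\<in>UNIV. conv (\<lambda>x. b' i (t, x)) (partial_deriv i (K n)) y"
      have "continuous_on UNIV ?f"
        by (intro continuous_on_sum continuous_conv partial_deriv_K[OF K] torus.sq_integrable_imp_integrable elim(2)[rule_format])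
      \<comment> \<open>A nonempty open set on which the divergence does not vanish would contain a point of \<open>D\<close>.\<close>
      then have "open (?f -` (- {0}))"
        by (intro open_vimage open_Compl) auto
      then have "?f -` (- {0}) = {}"
        using D(2)[of "?f -` (- {0})"] elim(1) by auto
      then show "?f y = 0" by auto
    qed
  qed
qed

section \<open>The energy inequality and uniqueness\<close>

text \<open>
  The production terms \<open>a n\<close> are controlled from above only, as the dissipation was dropped; so only their
  positive parts tend to zero.
\<close>

lemma integral_max_0_tendsto:
  fixes a :: "nat \<Rightarrow> 'a \<Rightarrow> real"
  assumes a: "\<And>n. integrable M (a n)" and D: "integrable M D"
    and le: "AE t in M. (\<forall>n. a n t \<le> c t n) \<and> (\<forall>n. \<bar>c t n\<bar> \<le> D t) \<and> (c t \<longlonglongrightarrow> 0)"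
  shows "(\<lambda>n. LINT t|M. max 0 (a n t)) \<longlonglongrightarrow> 0"
proof -
  have "(\<lambda>n. LINT t|M. max 0 (a n t)) \<longlonglongrightarrow> (LINT t|M. 0)"
  proof (rule integral_dominated_convergence[where w = D])
    show "AE t in M. (\<lambda>n. max 0 (a n t)) \<longlonglongrightarrow> 0"
      using le
    proof eventually_elim
      case (elim t)
      have "(\<lambda>n. \<bar>c t n\<bar>) \<longlonglongrightarrow> 0" using elim by (intro tendsto_rabs_zero) auto
      moreover have "\<forall>\<^sub>F n in sequentially. norm (max 0 (a n t)) \<le> \<bar>c t n\<bar>"
      proof (rule always_eventually, rule allI)
        fix n
        have "a n t \<le> c t n" using elim by blast
        then show "norm (max 0 (a n t)) \<le> \<bar>c t n\<bar>" by (auto simp: max_def)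
      qed
      ultimately show ?case by (rule Lim_null_comparison[rotated])
    qed
    show "AE t in M. norm (max 0 (a n t)) \<le> D t" for n
      using le
    proof eventually_elim
      case (elim t)
      then have "a n t \<le> c t n" "\<bar>c t n\<bar> \<le> D t" by auto
      then show ?case by (auto simp: max_def)
    qed
    show "(\<lambda>t. max 0 (a n t)) \<in> borel_measurable M" for n
      by (intro borel_measurable_max borel_measurable_const borel_measurable_integrable[OF a])
  qed (use D in auto)
  then show ?thesis by simp
qed

lemma slab_primitive_measurable:
  assumes F: "F \<in> borel_measurable (slab T :: (real \<times> (real ^ 'n)) measure)"
  shows "(\<lambda>p. primitive T (\<lambda>s. F (s, snd p)) (fst p)) \<in> borel_measurable (slab T)"
  unfolding primitive_def
proof (rule time.borel_measurable_lebesgue_integral)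
  let ?M = "(slab T :: (real \<times> (real ^ 'n)) measure) \<Otimes>\<^sub>M \<I> T"
  have id: "(\<lambda>x. x) \<in> borel_measurable (\<I> T)"
    by (intro interval_borel_measurable) simp
  have m1: "(\<lambda>q. fst (fst q)) \<in> borel_measurable ?M"
    by (rule measurable_compose[OF measurable_compose[OF measurable_fst measurable_fst] id])
  have m2: "(\<lambda>q. snd q) \<in> borel_measurable ?M"
    by (rule measurable_compose[OF measurable_snd id])
  have sets: "{q \<in> space ?M. snd q \<le> fst (fst q)} \<in> sets ?M"
    by (rule borel_measurable_le[OF m2 m1])
  have "(\<lambda>q. indicator {q \<in> space ?M. snd q \<le> fst (fst q)} q :: real) \<in> borel_measurable ?M"
    by (rule borel_measurable_indicator[OF sets])
  then have ind: "(\<lambda>q. indicator {..fst (fst q)} (snd q) :: real) \<in> borel_measurable ?M"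
    by (rule measurable_cong[THEN iffD1, rotated]) (auto simp: indicator_def)
  have "(\<lambda>q. (snd q, snd (fst q))) \<in> ?M \<rightarrow>\<^sub>M slab T"
    by (intro measurable_Pair measurable_snd measurable_compose[OF measurable_fst measurable_snd])
  from borel_measurable_times[OF ind measurable_compose[OF this F]]
  show "(\<lambda>(p, s). indicator {..fst p} s * F (s, snd p)) \<in> borel_measurable ?M"
    by (simp only: case_prod_unfold)
qed

text \<open>
  The equation in time holds for each \<open>y\<close> at almost every time; joint measurability of the
  primitive exchanges the two quantifiers. Then the pointwise inequality is integrated over the torus, and
  Fubini's theorem brings the time integral to the outside.
\<close>

lemma energy_inequality:
  fixes W F :: "real \<times> (real ^ 'n) \<Rightarrow> real"
  assumes W: "integrable (slab T) W" and F: "integrable (slab T) F"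
    and Fy: "\<And>y. integrable (\<I> T) (\<lambda>s. F (s, y))"
    and eq: "\<And>y. AE t in \<I> T. W (t, y) = primitive T (\<lambda>s. F (s, y)) t"
  shows "AE t in \<I> T. (LINT y|\<T>. soft_abs (W (t, y)))
    \<le> (LINT s|\<I> T. max 0 (LINT y|\<T>. soft_sgn (W (s, y)) * F (s, y)))"
proof -
  let ?I = "\<I> T" and ?V = "\<lambda>t y. primitive T (\<lambda>s. F (s, y)) t"
  have Wm: "W \<in> borel_measurable (slab T)" and Fm: "F \<in> borel_measurable (slab T)" using W F by auto
  have Vm: "(\<lambda>p. ?V (fst p) (snd p)) \<in> borel_measurable (slab T)"
    by (rule slab_primitive_measurable[OF Fm])
  have eq': "AE t in ?I. AE y in \<T>. W (t, y) = ?V t y"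
  proof (subst slab.AE_commute)
    show "{p \<in> space (slab T). W (fst p, snd p) = ?V (fst p) (snd p)} \<in> sets (slab T)"
      using borel_measurable_eq[OF Wm Vm] by simp
    show "AE y in \<T>. AE t in ?I. W (t, y) = ?V t y" using eq by simp
  qed
  have sgnF: "integrable (slab T) (\<lambda>p. F p * soft_sgn (W p))"
    by (rule integrable_mult_bounded[OF F soft_sgn_measurable[OF Wm] soft_sgn_bounded])
  have a: "integrable ?I (\<lambda>s. LINT y|\<T>. soft_sgn (W (s, y)) * F (s, y))"
    using slab.integrable_fst'[OF sgnF] by (simp add: mult.commute)
  have slice: "AE t in ?I. integrable \<T> (\<lambda>y. W (t, y))"
    by (rule slab.AE_integrable_fst'[OF W])
  show ?thesis
    using eq' slice AE_interval_neq[of 0 T] AE_space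
  proof eventually_elim
    case (elim t)
    have t: "0 < t" "t \<le> T" using elim by auto
    define H where "H s y = indicator {..t} s * (soft_sgn (?V s y) * F (s, y))" for s y
    have indm: "(\<lambda>p. indicator {..t} (fst p) :: real) \<in> borel_measurable (slab T)"
      by (rule measurable_compose[OF measurable_fst interval_borel_measurable]) simp
    have sV: "(\<lambda>p. soft_sgn (?V (fst p) (snd p))) \<in> borel_measurable (slab T)"
      by (rule soft_sgn_measurable[OF Vm])
    have H: "integrable (slab T) (case_prod H)"
    proof -
      have "integrable (slab T) (\<lambda>p. F p * (indicator {..t} (fst p) * soft_sgn (?V (fst p) (snd p))))"
        by (rule integrable_mult_bounded[OF F borel_measurable_times[OF indm sV], where B = 1])
          (use soft_sgn_bounded in \<open>auto simp: indicator_def\<close>)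
      then show ?thesis by (simp add: H_def case_prod_unfold mult_ac)
    qed
    have "(LINT y|\<T>. soft_abs (W (t, y))) \<le> (LINT y|\<T>. LINT s|?I. H s y)"
    proof (rule integral_mono_AE)
      show "integrable \<T> (\<lambda>y. soft_abs (W (t, y)))"
        by (rule soft_abs_integrable[OF elim(2)])
      show "integrable \<T> (\<lambda>y. LINT s|?I. H s y)"
        by (rule slab.integrable_snd[OF H])
      show "AE y in \<T>. soft_abs (W (t, y)) \<le> (LINT s|?I. H s y)"
        using elim(1)
      proof eventually_elim
        case (elim y)
        then show ?case
          using soft_abs_primitive_le[OF Fy t, of y] by (simp add: H_def)
      qed
    qed
    also have "\<dots> = (LINT s|?I. LINT y|\<T>. H s y)"
      by (rule slab.Fubini_integral[OF H])
    also have "\<dots> \<le> (LINT s|?I. max 0 (LINT y|\<T>. soft_sgn (W (s, y)) * F (s, y)))"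
    proof (rule integral_mono_AE)
      show "integrable ?I (\<lambda>s. LINT y|\<T>. H s y)"
        using slab.integrable_fst'[OF H] by simp
      show "integrable ?I (\<lambda>s. max 0 (LINT y|\<T>. soft_sgn (W (s, y)) * F (s, y)))"
        by (intro integrable_max a) simp
      show "AE s in ?I. (LINT y|\<T>. H s y) \<le> max 0 (LINT y|\<T>. soft_sgn (W (s, y)) * F (s, y))"
        using eq' slab.AE_integrable_fst'[OF sgnF]
      proof eventually_elim
        case (elim s)
        have m: "(\<lambda>y. indicator {..t} s * (soft_sgn (W (s, y)) * F (s, y))) \<in> borel_measurable \<T>"
          using borel_measurable_integrable[OF elim(2)] by (intro borel_measurable_times[OF borel_measurable_const]) (simp add: mult.commute)
        have "(LINT y|\<T>. H s y) = (LINT y|\<T>. indicator {..t} s * (soft_sgn (W (s, y)) * F (s, y)))"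
        proof (rule torus_integral_AE[OF m])
          show "AE y in \<T>. indicator {..t} s * (soft_sgn (W (s, y)) * F (s, y)) = H s y"
            using elim(1) by eventually_elim (simp add: H_def)
        qed
        also have "\<dots> = indicator {..t} s * (LINT y|\<T>. soft_sgn (W (s, y)) * F (s, y))" by simp
        also have "\<dots> \<le> max 0 (LINT y|\<T>. soft_sgn (W (s, y)) * F (s, y))"
          by (simp add: indicator_def)
        finally show ?case .
      qed
    qed
    finally show ?case .
  qed
qed

theorem theorem2p7:
  fixes T :: real
    and b :: "real \<Rightarrow> real ^ 'n \<Rightarrow> real ^ 'n"
    and u0 :: "real ^ 'n \<Rightarrow> real"
    and u v :: "real \<Rightarrow> real ^ 'n \<Rightarrow> real"
  assumes "T > 0"
    and "in_L2_L2 T b"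
    and "divergence_free T b"
    and "in_L2 u0"
    and "parabolic_solution T b u0 u"
    and "parabolic_solution T b u0 v"
  shows "AE (t, x) in spacetime_measure T. u t x = v t x"
proof -
  let ?I = "\<I> T"
  have real_id: "(\<lambda>v :: real. v) \<in> borel_measurable borel" "\<And>v :: real. \<bar>v\<bar> \<le> norm v" by auto
  have coord_meas: "(\<lambda>v :: real ^ 'n. v $ i) \<in> borel_measurable borel" for i
    by (intro borel_measurable_continuous_onI continuous_intros)
  have coord_le: "\<bar>v $ i\<bar> \<le> norm v" for i and v :: "real ^ 'n"
    by (rule component_le_norm_cart)
  have ex_sol: "\<exists>g dg. g \<in> borel_measurable borel \<and> sq_integrable (slab T) g \<and>
      (AE p in spacetime_measure T. z (fst p) (snd p) = g p) \<and>
      (AE t in ?I. AE x in \<T>. z t x = g (t, x)) \<and> (\<forall>i. sq_integrable (slab T) (dg i)) \<and>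
      (AE t in ?I. \<forall>\<psi> i. smooth \<psi> \<longrightarrow> torus_periodic \<psi> \<longrightarrow>
         (LINT x|\<T>. g (t, x) * partial_deriv i \<psi> x) = - (LINT x|\<T>. dg i (t, x) * \<psi> x))"
    if z: "parabolic_solution T b u0 z" for z
  proof -
    have zL: "in_L2_L2 T z" using z by (simp add: parabolic_solution_def in_L2_H1_def)
    obtain G where GL: "in_L2_L2 T G" and G: "AE t in ?I. weak_gradient (z t) (G t)"
      using z unfolding parabolic_solution_def in_L2_H1_def by blast
    obtain g where g: "g \<in> borel_measurable borel" "sq_integrable (slab T) g"
      "AE p in spacetime_measure T. z (fst p) (snd p) = g p" "AE t in ?I. AE x in \<T>. z t x = g (t, x)"
      using L2_representative[OF zL real_id] by blast
    have "\<exists>d. sq_integrable (slab T) d \<and> (AE t in ?I. AE x in \<T>. G t x $ i = d (t, x))" for i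
      using L2_representative[OF GL coord_meas coord_le] by blast
    then have "\<exists>dg. \<forall>i. sq_integrable (slab T) (dg i) \<and> (AE t in ?I. AE x in \<T>. G t x $ i = dg i (t, x))"
      by (intro choice allI)
    then obtain dg where dg: "\<And>i. sq_integrable (slab T) (dg i)" "\<And>i. AE t in ?I. AE x in \<T>. G t x $ i = dg i (t, x)"
      by blast
    have "AE t in ?I. \<forall>i. AE x in \<T>. G t x $ i = dg i (t, x)"
      unfolding AE_all_countable using dg(2) by blast
    moreover have "AE t in ?I. \<forall>i. sq_integrable \<T> (\<lambda>x. dg i (t, x))"
      unfolding AE_all_countable using slab_slices[OF dg(1)] by blast
    ultimately have "AE t in ?I. \<forall>\<psi> i. smooth \<psi> \<longrightarrow> torus_periodic \<psi> \<longrightarrow>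
         (LINT x|\<T>. g (t, x) * partial_deriv i \<psi> x) = - (LINT x|\<T>. dg i (t, x) * \<psi> x)"
      using G g(4) slab_slices[OF g(2)]
    proof eventually_elim
      case (elim t)
      show ?case
      proof (intro allI impI)
        fix \<psi> :: "real ^ 'n \<Rightarrow> real" and i assume \<psi>: "smooth \<psi>" "torus_periodic \<psi>"
        show "(LINT x|\<T>. g (t, x) * partial_deriv i \<psi> x) = - (LINT x|\<T>. dg i (t, x) * \<psi> x)"
          by (rule weak_gradient_representative[OF elim(3,4,5) _ _ \<psi>]) (use elim(1,2) in auto)
      qed
    qed
    with g dg(1) show ?thesis by blast
  qed
  obtain u' du where u': "u' \<in> borel_measurable borel" "sq_integrable (slab T) u'"
    "AE p in spacetime_measure T. u (fst p) (snd p) = u' p" "AE t in ?I. AE x in \<T>. u t x = u' (t, x)"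
    and du: "\<And>i. sq_integrable (slab T) (du i)"
    and u_weak: "AE t in ?I. \<forall>\<psi> i. smooth \<psi> \<longrightarrow> torus_periodic \<psi> \<longrightarrow>
       (LINT x|\<T>. u' (t, x) * partial_deriv i \<psi> x) = - (LINT x|\<T>. du i (t, x) * \<psi> x)"
    using ex_sol[OF assms(5)] by blast
  obtain v' dv where v': "v' \<in> borel_measurable borel" "sq_integrable (slab T) v'"
    "AE p in spacetime_measure T. v (fst p) (snd p) = v' p" "AE t in ?I. AE x in \<T>. v t x = v' (t, x)"
    and dv: "\<And>i. sq_integrable (slab T) (dv i)"
    and v_weak: "AE t in ?I. \<forall>\<psi> i. smooth \<psi> \<longrightarrow> torus_periodic \<psi> \<longrightarrow>
       (LINT x|\<T>. v' (t, x) * partial_deriv i \<psi> x) = - (LINT x|\<T>. dv i (t, x) * \<psi> x)"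
    using ex_sol[OF assms(6)] by blast
  have "\<exists>d. sq_integrable (slab T) d \<and> (AE t in ?I. AE x in \<T>. b t x $ i = d (t, x))" for i
    using L2_representative[OF assms(2) coord_meas coord_le] by blast
  then have "\<exists>b'. \<forall>i. sq_integrable (slab T) (b' i) \<and> (AE t in ?I. AE x in \<T>. b t x $ i = b' i (t, x))"
    by (intro choice allI)
  then obtain b' where b': "\<And>i. sq_integrable (slab T) (b' i)" "\<And>i. AE t in ?I. AE x in \<T>. b t x $ i = b' i (t, x)"
    by blast
  obtain K :: "nat \<Rightarrow> real ^ 'n \<Rightarrow> real" where K: "approx_identity K"
    using ex_approx_identity by blast
  have k: "smooth (K n)" "torus_periodic (K n)" "continuous_on UNIV (K n)" for n
    using kernelD[OF kernel_of_approx_identity[OF K]] by auto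
  define w where "w p = u' p - v' p" for p
  define G where "G i p = du i p - dv i p" for i p
  have w: "sq_integrable (slab T) w" and G: "sq_integrable (slab T) (G i)" for i
    unfolding w_def G_def by (intro sq_integrable_diff u' v' du dv)+
  define W where "W n p = conv (\<lambda>x. w (fst p, x)) (K n) (snd p)" for n p
  define F where "F n p = mollified_flux (K n) (\<lambda>x. w (fst p, x)) (\<lambda>i x. b' i (fst p, x)) (snd p)" for n p
  have w1: "integrable (slab T) w"
    by (rule finite_measure.sq_integrable_imp_integrable[OF finite_measure_slab w])
  have W_int: "integrable (slab T) (W n)" for n
    unfolding W_def by (intro slab_conv_integrable w1 k)
  have F_int: "integrable (slab T) (F n)" for n
    unfolding F_def by (intro mollified_flux_slab_integrable k w b')
  have Fy: "integrable ?I (\<lambda>s. F n (s, y))" for n y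
    unfolding F_def fst_conv snd_conv by (intro mollified_flux_time_integrable k w b')

  have b_slices: "AE t in ?I. \<forall>i. sq_integrable \<T> (\<lambda>x. b' i (t, x))"
    unfolding AE_all_countable using slab_slices[OF b'(1)] by blast
  have G_slices: "AE t in ?I. \<forall>i. sq_integrable \<T> (\<lambda>x. G i (t, x))"
    unfolding AE_all_countable using slab_slices[OF G] by blast
  have du_slices: "AE t in ?I. \<forall>i. sq_integrable \<T> (\<lambda>x. du i (t, x))"
    unfolding AE_all_countable using slab_slices[OF du] by blast
  have dv_slices: "AE t in ?I. \<forall>i. sq_integrable \<T> (\<lambda>x. dv i (t, x))"
    unfolding AE_all_countable using slab_slices[OF dv] by blast
  have weak: "AE t in ?I. \<forall>\<psi> i. smooth \<psi> \<longrightarrow> torus_periodic \<psi> \<longrightarrow>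
       (LINT x|\<T>. w (t, x) * partial_deriv i \<psi> x) = - (LINT x|\<T>. G i (t, x) * \<psi> x)"
    using u_weak v_weak slab_slices[OF u'(2)] slab_slices[OF v'(2)] du_slices dv_slices
  proof eventually_elim
    case (elim t)
    show ?case
    proof (intro allI impI)
      fix \<psi> :: "real ^ 'n \<Rightarrow> real" and i assume \<psi>: "smooth \<psi>" "torus_periodic \<psi>"
      have s: "sq_integrable \<T> \<psi>" "sq_integrable \<T> (partial_deriv i \<psi>)"
        by (intro sq_integrable_continuous \<psi> smooth_continuous partial_deriv_K[OF \<psi>])+
      show "(LINT x|\<T>. w (t, x) * partial_deriv i \<psi> x) = - (LINT x|\<T>. G i (t, x) * \<psi> x)"
        using elim(1)[rule_format, OF \<psi>, of i] elim(2)[rule_format, OF \<psi>, of i]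
          sq_integrable_mult[OF elim(3) s(2)] sq_integrable_mult[OF elim(4) s(2)]
          sq_integrable_mult[OF elim(5)[rule_format, of i] s(1)] sq_integrable_mult[OF elim(6)[rule_format, of i] s(1)]
        by (simp add: w_def G_def left_diff_distrib)
    qed
  qed
  have div: "AE t in ?I. \<forall>n y. (\<Sum>i\<in>UNIV. conv (\<lambda>x. b' i (t, x)) (partial_deriv i (K n)) y) = 0"
    by (rule AE_divergence_free_mollified[OF assms(3) k(1,2) b'])

  have ode: "AE t in ?I. W n (t, y) = primitive T (\<lambda>s. F n (s, y)) t" for n y
  proof (rule AE_eq_primitive[OF _ Fy])
    show Wy: "integrable ?I (\<lambda>t. W n (t, y))"
      unfolding W_def fst_conv snd_conv by (intro time_conv_integrable w1 k)
    fix m c assume c: "0 < c" "c < T"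
    let ?\<eta> = "cutoff (real m) c" and ?\<eta>' = "\<lambda>t. - flat [:1, 1:] (real m * (c - t))"
    have \<eta>'m: "?\<eta>' \<in> borel_measurable borel"
      by (intro borel_measurable_continuous_onI continuous_on_minus
          continuous_on_compose2[OF smooth_continuous[OF smooth_flat]] continuous_intros) auto
    define A where "A z t = ?\<eta>' t * conv (\<lambda>x. z (t, x)) (K n) y
        + ?\<eta> t * mollified_flux (K n) (\<lambda>x. z (t, x)) (\<lambda>i x. b' i (t, x)) y" for z :: "real \<times> (real ^ 'n) \<Rightarrow> real" and t
    \<comment> \<open>Both solutions have the same initial term, which therefore cancels in the difference.\<close>
    have Au: "(LINT t|?I. A u' t) = - ?\<eta> 0 * conv u0 (K n) y"
      unfolding A_def
      by (rule distributional_solution_mollified[OF _ k(1,2) b' u'(2,4) smooth_cutoff cutoff_DERIV \<eta>'m c])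
        (use assms(5) cutoff_eq_0 in \<open>auto simp: parabolic_solution_def\<close>)
    have Av: "(LINT t|?I. A v' t) = - ?\<eta> 0 * conv u0 (K n) y"
      unfolding A_def
      by (rule distributional_solution_mollified[OF _ k(1,2) b' v'(2,4) smooth_cutoff cutoff_DERIV \<eta>'m c])
        (use assms(6) cutoff_eq_0 in \<open>auto simp: parabolic_solution_def\<close>)
    have A_int: "integrable ?I (A z)" if z: "sq_integrable (slab T) z" for z
    proof -
      have 1: "integrable ?I (\<lambda>t. conv (\<lambda>x. z (t, x)) (K n) y)"
        by (intro time_conv_integrable k finite_measure.sq_integrable_imp_integrable[OF finite_measure_slab] z)
      have 2: "integrable ?I (\<lambda>t. mollified_flux (K n) (\<lambda>x. z (t, x)) (\<lambda>i x. b' i (t, x)) y)"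
        by (intro mollified_flux_time_integrable k z b')
      obtain B where B: "\<And>t. t \<in> {0..T} \<Longrightarrow> \<bar>?\<eta> t\<bar> \<le> B"
      proof -
        have "bounded (?\<eta> ` {0..T})"
          by (intro compact_imp_bounded compact_continuous_image
              continuous_on_subset[OF smooth_continuous[OF smooth_cutoff]]) auto
        then obtain B where "\<forall>x\<in>?\<eta> ` {0..T}. norm x \<le> B" unfolding bounded_iff by blast
        then show ?thesis by (intro that[of B]) auto
      qed
      have "integrable ?I (\<lambda>t. conv (\<lambda>x. z (t, x)) (K n) y * ?\<eta>' t)"
        by (rule integrable_mult_bounded[OF 1 interval_borel_measurable[OF \<eta>'m], where B = 1])
          (use flat_11_bounds in auto)
      moreover have "integrable ?I (\<lambda>t. mollified_flux (K n) (\<lambda>x. z (t, x)) (\<lambda>i x. b' i (t, x)) y * ?\<eta> t)"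
        by (rule integrable_mult_bounded[OF 2 interval_borel_measurable, where B = B])
          (use B in \<open>auto intro!: borel_measurable_continuous_onI smooth_continuous smooth_cutoff\<close>)
      ultimately show ?thesis by (simp add: A_def[abs_def] mult.commute)
    qed
    have "(LINT t|?I. ?\<eta>' t * W n (t, y) + ?\<eta> t * F n (t, y)) = (LINT t|?I. A u' t - A v' t)"
    proof (rule time_integral_AE)
      show "(\<lambda>t. A u' t - A v' t) \<in> borel_measurable ?I"
        by (intro borel_measurable_diff borel_measurable_integrable A_int u' v')
      show "AE t in ?I. A u' t - A v' t = ?\<eta>' t * W n (t, y) + ?\<eta> t * F n (t, y)"
        using slab_slices[OF u'(2)] slab_slices[OF v'(2)] b_slices
      proof eventually_elim
        case (elim t)
        have W_eq: "W n (t, y) = conv (\<lambda>x. u' (t, x)) (K n) y - conv (\<lambda>x. v' (t, x)) (K n) y"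
          unfolding W_def w_def fst_conv snd_conv
          by (intro conv_diff torus.sq_integrable_imp_integrable elim k)
        have F_eq: "F n (t, y) = mollified_flux (K n) (\<lambda>x. u' (t, x)) (\<lambda>i x. b' i (t, x)) y
            - mollified_flux (K n) (\<lambda>x. v' (t, x)) (\<lambda>i x. b' i (t, x)) y"
          unfolding F_def w_def fst_conv snd_conv
          by (intro mollified_flux_diff elim(1,2) elim(3)[rule_format] k)
        show ?case unfolding A_def W_eq F_eq right_diff_distrib by simp
      qed
    qed
    also have "\<dots> = 0" using A_int[OF u'(2)] A_int[OF v'(2)] Au Av by simp
    finally show "(LINT t|?I. - flat [:1, 1:] (real m * (c - t)) * W n (t, y) + cutoff (real m) c t * F n (t, y)) = 0" .
  qed

  define a where "a n s = (LINT y|\<T>. soft_sgn (W n (s, y)) * F n (s, y))" for n s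
  define \<delta> where "\<delta> n = (LINT s|?I. max 0 (a n s))" for n
  have energy: "AE t in ?I. \<forall>n. (LINT y|\<T>. soft_abs (W n (t, y))) \<le> \<delta> n"
    unfolding AE_all_countable \<delta>_def a_def using energy_inequality[OF W_int F_int Fy ode] by blast
  have a_int: "integrable ?I (a n)" for n
  proof -
    have "integrable (slab T) (\<lambda>p. F n p * soft_sgn (W n p))"
      using F_int W_int by (intro integrable_mult_bounded[where B = 1] soft_sgn_measurable soft_sgn_bounded) auto
    from slab.integrable_fst'[OF this] show ?thesis by (simp add: a_def[abs_def] mult.commute)
  qed
  define D where "D t = (LINT x|\<T>. (\<Sum>i\<in>UNIV. (b' i (t, x))\<^sup>2 + (G i (t, x))\<^sup>2))" for t
  have D: "integrable ?I D"
  proof -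
    have "integrable (slab T) (\<lambda>p. \<Sum>i\<in>UNIV. (b' i p)\<^sup>2 + (G i p)\<^sup>2)"
      using b'(1) G by (intro Bochner_Integration.integrable_sum Bochner_Integration.integrable_add) (auto simp: sq_integrable_def)
    from slab.integrable_fst'[OF this] show ?thesis by (simp add: D_def[abs_def])
  qed
  \<comment> \<open>The transport term \<open>?c\<close> bounds the production from above at almost every time.\<close>
  have "\<delta> \<longlonglongrightarrow> 0"
    unfolding \<delta>_def[abs_def]
  proof (rule integral_max_0_tendsto[OF a_int D])
    let ?c = "\<lambda>t n. - (LINT x|\<T>. (\<Sum>i\<in>UNIV. b' i (t, x) * G i (t, x)) * conv (\<lambda>y. soft_sgn (conv (\<lambda>x. w (t, x)) (K n) y)) (K n) x)"
    show "AE t in ?I. (\<forall>n. a n t \<le> ?c t n) \<and> (\<forall>n. \<bar>?c t n\<bar> \<le> D t) \<and> (?c t \<longlonglongrightarrow> 0)"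
      using b_slices G_slices slab_slices[OF w] weak div
    proof eventually_elim
      case (elim t)
      note h = K elim(1)[rule_format] elim(5)[rule_format] elim(3) elim(2)[rule_format] elim(4)[rule_format]
      have "a n t \<le> ?c t n" for n
        unfolding a_def W_def F_def fst_conv snd_conv by (rule soft_sgn_flux_le[OF h])
      moreover have "\<bar>?c t n\<bar> \<le> D t" for n
        unfolding D_def abs_minus_cancel by (rule commutator_bounded[OF h])
      moreover have "?c t \<longlonglongrightarrow> 0"
        using tendsto_minus[OF commutator_vanishes[OF h]] by simp
      ultimately show ?case by blast
    qed
  qed
  have "AE t in ?I. AE x in \<T>. w (t, x) = 0"
    using energy b_slices G_slices slab_slices[OF w] weak div
  proof eventually_elim
    case (elim t)
    note h = K elim(2)[rule_format] elim(6)[rule_format] elim(4) elim(3)[rule_format] elim(5)[rule_format]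
    have "(\<lambda>n. LINT x|\<T>. soft_abs (W n (t, x))) \<longlonglongrightarrow> (LINT x|\<T>. soft_abs (w (t, x)))"
      unfolding W_def fst_conv snd_conv by (rule soft_abs_mollified_tendsto[OF h])
    then have "(LINT x|\<T>. soft_abs (w (t, x))) \<le> 0"
      by (rule LIMSEQ_le[OF _ \<open>\<delta> \<longlonglongrightarrow> 0\<close>]) (use elim(1) in auto)
    moreover have int: "integrable \<T> (\<lambda>x. soft_abs (w (t, x)))"
      by (intro soft_abs_integrable torus.sq_integrable_imp_integrable elim(4))
    moreover have "0 \<le> (LINT x|\<T>. soft_abs (w (t, x)))" by (simp add: soft_abs_nonneg)
    ultimately have "AE x in \<T>. soft_abs (w (t, x)) = 0"
      using integral_nonneg_eq_0_iff_AE[OF int] by (simp add: soft_abs_nonneg)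
    then show ?case by (simp add: soft_abs_eq_0_iff)
  qed
  then have "AE p in spacetime_measure T. w p = 0"
    by (intro AE_spacetime_of_slab) (auto simp: w_def[abs_def] intro!: borel_measurable_diff u' v')
  with u'(3) v'(3) show ?thesis
    by eventually_elim (auto simp: w_def)
qed

end
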